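(* Let $\mathcal{E}$ be a weakly idempotent complete exact category with enough injective and projective objects. Assume that $\mathcal{M}\subseteq\mathcal{E}$ is a rigid, contravariantly finite full subcategory of $\mathcal{E}$ containing all the injective objects, stable under taking direct sums and summands, and such that $\mho\mathcal{M}$ is contravariantly finite. Then there exist two classes of morphisms $\mathrm{Fib}$ and $\mathcal{W}$, where $\mathcal{W}$ is the class of morphisms $f$ such that $Gf$ is an isomorphism, such that $(\mathcal{E},\mathrm{Fib},\mathcal{W})$ has a prefibration structure in the sense of Anderson–Brown–Cisinski. All the objects are fibrant, and an object is cofibrant if and only if it belongs to $\mathrm{pr}\mathcal{M}$. Moreover, under the assumption that $\mathcal{M}$ contains the projective objects, every object of $\mathcal{E}$ has a cofibrant replacement.
   Context: An exact category is weakly idempotent complete if every retraction has a kernel. $\mathcal{M}$ is rigid if $\mathrm{Ext}^1_{\mathcal{E}}(M,M')=0$ for all $M,M'\in\mathcal{M}$. A class of objects $\mathcal{A}$ is contravariantly finite if every $X\in\mathcal{E}$ admits a morphism $A\to X$ with $A\in\mathcal{A}$ through which every morphism $A'\to X$ with $A'\in\mathcal{A}$ factors. $\mathrm{pr}\mathcal{M}$ is the class of objects $X$ with a short exact sequence $0\to M_1\to M_0\to X\to 0$, $M_0,M_1\in\mathcal{M}$. $\mho\mathcal{M}$ is the class of objects $X$ with a short exact sequence $0\to M\to I\to X\to0$, $M\in\mathcal{M}$, $I$ injective. $\overline{\mathcal{E}}$ is the quotient of $\mathcal{E}$ by the ideal of morphisms factoring through injectives, $\overline{\mathcal{M}}$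 its full subcategory on $\mathcal{M}$, $\mathrm{Mod}\,\overline{\mathcal{M}}$ the category of additive contravariant functors from $\overline{\mathcal{M}}$ to abelian groups, and $G:\mathcal{E}\to\mathrm{Mod}\,\overline{\mathcal{M}}$ is $G(X)=\overline{\mathcal{E}}(-,X)|_{\overline{\mathcal{M}}}$. An object $X$ is fibrant if $X\to0$ is in $\mathrm{Fib}$. Morphisms in $\mathrm{Fib}\cap\mathcal{W}$ are called acyclic fibrations. An object $C$ is cofibrant if for every acyclic fibration $f:X\to Y$ every morphism $C\to Y$ factors through $f$. A cofibrant replacement of $X$ is a morphism $A\to X$ in $\mathcal{W}$ with $A$ cofibrant. An ABC (Anderson–Brown–Cisinski) prefibration structure on a category consists of two classes of maps $\mathrm{Fib}$ (fibrations) and $\mathcal{W}$ (weak equivalences) such that: (F1) there is a final object, which is fibrant; fibrations are stable under composition; all isomorphisms are weak equivalences, and all isomorphisms with fibrant codomain are acyclic fibrations; (F2) $\mathcal{W}$ has the two-out-of-three property; (F3) $\mathrm{Fib}$ and $\mathcal{W}$ are stable under retracts; (F4) for a diagram $B\xrightarrow{b}Y\xleftarrow{f}X$ the pullback exists; moreover, if $f$ is a fibration (respectively an acyclic fibration), then the projection $h$ from the pullback to $B$ is a fibration (respectively an acyclic fibration); (F5) any morphism $f:A\to B$ with $B$ fibrant factors as a weak equivalence followed by a fibration.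
   Formalization: In (F4), existence of all pullbacks can fail for E (e.g. finitely generated free modules over k[x]/(x²)); the full prefibration structure is stated when E has pullbacks; otherwise (F4) only asserts stability of (acyclic) fibrations under existing pullbacks. *)

theory Defs
  imports "HOL-Algebra.Coset"
begin

section \<open>Preadditive categories\<close>

text \<open>
  The hom-groups are HOL-Algebra groups, so that the group operation of \<open>Hom C X Y\<close> is written
  multiplicatively: \<open>f \<otimes>\<^bsub>Hom C X Y\<^esub> g\<close> is the sum of two parallel
  morphisms and \<open>\<one>\<^bsub>Hom C X Y\<^esub>\<close> is the zero morphism. Every morphism knows its domain
  and codomain, so a class of morphisms is just a set of type \<open>'m set\<close>.
\<close>

record ('o, 'm) cat =
  Obj :: "'o set"
  Hom :: "'o \<Rightarrow> 'o \<Rightarrow> 'm monoid"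
  Dom :: "'m \<Rightarrow> 'o"
  Cod :: "'m \<Rightarrow> 'o"
  Id :: "'o \<Rightarrow> 'm"
  Comp :: "'m \<Rightarrow> 'm \<Rightarrow> 'm" (infixr "\<cdot>\<index>" 75)

definition Arr :: "('o, 'm) cat \<Rightarrow> 'm set" where
  "Arr C = {f. Dom C f \<in> Obj C \<and> Cod C f \<in> Obj C \<and> f \<in> carrier (Hom C (Dom C f) (Cod C f))}"

locale preadditive_category =
  fixes C :: "('o, 'm) cat" (structure)
  assumes hom_group: "\<lbrakk>X \<in> Obj C; Y \<in> Obj C\<rbrakk> \<Longrightarrow> comm_group (Hom C X Y)"
    and dom_cod: "\<lbrakk>X \<in> Obj C; Y \<in> Obj C; f \<in> carrier (Hom C X Y)\<rbrakk> \<Longrightarrow> Dom C f = X \<and> Cod C f = Y"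
    and id_closed: "X \<in> Obj C \<Longrightarrow> Id C X \<in> carrier (Hom C X X)"
    and comp_closed: "\<lbrakk>X \<in> Obj C; Y \<in> Obj C; Z \<in> Obj C; f \<in> carrier (Hom C X Y);
        g \<in> carrier (Hom C Y Z)\<rbrakk> \<Longrightarrow> g \<cdot> f \<in> carrier (Hom C X Z)"
    and comp_assoc: "\<lbrakk>W \<in> Obj C; X \<in> Obj C; Y \<in> Obj C; Z \<in> Obj C; f \<in> carrier (Hom C W X);
        g \<in> carrier (Hom C X Y); h \<in> carrier (Hom C Y Z)\<rbrakk> \<Longrightarrow> (h \<cdot> g) \<cdot> f = h \<cdot> (g \<cdot> f)"
    and id_left: "\<lbrakk>X \<in> Obj C; Y \<in> Obj C; f \<in> carrier (Hom C X Y)\<rbrakk> \<Longrightarrow> Id C Y \<cdot> f = f"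
    and id_right: "\<lbrakk>X \<in> Obj C; Y \<in> Obj C; f \<in> carrier (Hom C X Y)\<rbrakk> \<Longrightarrow> f \<cdot> Id C X = f"
    and comp_add_right: "\<lbrakk>X \<in> Obj C; Y \<in> Obj C; Z \<in> Obj C; f \<in> carrier (Hom C X Y);
        f' \<in> carrier (Hom C X Y); g \<in> carrier (Hom C Y Z)\<rbrakk> \<Longrightarrow>
        g \<cdot> (f \<otimes>\<^bsub>Hom C X Y\<^esub> f') = (g \<cdot> f) \<otimes>\<^bsub>Hom C X Z\<^esub> (g \<cdot> f')"
    and comp_add_left: "\<lbrakk>X \<in> Obj C; Y \<in> Obj C; Z \<in> Obj C; f \<in> carrier (Hom C X Y);
        g \<in> carrier (Hom C Y Z); g' \<in> carrier (Hom C Y Z)\<rbrakk> \<Longrightarrow>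
        (g \<otimes>\<^bsub>Hom C Y Z\<^esub> g') \<cdot> f = (g \<cdot> f) \<otimes>\<^bsub>Hom C X Z\<^esub> (g' \<cdot> f)"

definition is_iso :: "('o, 'm) cat \<Rightarrow> 'm \<Rightarrow> bool" where
  "is_iso C f \<longleftrightarrow> f \<in> Arr C \<and> (\<exists>g \<in> carrier (Hom C (Cod C f) (Dom C f)).
     g \<cdot>\<^bsub>C\<^esub> f = Id C (Dom C f) \<and> f \<cdot>\<^bsub>C\<^esub> g = Id C (Cod C f))"

definition is_retraction :: "('o, 'm) cat \<Rightarrow> 'm \<Rightarrow> bool" where
  "is_retraction C r \<longleftrightarrow> r \<in> Arr C \<and>
     (\<exists>s \<in> carrier (Hom C (Cod C r) (Dom C r)). r \<cdot>\<^bsub>C\<^esub> s = Id C (Cod C r))"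

definition is_final :: "('o, 'm) cat \<Rightarrow> 'o \<Rightarrow> bool" where
  "is_final C T \<longleftrightarrow> T \<in> Obj C \<and> (\<forall>X \<in> Obj C. \<exists>!f. f \<in> carrier (Hom C X T))"

definition is_initial :: "('o, 'm) cat \<Rightarrow> 'o \<Rightarrow> bool" where
  "is_initial C T \<longleftrightarrow> T \<in> Obj C \<and> (\<forall>X \<in> Obj C. \<exists>!f. f \<in> carrier (Hom C T X))"

definition is_biproduct :: "('o, 'm) cat \<Rightarrow> 'o \<Rightarrow> 'o \<Rightarrow> 'o \<Rightarrow> bool" where
  "is_biproduct C B X Y \<longleftrightarrow> B \<in> Obj C \<and> X \<in> Obj C \<and> Y \<in> Obj C \<and>
     (\<exists>i \<in> carrier (Hom C X B). \<exists>j \<in> carrier (Hom C Y B).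
      \<exists>p \<in> carrier (Hom C B X). \<exists>q \<in> carrier (Hom C B Y).
        p \<cdot>\<^bsub>C\<^esub> i = Id C X \<and> q \<cdot>\<^bsub>C\<^esub> j = Id C Y \<and>
        q \<cdot>\<^bsub>C\<^esub> i = \<one>\<^bsub>Hom C X Y\<^esub> \<and> p \<cdot>\<^bsub>C\<^esub> j = \<one>\<^bsub>Hom C Y X\<^esub> \<and>
        (i \<cdot>\<^bsub>C\<^esub> p) \<otimes>\<^bsub>Hom C B B\<^esub> (j \<cdot>\<^bsub>C\<^esub> q) = Id C B)"

definition is_pullback :: "('o, 'm) cat \<Rightarrow> 'm \<Rightarrow> 'm \<Rightarrow> 'm \<Rightarrow> 'm \<Rightarrow> bool" where
  \<comment> \<open>\<open>h\<close> and \<open>g\<close> are the projections from the pullback to the domains of \<open>b\<close> and of \<open>f\<close>.\<close>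
  "is_pullback C b f h g \<longleftrightarrow> {b, f, h, g} \<subseteq> Arr C \<and>
     Cod C b = Cod C f \<and> Dom C h = Dom C g \<and> Cod C h = Dom C b \<and> Cod C g = Dom C f \<and>
     b \<cdot>\<^bsub>C\<^esub> h = f \<cdot>\<^bsub>C\<^esub> g \<and>
     (\<forall>T \<in> Obj C. \<forall>u \<in> carrier (Hom C T (Dom C b)). \<forall>v \<in> carrier (Hom C T (Dom C f)).
        b \<cdot>\<^bsub>C\<^esub> u = f \<cdot>\<^bsub>C\<^esub> v \<longrightarrow>
        (\<exists>!w. w \<in> carrier (Hom C T (Dom C h)) \<and> h \<cdot>\<^bsub>C\<^esub> w = u \<and> g \<cdot>\<^bsub>C\<^esub> w = v))"

definition is_pushout :: "('o, 'm) cat \<Rightarrow> 'm \<Rightarrow> 'm \<Rightarrow> 'm \<Rightarrow> 'm \<Rightarrow> bool" where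
  \<comment> \<open>\<open>h\<close> and \<open>g\<close> are the injections of the codomains of \<open>b\<close> and of \<open>f\<close> into the pushout.\<close>
  "is_pushout C b f h g \<longleftrightarrow> {b, f, h, g} \<subseteq> Arr C \<and>
     Dom C b = Dom C f \<and> Cod C h = Cod C g \<and> Dom C h = Cod C b \<and> Dom C g = Cod C f \<and>
     h \<cdot>\<^bsub>C\<^esub> b = g \<cdot>\<^bsub>C\<^esub> f \<and>
     (\<forall>T \<in> Obj C. \<forall>u \<in> carrier (Hom C (Cod C b) T). \<forall>v \<in> carrier (Hom C (Cod C f) T).
        u \<cdot>\<^bsub>C\<^esub> b = v \<cdot>\<^bsub>C\<^esub> f \<longrightarrow>
        (\<exists>!w. w \<in> carrier (Hom C (Cod C h) T) \<and> w \<cdot>\<^bsub>C\<^esub> h = u \<and> w \<cdot>\<^bsub>C\<^esub> g = v))"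

definition is_kernel :: "('o, 'm) cat \<Rightarrow> 'm \<Rightarrow> 'm \<Rightarrow> bool" where
  "is_kernel C i p \<longleftrightarrow> {i, p} \<subseteq> Arr C \<and> Cod C i = Dom C p \<and>
     p \<cdot>\<^bsub>C\<^esub> i = \<one>\<^bsub>Hom C (Dom C i) (Cod C p)\<^esub> \<and>
     (\<forall>T \<in> Obj C. \<forall>f \<in> carrier (Hom C T (Dom C p)).
        p \<cdot>\<^bsub>C\<^esub> f = \<one>\<^bsub>Hom C T (Cod C p)\<^esub> \<longrightarrow>
        (\<exists>!w. w \<in> carrier (Hom C T (Dom C i)) \<and> i \<cdot>\<^bsub>C\<^esub> w = f))"

definition is_cokernel :: "('o, 'm) cat \<Rightarrow> 'm \<Rightarrow> 'm \<Rightarrow> bool" where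
  "is_cokernel C p i \<longleftrightarrow> {i, p} \<subseteq> Arr C \<and> Cod C i = Dom C p \<and>
     p \<cdot>\<^bsub>C\<^esub> i = \<one>\<^bsub>Hom C (Dom C i) (Cod C p)\<^esub> \<and>
     (\<forall>T \<in> Obj C. \<forall>f \<in> carrier (Hom C (Cod C i) T).
        f \<cdot>\<^bsub>C\<^esub> i = \<one>\<^bsub>Hom C (Dom C i) T\<^esub> \<longrightarrow>
        (\<exists>!w. w \<in> carrier (Hom C (Cod C p) T) \<and> w \<cdot>\<^bsub>C\<^esub> p = f))"

locale additive_category = preadditive_category +
  assumes zero_object: "\<exists>Z. is_initial C Z \<and> is_final C Z"
    and biproducts: "\<lbrakk>X \<in> Obj C; Y \<in> Obj C\<rbrakk> \<Longrightarrow> \<exists>B. is_biproduct C B X Y"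


section \<open>Exact categories\<close>

definition inflation :: "('m \<times> 'm) set \<Rightarrow> 'm \<Rightarrow> bool" where
  "inflation S i \<longleftrightarrow> (\<exists>p. (i, p) \<in> S)"

definition deflation :: "('m \<times> 'm) set \<Rightarrow> 'm \<Rightarrow> bool" where
  "deflation S p \<longleftrightarrow> (\<exists>i. (i, p) \<in> S)"

text \<open>
  Quillen's axioms in the self-dual form of Buehler, \<open>Exact categories\<close>; \<open>S\<close> is the class of
  short exact sequences \<open>(i, p)\<close>, standing for \<open>0 \<rightarrow> Dom i \<rightarrow> Cod i = Dom p \<rightarrow> Cod p \<rightarrow> 0\<close>.
\<close>

locale exact_category = additive_category +
  fixes S :: "('m \<times> 'm) set"
  assumes kernel_cokernel: "(i, p) \<in> S \<Longrightarrow> is_kernel C i p \<and> is_cokernel C p i"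
    and iso_closed: "\<lbrakk>(i, p) \<in> S; i' \<in> Arr C; p' \<in> Arr C; Cod C i' = Dom C p';
        is_iso C a; is_iso C b; is_iso C c;
        Dom C a = Dom C i; Cod C a = Dom C i'; Dom C b = Cod C i; Cod C b = Cod C i';
        Dom C c = Cod C p; Cod C c = Cod C p'; b \<cdot> i = i' \<cdot> a; c \<cdot> p = p' \<cdot> b\<rbrakk> \<Longrightarrow> (i', p') \<in> S"
    and id_inflation: "X \<in> Obj C \<Longrightarrow> inflation S (Id C X)"
    and id_deflation: "X \<in> Obj C \<Longrightarrow> deflation S (Id C X)"
    and inflation_comp: "\<lbrakk>inflation S i; inflation S j; Cod C i = Dom C j\<rbrakk> \<Longrightarrow> inflation S (j \<cdot> i)"
    and deflation_comp: "\<lbrakk>deflation S p; deflation S q; Cod C p = Dom C q\<rbrakk> \<Longrightarrow> deflation S (q \<cdot> p)"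
    and inflation_pushout: "\<lbrakk>inflation S i; f \<in> Arr C; Dom C f = Dom C i\<rbrakk> \<Longrightarrow>
        \<exists>h g. is_pushout C f i h g \<and> inflation S h"
    and deflation_pullback: "\<lbrakk>deflation S p; f \<in> Arr C; Cod C f = Cod C p\<rbrakk> \<Longrightarrow>
        \<exists>h g. is_pullback C f p h g \<and> deflation S h"

definition weakly_idempotent_complete :: "('o, 'm) cat \<Rightarrow> bool" where
  "weakly_idempotent_complete C \<longleftrightarrow> (\<forall>r. is_retraction C r \<longrightarrow> (\<exists>i. is_kernel C i r))"

definition injectives :: "('o, 'm) cat \<Rightarrow> ('m \<times> 'm) set \<Rightarrow> 'o set" where
  "injectives C S = {I \<in> Obj C. \<forall>i. inflation S i \<longrightarrow>
     (\<forall>f \<in> carrier (Hom C (Dom C i) I). \<exists>g \<in> carrier (Hom C (Cod C i) I). g \<cdot>\<^bsub>C\<^esub> i = f)}"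

definition projectives :: "('o, 'm) cat \<Rightarrow> ('m \<times> 'm) set \<Rightarrow> 'o set" where
  "projectives C S = {P \<in> Obj C. \<forall>p. deflation S p \<longrightarrow>
     (\<forall>f \<in> carrier (Hom C P (Cod C p)). \<exists>g \<in> carrier (Hom C P (Dom C p)). p \<cdot>\<^bsub>C\<^esub> g = f)}"

definition enough_injectives :: "('o, 'm) cat \<Rightarrow> ('m \<times> 'm) set \<Rightarrow> bool" where
  "enough_injectives C S \<longleftrightarrow>
     (\<forall>X \<in> Obj C. \<exists>i. inflation S i \<and> Dom C i = X \<and> Cod C i \<in> injectives C S)"

definition enough_projectives :: "('o, 'm) cat \<Rightarrow> ('m \<times> 'm) set \<Rightarrow> bool" where
  "enough_projectives C S \<longleftrightarrow>
     (\<forall>X \<in> Obj C. \<exists>p. deflation S p \<and> Dom C p \<in> projectives C S \<and> Cod C p = X)"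

text \<open>Yoneda extensions \<open>0 \<rightarrow> Y \<rightarrow> B \<rightarrow> X \<rightarrow> 0\<close> and their equivalence classes.\<close>

definition extensions :: "('o, 'm) cat \<Rightarrow> ('m \<times> 'm) set \<Rightarrow> 'o \<Rightarrow> 'o \<Rightarrow> ('m \<times> 'm) set" where
  "extensions C S X Y = {(i, p) \<in> S. Dom C i = Y \<and> Cod C p = X}"

definition ext_equiv :: "('o, 'm) cat \<Rightarrow> ('m \<times> 'm) set \<Rightarrow> 'o \<Rightarrow> 'o \<Rightarrow> (('m \<times> 'm) \<times> ('m \<times> 'm)) set" where
  "ext_equiv C S X Y = {((i, p), (i', p')). (i, p) \<in> extensions C S X Y \<and> (i', p') \<in> extensions C S X Y \<and>
     (\<exists>b. is_iso C b \<and> Dom C b = Cod C i \<and> Cod C b = Cod C i' \<and>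
          b \<cdot>\<^bsub>C\<^esub> i = i' \<and> p' \<cdot>\<^bsub>C\<^esub> b = p)}"

definition Ext1 :: "('o, 'm) cat \<Rightarrow> ('m \<times> 'm) set \<Rightarrow> 'o \<Rightarrow> 'o \<Rightarrow> ('m \<times> 'm) set set" where
  "Ext1 C S X Y = extensions C S X Y // ext_equiv C S X Y"

definition rigid :: "('o, 'm) cat \<Rightarrow> ('m \<times> 'm) set \<Rightarrow> 'o set \<Rightarrow> bool" where
  \<comment> \<open>The Baer sum makes \<open>Ext1\<close> a group on this set of classes; it is zero iff there is only one class.\<close>
  "rigid C S M \<longleftrightarrow> (\<forall>X \<in> M. \<forall>Y \<in> M. is_singleton (Ext1 C S X Y))"

definition contravariantly_finite :: "('o, 'm) cat \<Rightarrow> 'o set \<Rightarrow> bool" where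
  "contravariantly_finite C A \<longleftrightarrow>
     (\<forall>X \<in> Obj C. \<exists>U \<in> A. \<exists>a \<in> carrier (Hom C U X).
        \<forall>V \<in> A. \<forall>f \<in> carrier (Hom C V X). \<exists>g \<in> carrier (Hom C V U). a \<cdot>\<^bsub>C\<^esub> g = f)"

definition closed_under_sums :: "('o, 'm) cat \<Rightarrow> 'o set \<Rightarrow> bool" where
  "closed_under_sums C A \<longleftrightarrow> (\<forall>B X Y. is_biproduct C B X Y \<longrightarrow> X \<in> A \<longrightarrow> Y \<in> A \<longrightarrow> B \<in> A)"

definition closed_under_summands :: "('o, 'm) cat \<Rightarrow> 'o set \<Rightarrow> bool" where
  "closed_under_summands C A \<longleftrightarrow> (\<forall>B X Y. is_biproduct C B X Y \<longrightarrow> B \<in> A \<longrightarrow> X \<in> A)"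

definition pr :: "('o, 'm) cat \<Rightarrow> ('m \<times> 'm) set \<Rightarrow> 'o set \<Rightarrow> 'o set" where
  "pr C S M = {X. \<exists>(i, p) \<in> S. Dom C i \<in> M \<and> Cod C i \<in> M \<and> Cod C p = X}"

definition mho :: "('o, 'm) cat \<Rightarrow> ('m \<times> 'm) set \<Rightarrow> 'o set \<Rightarrow> 'o set" where
  "mho C S M = {X. \<exists>(i, p) \<in> S. Dom C i \<in> M \<and> Cod C i \<in> injectives C S \<and> Cod C p = X}"


section \<open>The stable category and the functor G\<close>

text \<open>Quotient by an ideal \<open>J\<close>: morphisms of the quotient are the cosets of the subgroups \<open>J X Y\<close>.\<close>

definition quotient_cat :: "('o, 'm) cat \<Rightarrow> ('o \<Rightarrow> 'o \<Rightarrow> 'm set) \<Rightarrow> ('o, 'm set) cat" where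
  "quotient_cat C J = \<lparr>
     Obj = Obj C,
     Hom = (\<lambda>X Y. Hom C X Y Mod J X Y),
     Dom = (\<lambda>A. Dom C (SOME f. f \<in> A)),
     Cod = (\<lambda>A. Cod C (SOME f. f \<in> A)),
     Id = (\<lambda>X. J X X #>\<^bsub>Hom C X X\<^esub> Id C X),
     Comp = (\<lambda>B A. \<Union>g\<in>B. \<Union>f\<in>A.
               J (Dom C f) (Cod C g) #>\<^bsub>Hom C (Dom C f) (Cod C g)\<^esub> (g \<cdot>\<^bsub>C\<^esub> f))\<rparr>"

definition injective_ideal :: "('o, 'm) cat \<Rightarrow> ('m \<times> 'm) set \<Rightarrow> 'o \<Rightarrow> 'o \<Rightarrow> 'm set" where
  "injective_ideal C S X Y = {h \<cdot>\<^bsub>C\<^esub> g |g h I. I \<in> injectives C S \<and>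
     g \<in> carrier (Hom C X I) \<and> h \<in> carrier (Hom C I Y)}"

definition stable_cat :: "('o, 'm) cat \<Rightarrow> ('m \<times> 'm) set \<Rightarrow> ('o, 'm set) cat" where
  "stable_cat C S = quotient_cat C (injective_ideal C S)"

definition stable_class :: "('o, 'm) cat \<Rightarrow> ('m \<times> 'm) set \<Rightarrow> 'm \<Rightarrow> 'm set" where
  \<comment> \<open>The projection functor to the stable category, on morphisms.\<close>
  "stable_class C S f =
     injective_ideal C S (Dom C f) (Cod C f) #>\<^bsub>Hom C (Dom C f) (Cod C f)\<^esub> f"

definition full_subcat :: "('o, 'm) cat \<Rightarrow> 'o set \<Rightarrow> ('o, 'm) cat" where
  "full_subcat C A = C\<lparr>Obj := A\<rparr>"

record ('o, 'm, 'g) presheaf =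
  Fob :: "'o \<Rightarrow> 'g monoid"
  Fmap :: "'m \<Rightarrow> 'g \<Rightarrow> 'g"

definition Mod_obj :: "('o, 'm) cat \<Rightarrow> ('o, 'm, 'g) presheaf \<Rightarrow> bool" where
  \<comment> \<open>Additive contravariant functors to abelian groups.\<close>
  "Mod_obj C F \<longleftrightarrow>
     (\<forall>X \<in> Obj C. comm_group (Fob F X)) \<and>
     (\<forall>f \<in> Arr C. Fmap F f \<in> hom (Fob F (Cod C f)) (Fob F (Dom C f))) \<and>
     (\<forall>X \<in> Obj C. \<forall>x \<in> carrier (Fob F X). Fmap F (Id C X) x = x) \<and>
     (\<forall>f \<in> Arr C. \<forall>g \<in> Arr C. Cod C f = Dom C g \<longrightarrow>
        (\<forall>x \<in> carrier (Fob F (Cod C g)). Fmap F (g \<cdot>\<^bsub>C\<^esub> f) x = Fmap F f (Fmap F g x))) \<and>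
     (\<forall>X \<in> Obj C. \<forall>Y \<in> Obj C. \<forall>f \<in> carrier (Hom C X Y). \<forall>g \<in> carrier (Hom C X Y).
        \<forall>x \<in> carrier (Fob F Y).
          Fmap F (f \<otimes>\<^bsub>Hom C X Y\<^esub> g) x = Fmap F f x \<otimes>\<^bsub>Fob F X\<^esub> Fmap F g x)"

definition Mod_mor :: "('o, 'm) cat \<Rightarrow> ('o, 'm, 'g) presheaf \<Rightarrow> ('o, 'm, 'g) presheaf \<Rightarrow>
    ('o \<Rightarrow> 'g \<Rightarrow> 'g) \<Rightarrow> bool" where
  \<comment> \<open>Natural transformations; components are only relevant on the carriers.\<close>
  "Mod_mor C F F' \<eta> \<longleftrightarrow> Mod_obj C F \<and> Mod_obj C F' \<and>
     (\<forall>X \<in> Obj C. \<eta> X \<in> hom (Fob F X) (Fob F' X)) \<and>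
     (\<forall>f \<in> Arr C. \<forall>x \<in> carrier (Fob F (Cod C f)).
        \<eta> (Dom C f) (Fmap F f x) = Fmap F' f (\<eta> (Cod C f) x))"

definition Mod_iso :: "('o, 'm) cat \<Rightarrow> ('o, 'm, 'g) presheaf \<Rightarrow> ('o, 'm, 'g) presheaf \<Rightarrow>
    ('o \<Rightarrow> 'g \<Rightarrow> 'g) \<Rightarrow> bool" where
  "Mod_iso C F F' \<eta> \<longleftrightarrow> Mod_mor C F F' \<eta> \<and>
     (\<exists>\<theta>. Mod_mor C F' F \<theta> \<and>
        (\<forall>X \<in> Obj C. (\<forall>x \<in> carrier (Fob F X). \<theta> X (\<eta> X x) = x) \<and>
                     (\<forall>y \<in> carrier (Fob F' X). \<eta> X (\<theta> X y) = y)))"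

definition G_obj :: "('o, 'm) cat \<Rightarrow> ('m \<times> 'm) set \<Rightarrow> 'o \<Rightarrow> ('o, 'm set, 'm set) presheaf" where
  "G_obj C S X = \<lparr> Fob = (\<lambda>Y. Hom (stable_cat C S) Y X),
                   Fmap = (\<lambda>f x. x \<cdot>\<^bsub>stable_cat C S\<^esub> f) \<rparr>"

definition G_mor :: "('o, 'm) cat \<Rightarrow> ('m \<times> 'm) set \<Rightarrow> 'm \<Rightarrow> 'o \<Rightarrow> 'm set \<Rightarrow> 'm set" where
  "G_mor C S f Y x = stable_class C S f \<cdot>\<^bsub>stable_cat C S\<^esub> x"

definition G_weak_equivalences :: "('o, 'm) cat \<Rightarrow> ('m \<times> 'm) set \<Rightarrow> 'o set \<Rightarrow> 'm set" where
  "G_weak_equivalences C S M = {f \<in> Arr C. Mod_iso (full_subcat (stable_cat C S) M)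
     (G_obj C S (Dom C f)) (G_obj C S (Cod C f)) (G_mor C S f)}"


section \<open>Prefibration structures\<close>

definition is_retract :: "('o, 'm) cat \<Rightarrow> 'm \<Rightarrow> 'm \<Rightarrow> bool" where
  \<comment> \<open>\<open>f\<close> is a retract of \<open>g\<close> in the category of arrows.\<close>
  "is_retract C f g \<longleftrightarrow> f \<in> Arr C \<and> g \<in> Arr C \<and>
     (\<exists>i \<in> carrier (Hom C (Dom C f) (Dom C g)). \<exists>r \<in> carrier (Hom C (Dom C g) (Dom C f)).
      \<exists>j \<in> carrier (Hom C (Cod C f) (Cod C g)). \<exists>s \<in> carrier (Hom C (Cod C g) (Cod C f)).
        r \<cdot>\<^bsub>C\<^esub> i = Id C (Dom C f) \<and> s \<cdot>\<^bsub>C\<^esub> j = Id C (Cod C f) \<and>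
        g \<cdot>\<^bsub>C\<^esub> i = j \<cdot>\<^bsub>C\<^esub> f \<and> f \<cdot>\<^bsub>C\<^esub> r = s \<cdot>\<^bsub>C\<^esub> g)"

definition fibrant :: "('o, 'm) cat \<Rightarrow> 'm set \<Rightarrow> 'o \<Rightarrow> bool" where
  \<comment> \<open>Required for every choice of the final object.\<close>
  "fibrant C Fib X \<longleftrightarrow> X \<in> Obj C \<and> (\<forall>T. is_final C T \<longrightarrow> carrier (Hom C X T) \<subseteq> Fib)"

definition cofibrant :: "('o, 'm) cat \<Rightarrow> 'm set \<Rightarrow> 'm set \<Rightarrow> 'o \<Rightarrow> bool" where
  "cofibrant C Fib W A \<longleftrightarrow> A \<in> Obj C \<and>
     (\<forall>f \<in> Fib \<inter> W. \<forall>c \<in> carrier (Hom C A (Cod C f)).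
        \<exists>l \<in> carrier (Hom C A (Dom C f)). f \<cdot>\<^bsub>C\<^esub> l = c)"

definition cofibrant_replacement :: "('o, 'm) cat \<Rightarrow> 'm set \<Rightarrow> 'm set \<Rightarrow> 'o \<Rightarrow> 'm \<Rightarrow> bool" where
  "cofibrant_replacement C Fib W X w \<longleftrightarrow> w \<in> W \<and> Cod C w = X \<and> cofibrant C Fib W (Dom C w)"

definition abc_F1 :: "('o, 'm) cat \<Rightarrow> 'm set \<Rightarrow> 'm set \<Rightarrow> bool" where
  "abc_F1 C Fib W \<longleftrightarrow>
     (\<exists>T. is_final C T \<and> fibrant C Fib T) \<and>
     (\<forall>f \<in> Fib. \<forall>g \<in> Fib. Cod C f = Dom C g \<longrightarrow> g \<cdot>\<^bsub>C\<^esub> f \<in> Fib) \<and>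
     (\<forall>f. is_iso C f \<longrightarrow> f \<in> W) \<and>
     (\<forall>f. is_iso C f \<and> fibrant C Fib (Cod C f) \<longrightarrow> f \<in> Fib \<inter> W)"

definition abc_F2 :: "('o, 'm) cat \<Rightarrow> 'm set \<Rightarrow> bool" where
  "abc_F2 C W \<longleftrightarrow> (\<forall>f \<in> Arr C. \<forall>g \<in> Arr C. Cod C f = Dom C g \<longrightarrow>
     (f \<in> W \<and> g \<in> W \<longrightarrow> g \<cdot>\<^bsub>C\<^esub> f \<in> W) \<and>
     (f \<in> W \<and> g \<cdot>\<^bsub>C\<^esub> f \<in> W \<longrightarrow> g \<in> W) \<and>
     (g \<in> W \<and> g \<cdot>\<^bsub>C\<^esub> f \<in> W \<longrightarrow> f \<in> W))"

definition abc_F3 :: "('o, 'm) cat \<Rightarrow> 'm set \<Rightarrow> 'm set \<Rightarrow> bool" where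
  "abc_F3 C Fib W \<longleftrightarrow> (\<forall>f g. is_retract C f g \<longrightarrow> (g \<in> Fib \<longrightarrow> f \<in> Fib) \<and> (g \<in> W \<longrightarrow> f \<in> W))"

definition has_pullbacks :: "('o, 'm) cat \<Rightarrow> bool" where
  "has_pullbacks C \<longleftrightarrow> (\<forall>b \<in> Arr C. \<forall>f \<in> Arr C. Cod C b = Cod C f \<longrightarrow> (\<exists>h g. is_pullback C b f h g))"

definition abc_F4_base_change :: "('o, 'm) cat \<Rightarrow> 'm set \<Rightarrow> 'm set \<Rightarrow> bool" where
  "abc_F4_base_change C Fib W \<longleftrightarrow> (\<forall>b f h g. is_pullback C b f h g \<longrightarrow>
     (f \<in> Fib \<longrightarrow> h \<in> Fib) \<and> (f \<in> Fib \<inter> W \<longrightarrow> h \<in> Fib \<inter> W))"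

definition abc_F4 :: "('o, 'm) cat \<Rightarrow> 'm set \<Rightarrow> 'm set \<Rightarrow> bool" where
  "abc_F4 C Fib W \<longleftrightarrow> has_pullbacks C \<and> abc_F4_base_change C Fib W"

definition abc_F5 :: "('o, 'm) cat \<Rightarrow> 'm set \<Rightarrow> 'm set \<Rightarrow> bool" where
  "abc_F5 C Fib W \<longleftrightarrow> (\<forall>f \<in> Arr C. fibrant C Fib (Cod C f) \<longrightarrow>
     (\<exists>w \<in> W. \<exists>p \<in> Fib. Cod C w = Dom C p \<and> p \<cdot>\<^bsub>C\<^esub> w = f))"

definition abc_prefibration :: "('o, 'm) cat \<Rightarrow> 'm set \<Rightarrow> 'm set \<Rightarrow> bool" where
  "abc_prefibration C Fib W \<longleftrightarrow> Fib \<subseteq> Arr C \<and> W \<subseteq> Arr C \<and>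
     abc_F1 C Fib W \<and> abc_F2 C W \<and> abc_F3 C Fib W \<and> abc_F4 C Fib W \<and> abc_F5 C Fib W"

text \<open>
  The first clause of (F4) is a property of the category alone and may fail: in the weakly idempotent
  complete category of finitely generated free modules over the dual numbers, with the split exact
  structure, multiplication by the nilpotent generator has no kernel. The following notion keeps all
  the axioms, with base change required for every pullback square that exists; together with
  \<open>has_pullbacks\<close> it is \<open>abc_prefibration\<close>.
\<close>

definition abc_prefibration_no_existence :: "('o, 'm) cat \<Rightarrow> 'm set \<Rightarrow> 'm set \<Rightarrow> bool" where
  "abc_prefibration_no_existence C Fib W \<longleftrightarrow> Fib \<subseteq> Arr C \<and> W \<subseteq> Arr C \<and>
     abc_F1 C Fib W \<and> abc_F2 C W \<and> abc_F3 C Fib W \<and> abc_F4_base_change C Fib W \<and> abc_F5 C Fib W"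

end

theory Submission
  imports Defs
begin

text \<open>
  The fibrations are the morphisms through which all morphisms from objects of \<open>\<mho>M\<close> lift. Rigidity says
  that \<open>G\<close> vanishes on \<open>\<mho>M\<close>, so \<open>A \<rightarrow> A \<oplus> U \<rightarrow> B\<close>, with \<open>U \<rightarrow> B\<close> a right \<open>\<mho>M\<close>-approximation, gives (F5).

  Since injectives lie in \<open>\<mho>M\<close>, factorizations through injectives can be lifted along a fibration; so a
  fibration \<open>f\<close> is acyclic iff \<open>Hom(N, f)\<close> is onto for \<open>N \<in> M\<close> and every \<open>g: N \<rightarrow> Dom f\<close> with \<open>f g = 0\<close> is
  \<open>u j\<close> with \<open>u\<close> defined on an injective object and \<open>f u = 0\<close>. This description is stable under base change
  and lets one lift first \<open>M\<^sub>0\<close> and then the cokernel of \<open>M\<^sub>1 \<rightarrow> M\<^sub>0\<close>, so \<open>pr M\<close> is cofibrant.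

  Conversely every object is the target of an acyclic fibration from \<open>pr M\<close>, so a cofibrant object is a
  retract of one in \<open>pr M\<close>, and \<open>pr M\<close> is closed under retracts by a Schanuel argument.
\<close>

section \<open>Morphisms of a preadditive category\<close>

text \<open>Pullbacks of the category are unrelated to the quotient by injectives, so an equation
  that holds only modulo injectives cannot be fed into their universal property. This is the reason
  for the strict description of acyclic fibrations: its clauses are honest equations. In the kernel
  clause it would not be enough that \<open>g\<close> factors through an injective; the condition
  \<open>f u = 0\<close> is what makes \<open>(0, u)\<close> a compatible pair for a pullback of
  \<open>f\<close>. Achieving it takes lifts from cokernels of injective hulls of objects of
  \<open>M\<close>, which is why fibrations lift maps from all of \<mho>M and not from injectives
  alone. Rigidity acts in one form: a deflation with kernel in \<open>M\<close> is surjective on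
  maps from objects of \<open>M\<close>. It kills \<open>G\<close> on \<mho>M, splits the auxiliary
  extensions, and in the Schanuel argument lifts the idempotent \<open>1 - s r\<close> of an object
  of \<open>pr M\<close> to its presentation. Weak idempotent completeness turns the retracts met
  there into direct summands.\<close>

context preadditive_category
begin

text \<open>Membership in the carrier of an indexed hom-group is replaced by three facts on
  \<open>f\<close> alone, which the simplifier can propagate through composites and sums.\<close>

abbreviation in_hom :: "'m \<Rightarrow> 'o \<Rightarrow> 'o \<Rightarrow> bool" where
  "in_hom f X Y \<equiv> f \<in> Arr C \<and> Dom C f = X \<and> Cod C f = Y"

text \<open>The hom-group is read off from the left operand, so a sum carries no index; the laws
  below ask that the operands be parallel.\<close>

definition add :: "'m \<Rightarrow> 'm \<Rightarrow> 'm" (infixl "\<boxplus>" 65) where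
  "f \<boxplus> g = f \<otimes>\<^bsub>Hom C (Dom C f) (Cod C f)\<^esub> g"

definition neg :: "'m \<Rightarrow> 'm" where
  "neg f = inv\<^bsub>Hom C (Dom C f) (Cod C f)\<^esub> f"

definition zero :: "'o \<Rightarrow> 'o \<Rightarrow> 'm" where
  "zero X Y = \<one>\<^bsub>Hom C X Y\<^esub>"

definition minus :: "'m \<Rightarrow> 'm \<Rightarrow> 'm" (infixl "\<boxminus>" 65) where
  "f \<boxminus> g = f \<boxplus> neg g"

lemma carrier_Hom_iff:
  assumes "X \<in> Obj C" "Y \<in> Obj C"
  shows "f \<in> carrier (Hom C X Y) \<longleftrightarrow> in_hom f X Y"
  using assms dom_cod by (auto simp: Arr_def)

lemma Dom_Obj [simp]: "f \<in> Arr C \<Longrightarrow> Dom C f \<in> Obj C"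
  and Cod_Obj [simp]: "f \<in> Arr C \<Longrightarrow> Cod C f \<in> Obj C"
  and Arr_carrier: "f \<in> Arr C \<Longrightarrow> f \<in> carrier (Hom C (Dom C f) (Cod C f))"
  by (auto simp: Arr_def)

lemma Id_in_hom:
  assumes "X \<in> Obj C"
  shows "in_hom (Id C X) X X"
  using id_closed[OF assms] carrier_Hom_iff[OF assms assms] by simp

lemmas Id_simps [simp] = Id_in_hom[THEN conjunct1] Id_in_hom[THEN conjunct2, THEN conjunct1]
  Id_in_hom[THEN conjunct2, THEN conjunct2]

lemma comp_in_hom:
  assumes "f \<in> Arr C" "g \<in> Arr C" "Cod C f = Dom C g"
  shows "in_hom (g \<cdot> f) (Dom C f) (Cod C g)"
proof -
  have "g \<cdot> f \<in> carrier (Hom C (Dom C f) (Cod C g))"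
    by (rule comp_closed[of _ "Dom C g"])
      (use assms Arr_carrier[of f] Arr_carrier[of g] in simp_all)
  then show ?thesis using assms carrier_Hom_iff[of "Dom C f" "Cod C g"] by simp
qed

lemmas comp_simps [simp] = comp_in_hom[THEN conjunct1] comp_in_hom[THEN conjunct2, THEN conjunct1]
  comp_in_hom[THEN conjunct2, THEN conjunct2]

lemma zero_in_hom:
  assumes "X \<in> Obj C" "Y \<in> Obj C"
  shows "in_hom (zero X Y) X Y"
proof -
  interpret comm_group "Hom C X Y" by (rule hom_group[OF assms])
  show ?thesis using carrier_Hom_iff[OF assms, of "zero X Y"] by (auto simp: zero_def)
qed

lemmas zero_simps [simp] = zero_in_hom[THEN conjunct1] zero_in_hom[THEN conjunct2, THEN conjunct1]
  zero_in_hom[THEN conjunct2, THEN conjunct2]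

lemma add_in_hom:
  assumes "f \<in> Arr C" "g \<in> Arr C" "Dom C g = Dom C f" "Cod C g = Cod C f"
  shows "in_hom (f \<boxplus> g) (Dom C f) (Cod C f)"
proof -
  interpret comm_group "Hom C (Dom C f) (Cod C f)" by (rule hom_group) (use assms in auto)
  have "f \<boxplus> g \<in> carrier (Hom C (Dom C f) (Cod C f))"
    unfolding add_def using assms Arr_carrier[of f] Arr_carrier[of g] by simp
  then show ?thesis using assms carrier_Hom_iff[of "Dom C f" "Cod C f"] by simp
qed

lemmas add_simps [simp] = add_in_hom[THEN conjunct1] add_in_hom[THEN conjunct2, THEN conjunct1]
  add_in_hom[THEN conjunct2, THEN conjunct2]

lemma neg_in_hom:
  assumes "f \<in> Arr C"
  shows "in_hom (neg f) (Dom C f) (Cod C f)"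
proof -
  interpret comm_group "Hom C (Dom C f) (Cod C f)" by (rule hom_group) (use assms in auto)
  have "neg f \<in> carrier (Hom C (Dom C f) (Cod C f))"
    unfolding neg_def using assms Arr_carrier[of f] by simp
  then show ?thesis using assms carrier_Hom_iff[of "Dom C f" "Cod C f"] by simp
qed

lemmas neg_simps [simp] = neg_in_hom[THEN conjunct1] neg_in_hom[THEN conjunct2, THEN conjunct1]
  neg_in_hom[THEN conjunct2, THEN conjunct2]

lemma minus_simps [simp]:
  assumes "f \<in> Arr C" "g \<in> Arr C" "Dom C g = Dom C f" "Cod C g = Cod C f"
  shows "f \<boxminus> g \<in> Arr C" "Dom C (f \<boxminus> g) = Dom C f" "Cod C (f \<boxminus> g) = Cod C f"
  using assms by (simp_all add: minus_def)

lemma comp_assoc' [simp]: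
  assumes "f \<in> Arr C" "g \<in> Arr C" "h \<in> Arr C" "Cod C f = Dom C g" "Cod C g = Dom C h"
  shows "(h \<cdot> g) \<cdot> f = h \<cdot> (g \<cdot> f)"
  by (rule comp_assoc[of "Dom C f" "Cod C f" "Cod C g" "Cod C h"])
    (use assms Arr_carrier[of f] Arr_carrier[of g] Arr_carrier[of h] in auto)

text \<open>The rule \<open>comp_assoc'\<close> associates composites to the right and thereby hides
  \<open>h \<cdot> g\<close> inside \<open>h \<cdot> (g \<cdot> f)\<close>. Instances of this lemma
  are known equations made applicable to such composites.\<close>

lemma comp_eq_assoc:
  assumes "h \<cdot> g = k" "f \<in> Arr C" "g \<in> Arr C" "h \<in> Arr C" "Cod C f = Dom C g" "Cod C g = Dom C h"
  shows "h \<cdot> (g \<cdot> f) = k \<cdot> f"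
  using assms comp_assoc'[of f g h] by simp

lemma Id_comp [simp]: "\<lbrakk>f \<in> Arr C; Cod C f = Y\<rbrakk> \<Longrightarrow> Id C Y \<cdot> f = f"
  and comp_Id [simp]: "\<lbrakk>f \<in> Arr C; Dom C f = X\<rbrakk> \<Longrightarrow> f \<cdot> Id C X = f"
  using id_left[of "Dom C f" "Cod C f" f] id_right[of "Dom C f" "Cod C f" f] by (auto simp: Arr_carrier)

text \<open>All the group laws stand together so that the hom-group is interpreted once; laws in
  fewer variables are instances with repeated arguments.\<close>

lemma hom_group_rules:
  assumes "f \<in> Arr C" "g \<in> Arr C" "h \<in> Arr C" "Dom C g = Dom C f" "Cod C g = Cod C f"
    "Dom C h = Dom C f" "Cod C h = Cod C f"
  shows "(f \<boxplus> g) \<boxplus> h = f \<boxplus> (g \<boxplus> h)" "f \<boxplus> g = g \<boxplus> f" "f \<boxplus> (g \<boxplus> h) = g \<boxplus> (f \<boxplus> h)"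
    "f \<boxplus> zero (Dom C f) (Cod C f) = f" "f \<boxplus> neg f = zero (Dom C f) (Cod C f)"
    "neg (f \<boxplus> g) = neg f \<boxplus> neg g" "neg (neg f) = f"
proof -
  interpret comm_group "Hom C (Dom C f) (Cod C f)" by (rule hom_group) (use assms in auto)
  have c: "f \<in> carrier (Hom C (Dom C f) (Cod C f))" "g \<in> carrier (Hom C (Dom C f) (Cod C f))"
    "h \<in> carrier (Hom C (Dom C f) (Cod C f))"
    using assms Arr_carrier[of f] Arr_carrier[of g] Arr_carrier[of h] by auto
  show "(f \<boxplus> g) \<boxplus> h = f \<boxplus> (g \<boxplus> h)" "f \<boxplus> g = g \<boxplus> f" "f \<boxplus> (g \<boxplus> h) = g \<boxplus> (f \<boxplus> h)"
    "f \<boxplus> zero (Dom C f) (Cod C f) = f"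
    using assms by (simp_all add: add_def zero_def c m_assoc m_comm m_lcomm
      add_in_hom[unfolded add_def])
  have n: "in_hom (neg f) (Dom C f) (Cod C f)" "in_hom (neg g) (Dom C f) (Cod C f)"
    using assms by simp_all
  show "f \<boxplus> neg f = zero (Dom C f) (Cod C f)" "neg (neg f) = f"
    using n by (simp_all add: add_def zero_def neg_def c)
  have "in_hom (f \<boxplus> g) (Dom C f) (Cod C f)" using assms by simp
  then show "neg (f \<boxplus> g) = neg f \<boxplus> neg g"
    unfolding add_def neg_def using n assms
    by (simp add: c inv_mult neg_def[symmetric])
qed

lemma add_assoc:
  assumes "f \<in> Arr C" "g \<in> Arr C" "h \<in> Arr C" "Dom C g = Dom C f" "Cod C g = Cod C f"
    "Dom C h = Dom C f" "Cod C h = Cod C f"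
  shows "(f \<boxplus> g) \<boxplus> h = f \<boxplus> (g \<boxplus> h)"
  by (rule hom_group_rules(1)[OF assms])

lemma add_commute:
  assumes "f \<in> Arr C" "g \<in> Arr C" "Dom C g = Dom C f" "Cod C g = Cod C f"
  shows "f \<boxplus> g = g \<boxplus> f"
  by (rule hom_group_rules(2)[of f g f]) (use assms in auto)

lemma add_left_commute:
  assumes "f \<in> Arr C" "g \<in> Arr C" "h \<in> Arr C" "Dom C g = Dom C f" "Cod C g = Cod C f"
    "Dom C h = Dom C f" "Cod C h = Cod C f"
  shows "f \<boxplus> (g \<boxplus> h) = g \<boxplus> (f \<boxplus> h)"
  by (rule hom_group_rules(3)[OF assms])

lemmas add_ac = add_assoc add_commute add_left_commute

lemma add_zero [simp]:
  "\<lbrakk>f \<in> Arr C; Dom C f = X; Cod C f = Y\<rbrakk> \<Longrightarrow> f \<boxplus> zero X Y = f"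
  "\<lbrakk>f \<in> Arr C; Dom C f = X; Cod C f = Y\<rbrakk> \<Longrightarrow> zero X Y \<boxplus> f = f"
  using hom_group_rules(4)[of f f f] add_commute[of f "zero (Dom C f) (Cod C f)"] by auto

lemma add_neg [simp]:
  "f \<in> Arr C \<Longrightarrow> f \<boxplus> neg f = zero (Dom C f) (Cod C f)"
  "f \<in> Arr C \<Longrightarrow> neg f \<boxplus> f = zero (Dom C f) (Cod C f)"
  using hom_group_rules(5)[of f f f] add_commute[of f "neg f"] by auto

lemma neg_neg [simp]: "f \<in> Arr C \<Longrightarrow> neg (neg f) = f"
  using hom_group_rules(7)[of f f f] by auto

lemma add_neg_cancel [simp]:
  assumes "f \<in> Arr C" "g \<in> Arr C" "Dom C g = Dom C f" "Cod C g = Cod C f"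
  shows "f \<boxplus> (neg f \<boxplus> g) = g" "neg f \<boxplus> (f \<boxplus> g) = g"
  using assms add_assoc[of f "neg f" g] add_assoc[of "neg f" f g] by auto

lemma neg_add:
  assumes "f \<in> Arr C" "g \<in> Arr C" "Dom C g = Dom C f" "Cod C g = Cod C f"
  shows "neg (f \<boxplus> g) = neg f \<boxplus> neg g"
  by (rule hom_group_rules(6)[of f g f]) (use assms in auto)

lemma comp_add [simp]:
  assumes "f \<in> Arr C" "f' \<in> Arr C" "Dom C f' = Dom C f" "Cod C f' = Cod C f"
    "g \<in> Arr C" "Cod C f = Dom C g"
  shows "g \<cdot> (f \<boxplus> f') = (g \<cdot> f) \<boxplus> (g \<cdot> f')"
  using comp_add_right[of "Dom C f" "Cod C f" "Cod C g" f f' g] assms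
    Arr_carrier[of f] Arr_carrier[of f'] Arr_carrier[of g]
  by (auto simp: add_def)

lemma add_comp [simp]:
  assumes "g \<in> Arr C" "g' \<in> Arr C" "Dom C g' = Dom C g" "Cod C g' = Cod C g"
    "f \<in> Arr C" "Cod C f = Dom C g"
  shows "(g \<boxplus> g') \<cdot> f = (g \<cdot> f) \<boxplus> (g' \<cdot> f)"
  using comp_add_left[of "Dom C f" "Cod C f" "Cod C g" f g g'] assms
    Arr_carrier[of f] Arr_carrier[of g'] Arr_carrier[of g]
  by (auto simp: add_def)

lemma add_right_cancel:
  assumes "f \<in> Arr C" "f' \<in> Arr C" "g \<in> Arr C" "Dom C f = Dom C g" "Cod C f = Cod C g"
    "Dom C f' = Dom C g" "Cod C f' = Cod C g" "f \<boxplus> g = f' \<boxplus> g"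
  shows "f = f'"
proof -
  have "f = (f \<boxplus> g) \<boxplus> neg g" using assms(1-7) by (simp add: add_assoc)
  also have "\<dots> = f'" unfolding assms(8) using assms(1-7) by (simp add: add_assoc)
  finally show ?thesis .
qed

lemma add_self_eq_zero:
  assumes "f \<in> Arr C" "f \<boxplus> f = f"
  shows "f = zero (Dom C f) (Cod C f)"
  using add_right_cancel[of f "zero (Dom C f) (Cod C f)" f] assms by simp

text \<open>Composition with \<open>g\<close> is additive, so the image of zero is idempotent under
  addition, and a group has only one such element.\<close>

lemma comp_zero [simp]:
  assumes "X \<in> Obj C" "g \<in> Arr C" "Dom C g = Y"
  shows "g \<cdot> zero X Y = zero X (Cod C g)"
proof -
  have "g \<cdot> zero X Y \<boxplus> g \<cdot> zero X Y = g \<cdot> (zero X Y \<boxplus> zero X Y)"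
    using assms by (subst comp_add) auto
  also have "\<dots> = g \<cdot> zero X Y" using assms by (auto simp del: comp_add)
  finally show ?thesis using assms add_self_eq_zero[of "g \<cdot> zero X Y"] by auto
qed

lemma zero_comp [simp]:
  assumes "Y \<in> Obj C" "f \<in> Arr C" "Cod C f = X"
  shows "zero X Y \<cdot> f = zero (Dom C f) Y"
proof -
  have "zero X Y \<cdot> f \<boxplus> zero X Y \<cdot> f = (zero X Y \<boxplus> zero X Y) \<cdot> f"
    using assms by (subst add_comp) auto
  also have "\<dots> = zero X Y \<cdot> f" using assms by (auto simp del: add_comp)
  finally show ?thesis using assms add_self_eq_zero[of "zero X Y \<cdot> f"] by auto
qed

lemma neg_unique:
  assumes "f \<in> Arr C" "g \<in> Arr C" "Dom C g = Dom C f" "Cod C g = Cod C f"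
    "f \<boxplus> g = zero (Dom C f) (Cod C f)"
  shows "f = neg g"
  using add_right_cancel[of f "neg g" g] assms by simp

lemma comp_neg [simp]:
  assumes "f \<in> Arr C" "g \<in> Arr C" "Cod C f = Dom C g"
  shows "g \<cdot> neg f = neg (g \<cdot> f)" "neg g \<cdot> f = neg (g \<cdot> f)"
proof -
  have "g \<cdot> neg f \<boxplus> g \<cdot> f = g \<cdot> (neg f \<boxplus> f)" using assms by (subst comp_add) auto
  then show "g \<cdot> neg f = neg (g \<cdot> f)" using assms by (intro neg_unique) (auto simp del: comp_add)
  have "neg g \<cdot> f \<boxplus> g \<cdot> f = (neg g \<boxplus> g) \<cdot> f" using assms by (subst add_comp) auto
  then show "neg g \<cdot> f = neg (g \<cdot> f)" using assms by (intro neg_unique) (auto simp del: add_comp)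
qed

lemma neg_zero [simp]: "\<lbrakk>X \<in> Obj C; Y \<in> Obj C\<rbrakk> \<Longrightarrow> neg (zero X Y) = zero X Y"
  using neg_unique[of "zero X Y" "zero X Y"] by simp

lemma comp_minus [simp]:
  assumes "f \<in> Arr C" "f' \<in> Arr C" "Dom C f' = Dom C f" "Cod C f' = Cod C f"
    "g \<in> Arr C" "Cod C f = Dom C g"
  shows "g \<cdot> (f \<boxminus> f') = (g \<cdot> f) \<boxminus> (g \<cdot> f')"
  using assms by (simp add: minus_def)

lemma minus_comp [simp]:
  assumes "g \<in> Arr C" "g' \<in> Arr C" "Dom C g' = Dom C g" "Cod C g' = Cod C g"
    "f \<in> Arr C" "Cod C f = Dom C g"
  shows "(g \<boxminus> g') \<cdot> f = (g \<cdot> f) \<boxminus> (g' \<cdot> f)"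
  using assms by (simp add: minus_def)

lemma minus_self [simp]: "\<lbrakk>f \<in> Arr C\<rbrakk> \<Longrightarrow> f \<boxminus> f = zero (Dom C f) (Cod C f)"
  by (simp add: minus_def)

lemma minus_zero [simp]:
  "\<lbrakk>f \<in> Arr C; Dom C f = X; Cod C f = Y\<rbrakk> \<Longrightarrow> f \<boxminus> zero X Y = f"
  using Dom_Obj Cod_Obj by (auto simp: minus_def)

lemma minus_add_cancel [simp]:
  assumes "f \<in> Arr C" "g \<in> Arr C" "Dom C g = Dom C f" "Cod C g = Cod C f"
  shows "(f \<boxminus> g) \<boxplus> g = f" "g \<boxplus> (f \<boxminus> g) = f" 
  using assms by (simp_all add: minus_def add_ac)

section \<open>Universal properties as existence and cancellation\<close>

lemma is_isoI:
  assumes "f \<in> Arr C" "in_hom g (Cod C f) (Dom C f)" "g \<cdot> f = Id C (Dom C f)" "f \<cdot> g = Id C (Cod C f)"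
  shows "is_iso C f"
  using assms carrier_Hom_iff[of "Cod C f" "Dom C f" g] by (auto simp: is_iso_def)

lemma is_isoE:
  assumes "is_iso C f"
  obtains g where "f \<in> Arr C" "in_hom g (Cod C f) (Dom C f)"
    "g \<cdot> f = Id C (Dom C f)" "f \<cdot> g = Id C (Cod C f)" "is_iso C g"
proof -
  obtain g where g: "f \<in> Arr C" "g \<in> carrier (Hom C (Cod C f) (Dom C f))"
    "g \<cdot> f = Id C (Dom C f)" "f \<cdot> g = Id C (Cod C f)"
    using assms by (auto simp: is_iso_def)
  then have h: "in_hom g (Cod C f) (Dom C f)" by (simp add: carrier_Hom_iff)
  show thesis by (rule that[OF g(1) h g(3,4)]) (rule is_isoI[of g f], use g h in auto)
qed

lemma is_iso_Id [simp]: "X \<in> Obj C \<Longrightarrow> is_iso C (Id C X)"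
  by (rule is_isoI[of _ "Id C X"]) auto

text \<open>Unique factorization is split into existence and left cancellation, the two forms in
  which it is consumed. Cancellation holds because \<open>p\<close> kills
  \<open>i \<cdot> w\<close>, so unique existence applies to this composite.\<close>

lemma is_kernelD:
  assumes "is_kernel C i p"
  shows "i \<in> Arr C" "p \<in> Arr C" "Cod C i = Dom C p" "p \<cdot> i = zero (Dom C i) (Cod C p)"
    "\<lbrakk>f \<in> Arr C; Cod C f = Dom C p; p \<cdot> f = zero (Dom C f) (Cod C p)\<rbrakk> \<Longrightarrow>
      \<exists>w. in_hom w (Dom C f) (Dom C i) \<and> i \<cdot> w = f"
    "\<lbrakk>w \<in> Arr C; w' \<in> Arr C; Dom C w' = Dom C w; Cod C w = Dom C i; Cod C w' = Dom C i; i \<cdot> w = i \<cdot> w'\<rbrakk>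
      \<Longrightarrow> w = w'"
proof -
  show 1: "i \<in> Arr C" "p \<in> Arr C" "Cod C i = Dom C p" "p \<cdot> i = zero (Dom C i) (Cod C p)"
    using assms by (auto simp: is_kernel_def zero_def)
  have *: "\<exists>!w. in_hom w (Dom C f) (Dom C i) \<and> i \<cdot> w = f"
    if "f \<in> Arr C" "Cod C f = Dom C p" "p \<cdot> f = zero (Dom C f) (Cod C p)" for f
  proof -
    have "f \<in> carrier (Hom C (Dom C f) (Dom C p))" using Arr_carrier[of f] that 1 by simp
    then have "\<exists>!w. w \<in> carrier (Hom C (Dom C f) (Dom C i)) \<and> i \<cdot> w = f"
      using assms that by (auto simp: is_kernel_def zero_def)
    then show ?thesis using 1 that carrier_Hom_iff[of "Dom C f" "Dom C i"] by auto
  qed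
  show "\<exists>w. in_hom w (Dom C f) (Dom C i) \<and> i \<cdot> w = f"
    if "f \<in> Arr C" "Cod C f = Dom C p" "p \<cdot> f = zero (Dom C f) (Cod C p)"
    using *[OF that] by auto
  show "w = w'"
    if w: "w \<in> Arr C" "w' \<in> Arr C" "Dom C w' = Dom C w" "Cod C w = Dom C i" "Cod C w' = Dom C i" 
      "i \<cdot> w = i \<cdot> w'"
  proof -
    have "p \<cdot> (i \<cdot> w) = zero (Dom C w) (Cod C p)" using comp_eq_assoc[OF 1(4)] w(1-5) 1 by simp
    then show ?thesis using *[of "i \<cdot> w"] w 1 by auto
  qed
qed

lemma is_kernelI:
  assumes "i \<in> Arr C" "p \<in> Arr C" "Cod C i = Dom C p" "p \<cdot> i = zero (Dom C i) (Cod C p)"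
    "\<And>f. \<lbrakk>f \<in> Arr C; Cod C f = Dom C p; p \<cdot> f = zero (Dom C f) (Cod C p)\<rbrakk> \<Longrightarrow>
      \<exists>w. in_hom w (Dom C f) (Dom C i) \<and> i \<cdot> w = f"
    "\<And>w w'. \<lbrakk>w \<in> Arr C; w' \<in> Arr C; Dom C w' = Dom C w; Cod C w = Dom C i; Cod C w' = Dom C i;
      i \<cdot> w = i \<cdot> w'\<rbrakk> \<Longrightarrow> w = w'"
  shows "is_kernel C i p"
  unfolding is_kernel_def
proof (intro conjI ballI impI)
  fix T f assume T: "T \<in> Obj C" "f \<in> carrier (Hom C T (Dom C p))" "p \<cdot> f = \<one>\<^bsub>Hom C T (Cod C p)\<^esub>"
  then have f: "in_hom f T (Dom C p)" using assms carrier_Hom_iff by auto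
  obtain w where w: "in_hom w T (Dom C i)" "i \<cdot> w = f"
    using assms(5)[of f] f T by (auto simp: zero_def)
  show "\<exists>!w. w \<in> carrier (Hom C T (Dom C i)) \<and> i \<cdot> w = f"
  proof (rule ex1I[of _ w])
    show "w \<in> carrier (Hom C T (Dom C i)) \<and> i \<cdot> w = f"
      using w T assms carrier_Hom_iff by auto
    show "w' = w" if "w' \<in> carrier (Hom C T (Dom C i)) \<and> i \<cdot> w' = f" for w'
      using w T assms(1) that carrier_Hom_iff[of T "Dom C i" w'] assms(6)[of w' w] by auto
  qed
qed (use assms in \<open>auto simp: zero_def\<close>)

lemma is_cokernelD:
  assumes "is_cokernel C p i"
  shows "i \<in> Arr C" "p \<in> Arr C" "Cod C i = Dom C p" "p \<cdot> i = zero (Dom C i) (Cod C p)"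
    "\<lbrakk>f \<in> Arr C; Dom C f = Dom C p; f \<cdot> i = zero (Dom C i) (Cod C f)\<rbrakk> \<Longrightarrow>
      \<exists>w. in_hom w (Cod C p) (Cod C f) \<and> w \<cdot> p = f"
    "\<lbrakk>w \<in> Arr C; w' \<in> Arr C; Cod C w' = Cod C w; Dom C w = Cod C p; Dom C w' = Cod C p; w \<cdot> p = w' \<cdot> p\<rbrakk>
      \<Longrightarrow> w = w'"
proof -
  show 1: "i \<in> Arr C" "p \<in> Arr C" "Cod C i = Dom C p" "p \<cdot> i = zero (Dom C i) (Cod C p)"
    using assms by (auto simp: is_cokernel_def zero_def)
  have *: "\<exists>!w. in_hom w (Cod C p) (Cod C f) \<and> w \<cdot> p = f"
    if "f \<in> Arr C" "Dom C f = Dom C p" "f \<cdot> i = zero (Dom C i) (Cod C f)" for f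
  proof -
    have "f \<in> carrier (Hom C (Cod C i) (Cod C f))" using Arr_carrier[of f] that 1 by simp
    then have "\<exists>!w. w \<in> carrier (Hom C (Cod C p) (Cod C f)) \<and> w \<cdot> p = f"
      using assms that by (auto simp: is_cokernel_def zero_def)
    then show ?thesis using 1 that carrier_Hom_iff[of "Cod C p" "Cod C f"] by auto
  qed
  show "\<exists>w. in_hom w (Cod C p) (Cod C f) \<and> w \<cdot> p = f"
    if "f \<in> Arr C" "Dom C f = Dom C p" "f \<cdot> i = zero (Dom C i) (Cod C f)"
    using *[OF that] by auto
  show "w = w'"
    if w: "w \<in> Arr C" "w' \<in> Arr C" "Cod C w' = Cod C w" "Dom C w = Cod C p" "Dom C w' = Cod C p" 
      "w \<cdot> p = w' \<cdot> p"
    using *[of "w \<cdot> p"] w 1 by auto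
qed

lemma is_cokernelI:
  assumes "i \<in> Arr C" "p \<in> Arr C" "Cod C i = Dom C p" "p \<cdot> i = zero (Dom C i) (Cod C p)"
    "\<And>f. \<lbrakk>f \<in> Arr C; Dom C f = Dom C p; f \<cdot> i = zero (Dom C i) (Cod C f)\<rbrakk> \<Longrightarrow>
      \<exists>w. in_hom w (Cod C p) (Cod C f) \<and> w \<cdot> p = f"
    "\<And>w w'. \<lbrakk>w \<in> Arr C; w' \<in> Arr C; Cod C w' = Cod C w; Dom C w = Cod C p; Dom C w' = Cod C p;
      w \<cdot> p = w' \<cdot> p\<rbrakk> \<Longrightarrow> w = w'"
  shows "is_cokernel C p i"
  unfolding is_cokernel_def
proof (intro conjI ballI impI)
  fix T f assume T: "T \<in> Obj C" "f \<in> carrier (Hom C (Cod C i) T)" "f \<cdot> i = \<one>\<^bsub>Hom C (Dom C i) T\<^esub>"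
  then have f: "in_hom f (Dom C p) T" using assms carrier_Hom_iff by auto
  obtain w where w: "in_hom w (Cod C p) T" "w \<cdot> p = f"
    using assms(5)[of f] f T by (auto simp: zero_def)
  show "\<exists>!w. w \<in> carrier (Hom C (Cod C p) T) \<and> w \<cdot> p = f"
  proof (rule ex1I[of _ w])
    show "w \<in> carrier (Hom C (Cod C p) T) \<and> w \<cdot> p = f"
      using w T assms carrier_Hom_iff by auto
    show "w' = w" if "w' \<in> carrier (Hom C (Cod C p) T) \<and> w' \<cdot> p = f" for w'
      using w T assms(2) that carrier_Hom_iff[of "Cod C p" T w'] assms(6)[of w' w] by auto
  qed
qed (use assms in \<open>auto simp: zero_def\<close>)

lemma is_pullbackD:
  assumes "is_pullback C b f h g"
  shows "b \<in> Arr C" "f \<in> Arr C" "h \<in> Arr C" "g \<in> Arr C" "Cod C b = Cod C f" "Dom C h = Dom C g"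
    "Cod C h = Dom C b" "Cod C g = Dom C f" "b \<cdot> h = f \<cdot> g"
    "\<lbrakk>u \<in> Arr C; v \<in> Arr C; Dom C v = Dom C u; Cod C u = Dom C b; Cod C v = Dom C f; b \<cdot> u = f \<cdot> v\<rbrakk> \<Longrightarrow>
      \<exists>w. in_hom w (Dom C u) (Dom C g) \<and> h \<cdot> w = u \<and> g \<cdot> w = v"
    "\<lbrakk>w \<in> Arr C; w' \<in> Arr C; Dom C w' = Dom C w; Cod C w = Dom C g; Cod C w' = Dom C g;
      h \<cdot> w = h \<cdot> w'; g \<cdot> w = g \<cdot> w'\<rbrakk> \<Longrightarrow> w = w'"
proof -
  show 1: "b \<in> Arr C" "f \<in> Arr C" "h \<in> Arr C" "g \<in> Arr C" "Cod C b = Cod C f" "Dom C h = Dom C g"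
    "Cod C h = Dom C b" "Cod C g = Dom C f" "b \<cdot> h = f \<cdot> g"
    using assms by (auto simp: is_pullback_def)
  have *: "\<exists>!w. in_hom w (Dom C u) (Dom C g) \<and> h \<cdot> w = u \<and> g \<cdot> w = v"
    if "u \<in> Arr C" "v \<in> Arr C" "Dom C v = Dom C u" "Cod C u = Dom C b" "Cod C v = Dom C f" "b \<cdot> u = f \<cdot> v"
    for u v
  proof -
    have "u \<in> carrier (Hom C (Dom C u) (Dom C b))" "v \<in> carrier (Hom C (Dom C u) (Dom C f))"
      using Arr_carrier[of u] Arr_carrier[of v] that 1 by simp_all
    moreover have "\<forall>T \<in> Obj C. \<forall>u \<in> carrier (Hom C T (Dom C b)). \<forall>v \<in> carrier (Hom C T (Dom C f)).
        b \<cdot> u = f \<cdot> v \<longrightarrow> (\<exists>!w. w \<in> carrier (Hom C T (Dom C h)) \<and> h \<cdot> w = u \<and> g \<cdot> w = v)"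
      using assms unfolding is_pullback_def by (elim conjE) assumption
    ultimately have "\<exists>!w. w \<in> carrier (Hom C (Dom C u) (Dom C h)) \<and> h \<cdot> w = u \<and> g \<cdot> w = v"
      using that(1,6) Dom_Obj by blast
    then show ?thesis using 1 that carrier_Hom_iff[of "Dom C u" "Dom C g"] by auto
  qed
  show "\<exists>w. in_hom w (Dom C u) (Dom C g) \<and> h \<cdot> w = u \<and> g \<cdot> w = v"
    if "u \<in> Arr C" "v \<in> Arr C" "Dom C v = Dom C u" "Cod C u = Dom C b" "Cod C v = Dom C f" "b \<cdot> u = f \<cdot> v"
    using *[OF that] by auto
  show "w = w'"
    if w: "w \<in> Arr C" "w' \<in> Arr C" "Dom C w' = Dom C w" "Cod C w = Dom C g" "Cod C w' = Dom C g"
      "h \<cdot> w = h \<cdot> w'" "g \<cdot> w = g \<cdot> w'"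
  proof -
    have "b \<cdot> (h \<cdot> w) = f \<cdot> (g \<cdot> w)" using comp_eq_assoc[OF 1(9)] w(1-5) 1 by simp
    then show ?thesis using *[of "h \<cdot> w" "g \<cdot> w"] w 1 by auto
  qed
qed

lemma is_pullback_sym:
  assumes "is_pullback C b f h g"
  shows "is_pullback C f b g h"
proof -
  note P = is_pullbackD[OF assms]
  show ?thesis
    unfolding is_pullback_def
  proof (intro conjI ballI impI)
    fix T u v
    assume T: "T \<in> Obj C" "u \<in> carrier (Hom C T (Dom C f))" "v \<in> carrier (Hom C T (Dom C b))"
      "f \<cdot> u = b \<cdot> v"
    have "\<forall>T \<in> Obj C. \<forall>u \<in> carrier (Hom C T (Dom C b)). \<forall>v \<in> carrier (Hom C T (Dom C f)).
        b \<cdot> u = f \<cdot> v \<longrightarrow> (\<exists>!w. w \<in> carrier (Hom C T (Dom C h)) \<and> h \<cdot> w = u \<and> g \<cdot> w = v)"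
      using assms unfolding is_pullback_def by (elim conjE) assumption
    then have "\<exists>!w. w \<in> carrier (Hom C T (Dom C h)) \<and> h \<cdot> w = v \<and> g \<cdot> w = u"
      using T(1-3) T(4)[symmetric] by blast
    then show "\<exists>!w. w \<in> carrier (Hom C T (Dom C g)) \<and> g \<cdot> w = u \<and> h \<cdot> w = v"
      unfolding P(6) by (simp only: conj_commute[of "h \<cdot> _ = _"])
  qed (use P in auto)
qed

lemma is_pushoutD:
  assumes "is_pushout C b f h g"
  shows "b \<in> Arr C" "f \<in> Arr C" "h \<in> Arr C" "g \<in> Arr C" "Dom C b = Dom C f" "Cod C h = Cod C g"
    "Dom C h = Cod C b" "Dom C g = Cod C f" "h \<cdot> b = g \<cdot> f"
    "\<lbrakk>u \<in> Arr C; v \<in> Arr C; Cod C v = Cod C u; Dom C u = Cod C b; Dom C v = Cod C f; u \<cdot> b = v \<cdot> f\<rbrakk> \<Longrightarrow>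
      \<exists>w. in_hom w (Cod C g) (Cod C u) \<and> w \<cdot> h = u \<and> w \<cdot> g = v"
    "\<lbrakk>w \<in> Arr C; w' \<in> Arr C; Cod C w' = Cod C w; Dom C w = Cod C g; Dom C w' = Cod C g;
      w \<cdot> h = w' \<cdot> h; w \<cdot> g = w' \<cdot> g\<rbrakk> \<Longrightarrow> w = w'"
proof -
  show 1: "b \<in> Arr C" "f \<in> Arr C" "h \<in> Arr C" "g \<in> Arr C" "Dom C b = Dom C f" "Cod C h = Cod C g"
    "Dom C h = Cod C b" "Dom C g = Cod C f" "h \<cdot> b = g \<cdot> f"
    using assms by (auto simp: is_pushout_def)
  have *: "\<exists>!w. in_hom w (Cod C g) (Cod C u) \<and> w \<cdot> h = u \<and> w \<cdot> g = v"
    if "u \<in> Arr C" "v \<in> Arr C" "Cod C v = Cod C u" "Dom C u = Cod C b" "Dom C v = Cod C f" "u \<cdot> b = v \<cdot> f"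
    for u v
  proof -
    have "u \<in> carrier (Hom C (Cod C b) (Cod C u))" "v \<in> carrier (Hom C (Cod C f) (Cod C u))"
      using Arr_carrier[of u] Arr_carrier[of v] that 1 by simp_all
    moreover have "\<forall>T \<in> Obj C. \<forall>u \<in> carrier (Hom C (Cod C b) T). \<forall>v \<in> carrier (Hom C (Cod C f) T).
        u \<cdot> b = v \<cdot> f \<longrightarrow> (\<exists>!w. w \<in> carrier (Hom C (Cod C h) T) \<and> w \<cdot> h = u \<and> w \<cdot> g = v)"
      using assms unfolding is_pushout_def by (elim conjE) assumption
    ultimately have "\<exists>!w. w \<in> carrier (Hom C (Cod C h) (Cod C u)) \<and> w \<cdot> h = u \<and> w \<cdot> g = v"
      using that(1,6) Cod_Obj by blast
    then show ?thesis using 1 that carrier_Hom_iff[of "Cod C g" "Cod C u"] by auto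
  qed
  show "\<exists>w. in_hom w (Cod C g) (Cod C u) \<and> w \<cdot> h = u \<and> w \<cdot> g = v"
    if "u \<in> Arr C" "v \<in> Arr C" "Cod C v = Cod C u" "Dom C u = Cod C b" "Dom C v = Cod C f" "u \<cdot> b = v \<cdot> f"
    using *[OF that] by auto
  show "w = w'"
    if w: "w \<in> Arr C" "w' \<in> Arr C" "Cod C w' = Cod C w" "Dom C w = Cod C g" "Dom C w' = Cod C g"
      "w \<cdot> h = w' \<cdot> h" "w \<cdot> g = w' \<cdot> g"
  proof -
    have "(w \<cdot> h) \<cdot> b = (w \<cdot> g) \<cdot> f" using w(1-5) 1 by simp
    then show ?thesis using *[of "w \<cdot> h" "w \<cdot> g"] w 1 by auto
  qed
qed

text \<open>\<open>is_biproduct\<close> hides the four structure maps under quantifiers. Here they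
  are the data, and the three objects are recovered as domains.\<close>

definition biprod :: "'m \<Rightarrow> 'm \<Rightarrow> 'm \<Rightarrow> 'm \<Rightarrow> bool" where
  "biprod i j p q \<longleftrightarrow> {i, j, p, q} \<subseteq> Arr C \<and> Cod C i = Dom C p \<and> Cod C j = Dom C p \<and> Dom C q = Dom C p \<and>
     Cod C p = Dom C i \<and> Cod C q = Dom C j \<and>
     p \<cdot> i = Id C (Dom C i) \<and> q \<cdot> j = Id C (Dom C j) \<and>
     q \<cdot> i = zero (Dom C i) (Dom C j) \<and> p \<cdot> j = zero (Dom C j) (Dom C i) \<and>
     (i \<cdot> p) \<boxplus> (j \<cdot> q) = Id C (Dom C p)"

lemma biprodD:
  assumes "biprod i j p q"
  shows "i \<in> Arr C" "j \<in> Arr C" "p \<in> Arr C" "q \<in> Arr C"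
    "Cod C i = Dom C p" "Cod C j = Dom C p" "Dom C q = Dom C p" "Cod C p = Dom C i" "Cod C q = Dom C j"
    "p \<cdot> i = Id C (Dom C i)" "q \<cdot> j = Id C (Dom C j)"
    "q \<cdot> i = zero (Dom C i) (Dom C j)" "p \<cdot> j = zero (Dom C j) (Dom C i)"
    "(i \<cdot> p) \<boxplus> (j \<cdot> q) = Id C (Dom C p)"
  using assms by (auto simp: biprod_def)

lemma biprod_commute: "biprod i j p q \<Longrightarrow> biprod j i q p"
  unfolding biprod_def by (auto simp: add_commute)

lemma is_biproduct_iff: 
  "is_biproduct C B X Y \<longleftrightarrow> (\<exists>i j p q. biprod i j p q \<and> Dom C p = B \<and> Dom C i = X \<and> Dom C j = Y)"
proof
  assume "is_biproduct C B X Y"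
  then obtain i j p q where O: "B \<in> Obj C" "X \<in> Obj C" "Y \<in> Obj C"
    and c: "i \<in> carrier (Hom C X B)" "j \<in> carrier (Hom C Y B)" "p \<in> carrier (Hom C B X)" 
      "q \<in> carrier (Hom C B Y)"
    and e: "p \<cdot> i = Id C X" "q \<cdot> j = Id C Y" "q \<cdot> i = \<one>\<^bsub>Hom C X Y\<^esub>" "p \<cdot> j = \<one>\<^bsub>Hom C Y X\<^esub>"
        "(i \<cdot> p) \<otimes>\<^bsub>Hom C B B\<^esub> (j \<cdot> q) = Id C B"
    unfolding is_biproduct_def by blast
  have h: "in_hom i X B" "in_hom j Y B" "in_hom p B X" "in_hom q B Y"
    using c O by (simp_all add: carrier_Hom_iff)
  then have "(i \<cdot> p) \<boxplus> (j \<cdot> q) = Id C B" using e(5) by (simp add: add_def)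
  then have "biprod i j p q" unfolding biprod_def using h e(1-4) by (simp flip: zero_def)
  then show "\<exists>i j p q. biprod i j p q \<and> Dom C p = B \<and> Dom C i = X \<and> Dom C j = Y"
    using h by blast
next
  assume "\<exists>i j p q. biprod i j p q \<and> Dom C p = B \<and> Dom C i = X \<and> Dom C j = Y"
  then obtain i j p q where b: "biprod i j p q" "Dom C p = B" "Dom C i = X" "Dom C j = Y" by blast
  note d = biprodD[OF b(1)]
  have O: "B \<in> Obj C" "X \<in> Obj C" "Y \<in> Obj C" using d(1-4) b by auto
  have "i \<in> carrier (Hom C X B)" "j \<in> carrier (Hom C Y B)" "p \<in> carrier (Hom C B X)" 
      "q \<in> carrier (Hom C B Y)" using d b O by (auto simp: carrier_Hom_iff)
  moreover have "(i \<cdot> p) \<otimes>\<^bsub>Hom C B B\<^esub> (j \<cdot> q) = Id C B" 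
    using d(14) d(1-9) b by (simp add: add_def)
  ultimately show "is_biproduct C B X Y"
    unfolding is_biproduct_def using O d(10-13) b by (auto simp flip: zero_def)
qed

text \<open>The idempotent \<open>Id - s \<cdot> r\<close> is killed by \<open>r\<close>, hence
  factors as \<open>k \<cdot> t\<close>; this \<open>t\<close> is the missing projection. Its
  identities are checked after composition with the monic \<open>k\<close>.\<close>

lemma retraction_kernel_biprod:
  assumes "is_kernel C k r" "in_hom s (Cod C r) (Dom C r)" "r \<cdot> s = Id C (Cod C r)"
  shows "\<exists>t. biprod s k r t"
proof -
  note K = is_kernelD[OF assms(1)]
  let ?e = "Id C (Dom C r) \<boxminus> s \<cdot> r"
  have e: "in_hom ?e (Dom C r) (Dom C r)" using K assms by auto
  have rsr: "r \<cdot> (s \<cdot> r) = r" using K assms(2) comp_assoc'[of r s r] by (simp add: assms(3))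
  have "r \<cdot> ?e = zero (Dom C r) (Cod C r)" using K(1-3) assms(2) by (simp add: rsr)
  then obtain t where t: "in_hom t (Dom C r) (Dom C k)" "k \<cdot> t = ?e"
    using K(5)[of ?e] e by auto
  have "t \<cdot> k = Id C (Dom C k)"
  proof (rule K(6))
    have "k \<cdot> (t \<cdot> k) = ?e \<cdot> k" using K(1-3) t by (simp flip: comp_assoc' t(2))
    also have "\<dots> = k" using K(1-4) assms(2) by simp
    finally show "k \<cdot> (t \<cdot> k) = k \<cdot> Id C (Dom C k)" using K(1) by simp
  qed (use K t in auto)
  moreover have "t \<cdot> s = zero (Cod C r) (Dom C k)"
  proof (rule K(6))
    have "k \<cdot> (t \<cdot> s) = ?e \<cdot> s" using K(1-3) t assms(2) by (simp flip: comp_assoc' t(2))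
    also have "\<dots> = k \<cdot> zero (Cod C r) (Dom C k)" using K(1-4) assms(2,3) by simp
    finally show "k \<cdot> (t \<cdot> s) = k \<cdot> zero (Cod C r) (Dom C k)" .
  qed (use K t assms(2) in auto)
  ultimately have "biprod s k r t"
    unfolding biprod_def using K(1-4) assms(2,3) t by simp
  then show ?thesis ..
qed

end

section \<open>Split sequences and rigidity in exact categories\<close>

context preadditive_category
begin

text \<open>The automorphism with matrix rows \<open>(1, 0)\<close> and \<open>(f, 1)\<close> moves
  the inclusion \<open>i\<close> to the graph of \<open>f\<close>, so that the graph is part of a
  decomposition too.\<close>

lemma biprod_shear:
  assumes "biprod i j p q" "in_hom f (Dom C i) (Dom C j)"
  shows "biprod (i \<boxplus> j \<cdot> f) j p (q \<boxminus> f \<cdot> p)"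
proof -
  note d = biprodD[OF assms(1)]
  note r = comp_eq_assoc[OF d(10)] comp_eq_assoc[OF d(11)] comp_eq_assoc[OF d(12)] comp_eq_assoc[OF d(13)]
  have "(i \<boxplus> j \<cdot> f) \<cdot> p \<boxplus> j \<cdot> (q \<boxminus> f \<cdot> p) = i \<cdot> p \<boxplus> j \<cdot> q"
    using d(1-9) assms(2) by (simp add: minus_def add_ac)
  then show ?thesis
    unfolding biprod_def using d assms(2) by (simp add: r)
qed

lemma biprod_cokernel:
  assumes "biprod i j p q"
  shows "is_cokernel C q i"
proof -
  note d = biprodD[OF assms(1)]
  show ?thesis
  proof (rule is_cokernelI)
    fix f assume f: "f \<in> Arr C" "Dom C f = Dom C q" "f \<cdot> i = zero (Dom C i) (Cod C f)"
    have "f = f \<cdot> (i \<cdot> p \<boxplus> j \<cdot> q)" unfolding d(14) using f d by simp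
    also have "\<dots> = (f \<cdot> j) \<cdot> q" using f d(1-9) by (simp add: comp_eq_assoc[OF f(3)])
    finally show "\<exists>w. in_hom w (Cod C q) (Cod C f) \<and> w \<cdot> q = f"
      using f d by (intro exI[of _ "f \<cdot> j"]) simp
  next
    fix w w' assume w: "w \<in> Arr C" "w' \<in> Arr C" "Cod C w' = Cod C w" "Dom C w = Cod C q"
      "Dom C w' = Cod C q" "w \<cdot> q = w' \<cdot> q"
    have "(w \<cdot> q) \<cdot> j = (w' \<cdot> q) \<cdot> j" using w by simp
    then show "w = w'" using w(1-5) d by simp
  qed (use d in auto)
qed

text \<open>The compatible pair \<open>(0, i)\<close> induces \<open>k\<close>. Base change thus
  leaves the left end of a short exact sequence unchanged, which is how a kernel in \<open>M\<close>
  stays in \<open>M\<close>.\<close>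

lemma pullback_kernel:
  assumes "is_pullback C b f h g" "is_kernel C i f"
  shows "\<exists>k. is_kernel C k h \<and> Dom C k = Dom C i \<and> g \<cdot> k = i"
proof -
  note P = is_pullbackD[OF assms(1)] and K = is_kernelD[OF assms(2)]
  obtain k where k: "in_hom k (Dom C i) (Dom C g)" "h \<cdot> k = zero (Dom C i) (Dom C b)" "g \<cdot> k = i"
    using P(10)[of "zero (Dom C i) (Dom C b)" i] P(1-8) K(1-4) by auto
  have "is_kernel C k h"
  proof (rule is_kernelI)
    fix v assume v: "v \<in> Arr C" "Cod C v = Dom C h" "h \<cdot> v = zero (Dom C v) (Cod C h)"
    have "f \<cdot> (g \<cdot> v) = b \<cdot> (h \<cdot> v)" using comp_eq_assoc[OF P(9), of v] P(1-8) v(1,2) by simp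
    also have "\<dots> = zero (Dom C v) (Cod C f)" using P(1-8) v by simp
    finally obtain w where w: "in_hom w (Dom C v) (Dom C i)" "i \<cdot> w = g \<cdot> v"
      using K(5)[of "g \<cdot> v"] P(1-8) v by auto
    have "k \<cdot> w = v"
      by (rule P(11)) (use P(1-8) v w k K(1-3) in \<open>simp_all add: comp_eq_assoc[OF k(2)] comp_eq_assoc[OF k(3)]\<close>)
    then show "\<exists>w. in_hom w (Dom C v) (Dom C k) \<and> k \<cdot> w = v" using w k by auto
  next
    fix w w' assume w: "w \<in> Arr C" "w' \<in> Arr C" "Dom C w' = Dom C w" "Cod C w = Dom C k" "Cod C w' = Dom C k"
      "k \<cdot> w = k \<cdot> w'"
    have "i \<cdot> w = g \<cdot> (k \<cdot> w)" "i \<cdot> w' = g \<cdot> (k \<cdot> w')"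
      using w(1-5) k P K by (simp_all add: comp_eq_assoc[OF k(3)])
    then show "w = w'" using w k K(6)[of w w'] by simp
  qed (use P k in auto)
  then show ?thesis using k by auto
qed

end

context exact_category
begin

section \<open>Recognising short exact sequences\<close>

lemma S_D:
  assumes "(i, p) \<in> S"
  shows "is_kernel C i p" "is_cokernel C p i" "i \<in> Arr C" "p \<in> Arr C" "Cod C i = Dom C p"
    "p \<cdot> i = zero (Dom C i) (Cod C p)"
  using kernel_cokernel[OF assms] is_kernelD(1-4)[of i p] by auto

text \<open>The class \<open>S\<close> contains some kernel of \<open>p\<close>; any other kernel
  differs from it by an isomorphism, and \<open>S\<close> is closed under isomorphism.\<close>

lemma S_kernelI:
  assumes "deflation S p" "is_kernel C k p"
  shows "(k, p) \<in> S"
proof -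
  obtain i where i: "(i, p) \<in> S" using assms by (auto simp: deflation_def)
  note K = is_kernelD[OF assms(2)] and L = is_kernelD[OF S_D(1)[OF i]]
  obtain a where a: "in_hom a (Dom C i) (Dom C k)" "k \<cdot> a = i" using K(5)[of i] L by auto
  obtain b where b: "in_hom b (Dom C k) (Dom C i)" "i \<cdot> b = k" using L(5)[of k] K by auto
  have ba: "b \<cdot> a = Id C (Dom C i)"
    by (rule L(6)) (use a b K L in \<open>simp_all add: comp_eq_assoc[OF b(2)]\<close>)
  have ab: "a \<cdot> b = Id C (Dom C k)"
    by (rule K(6)) (use a b K L in \<open>simp_all add: comp_eq_assoc[OF a(2)]\<close>)
  have iso: "is_iso C a" by (rule is_isoI[of a b]) (use a b ab ba in auto)
  show ?thesis
    by (rule iso_closed[OF i, of k p a "Id C (Dom C p)" "Id C (Cod C p)"]) (use a K L iso in auto)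
qed

lemma S_cokernelI:
  assumes "inflation S i" "is_cokernel C q i"
  shows "(i, q) \<in> S"
proof -
  obtain p where p: "(i, p) \<in> S" using assms by (auto simp: inflation_def)
  note K = is_cokernelD[OF assms(2)] and L = is_cokernelD[OF S_D(2)[OF p]]
  obtain a where a: "in_hom a (Cod C p) (Cod C q)" "a \<cdot> p = q" using L(5)[of q] K L(1-4) by auto
  obtain b where b: "in_hom b (Cod C q) (Cod C p)" "b \<cdot> q = p" using K(5)[of p] K(1-4) L by auto
  have ba: "b \<cdot> a = Id C (Cod C p)"
    by (rule L(6)) (use a b K L in \<open>simp_all\<close>)
  have ab: "a \<cdot> b = Id C (Cod C q)"
    by (rule K(6)) (use a b K L in \<open>simp_all\<close>)
  have iso: "is_iso C a" by (rule is_isoI[of a b]) (use a b ab ba in auto)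
  show ?thesis
    by (rule iso_closed[OF p, of i q "Id C (Dom C i)" "Id C (Cod C i)" a]) (use a K L iso in auto)
qed

lemma inflation_iso_comp:
  assumes "inflation S i" "is_iso C a" "Dom C a = Cod C i"
  shows "inflation S (a \<cdot> i)"
proof -
  obtain p where p: "(i, p) \<in> S" using assms by (auto simp: inflation_def)
  note L = S_D(3-6)[OF p]
  obtain b where b: "a \<in> Arr C" "in_hom b (Cod C a) (Dom C a)" "b \<cdot> a = Id C (Dom C a)" "is_iso C b"
    using is_isoE[OF assms(2)] by metis
  have "(a \<cdot> i, p \<cdot> b) \<in> S"
    by (rule iso_closed[OF p, of "a \<cdot> i" "p \<cdot> b" "Id C (Dom C i)" a "Id C (Cod C p)"])
      (use b L assms in auto)
  then show ?thesis by (auto simp: inflation_def)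
qed

lemma biprod_S:
  assumes "biprod i j p q"
  shows "(i, q) \<in> S"
proof -
  note d = biprodD[OF assms]
  let ?Y = "Dom C j"
  \<comment> \<open>An identity is a deflation, so its kernel, a map out of a zero object, is an
    inflation. The pushout of this kernel along the zero map to \<open>Dom C i\<close> is again a
    biproduct, and \<open>\<phi>\<close> compares it with the given one.\<close>
  obtain k where k: "(k, Id C ?Y) \<in> S" using id_deflation[of ?Y] d by (auto simp: deflation_def)
  have k': "in_hom k (Dom C k) ?Y" "k = zero (Dom C k) ?Y" using S_D(3-6)[OF k] d by auto
  let ?f = "zero (Dom C k) (Dom C i)"
  have k_inf: "inflation S k" using k by (auto simp: inflation_def)
  have f: "?f \<in> Arr C" "Dom C ?f = Dom C k" using k' d by auto
  obtain h g where P: "is_pushout C ?f k h g" and h: "inflation S h"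
    using inflation_pushout[OF k_inf f] by auto
  note Q = is_pushoutD[OF P]
  have "i \<cdot> ?f = j \<cdot> k" using d k'(1) by (subst k'(2)) simp
  then obtain \<phi> where \<phi>: "in_hom \<phi> (Cod C g) (Dom C p)" "\<phi> \<cdot> h = i" "\<phi> \<cdot> g = j"
    using Q(10)[of i j] d(1-9) Q(1-8) k'(1) by auto
  let ?\<psi> = "h \<cdot> p \<boxplus> g \<cdot> q"
  have Q': "Dom C h = Dom C i" "Dom C g = ?Y" using Q(7,8) k' d by auto
  have \<psi>: "in_hom ?\<psi> (Dom C p) (Cod C g)" using Q(1-8) Q' d(1-9) k' by simp
  have 1: "?\<psi> \<cdot> \<phi> = Id C (Cod C g)"
    by (rule Q(11)) (use \<phi> \<psi> Q(1-8) Q' d k' in \<open>simp_all\<close>)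
  have 2: "\<phi> \<cdot> ?\<psi> = Id C (Dom C p)"
    using \<phi> Q(1-8) Q' d k' by (simp add: comp_eq_assoc[OF \<phi>(2)] comp_eq_assoc[OF \<phi>(3)])
  have "is_iso C \<phi>" by (rule is_isoI[of \<phi> ?\<psi>]) (use 1 2 \<phi> \<psi> in auto)
  then have "inflation S i" using inflation_iso_comp[OF h, of \<phi>] \<phi> Q by simp
  then show ?thesis by (rule S_cokernelI) (rule biprod_cokernel[OF assms])
qed

lemma biprod_exists:
  assumes "X \<in> Obj C" "Y \<in> Obj C"
  shows "\<exists>i j p q. biprod i j p q \<and> Dom C i = X \<and> Dom C j = Y"
  using biproducts[OF assms] is_biproduct_iff by blast

text \<open>The matrix \<open>(i, f)\<close> is the sheared inclusion \<open>A \<rightarrow> A \<oplus> Z\<close> followed by \<open>i \<oplus> 1\<close>, a pushout of \<open>i\<close>.\<close>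

lemma inflation_col:
  assumes "inflation S i" "f \<in> Arr C" "Dom C f = Dom C i"
  shows "\<exists>u v p q. biprod u v p q \<and> Dom C u = Cod C i \<and> Dom C v = Cod C f \<and> inflation S (u \<cdot> i \<boxplus> v \<cdot> f)"
proof -
  obtain p0 where p0: "(i, p0) \<in> S" using assms by (auto simp: inflation_def)
  note i = S_D(3-6)[OF p0]
  obtain a b r s where B: "biprod a b r s" "Dom C a = Dom C i" "Dom C b = Cod C f"
    using biprod_exists[of "Dom C i" "Cod C f"] i assms by auto
  note d = biprodD[OF B(1)]
  obtain h g where P: "is_pushout C a i h g" and h: "inflation S h"
    using inflation_pushout[OF assms(1) d(1) B(2)] by auto
  note Q = is_pushoutD[OF P]
  \<comment> \<open>The pushout is \<open>Cod C i \<oplus> Cod C f\<close>: its inclusions are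
    \<open>g\<close> and \<open>h \<cdot> b\<close>, and the pairs \<open>(i \<cdot> r, Id)\<close>
    and \<open>(s, 0)\<close> induce its projections \<open>p\<close> and \<open>q\<close>.\<close>
  have "(i \<cdot> r) \<cdot> a = Id C (Cod C i) \<cdot> i" using i d B by simp
  then obtain p where p: "in_hom p (Cod C g) (Cod C i)" "p \<cdot> h = i \<cdot> r" "p \<cdot> g = Id C (Cod C i)"
    using Q(10)[of "i \<cdot> r" "Id C (Cod C i)"] i d(1-9) B by auto
  have "s \<cdot> a = zero (Cod C i) (Cod C f) \<cdot> i" using i d B assms by simp
  then obtain q where q: "in_hom q (Cod C g) (Cod C f)" "q \<cdot> h = s" "q \<cdot> g = zero (Cod C i) (Cod C f)"
    using Q(10)[of "s" "zero (Cod C i) (Cod C f)"] i d(1-9) B assms by auto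
  let ?v = "h \<cdot> b"
  have t: "Dom C g = Dom C p0" "Dom C h = Dom C r" "Cod C h = Cod C g" using Q(5-8) d i by auto
  have 1: "g \<cdot> p \<boxplus> ?v \<cdot> q = Id C (Cod C g)"
  proof (rule Q(11))
    have "(g \<cdot> p \<boxplus> ?v \<cdot> q) \<cdot> h = g \<cdot> (i \<cdot> r) \<boxplus> h \<cdot> (b \<cdot> s)" 
      using p q Q(1-4) t d(1-9) B i by simp
    also have "g \<cdot> (i \<cdot> r) = h \<cdot> (a \<cdot> r)"
      using p q Q(1-4) t d(1-9) B i comp_eq_assoc[OF Q(9)[symmetric], of r] by simp
    also have "h \<cdot> (a \<cdot> r) \<boxplus> h \<cdot> (b \<cdot> s) = h \<cdot> (a \<cdot> r \<boxplus> b \<cdot> s)"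
      using Q(1-4) t d(1-9) B i by simp
    also have "\<dots> = Id C (Cod C g) \<cdot> h" unfolding d(14) using Q(1-4) t by simp
    finally show "(g \<cdot> p \<boxplus> ?v \<cdot> q) \<cdot> h = Id C (Cod C g) \<cdot> h" .
    show "(g \<cdot> p \<boxplus> ?v \<cdot> q) \<cdot> g = Id C (Cod C g) \<cdot> g"
      using p q Q(1-4) t d(1-9) B i by simp
  qed (use p q Q(1-4) t d(1-9) B i in simp_all)
  have bi: "biprod g ?v p q"
    unfolding biprod_def using p q Q(1-4) t d B i assms 1
    by (simp add: comp_eq_assoc[OF p(2)] comp_eq_assoc[OF q(2)])
  have "inflation S (a \<boxplus> b \<cdot> f)"
    using biprod_S[OF biprod_shear[OF B(1), of f]] B assms by (auto simp: inflation_def)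
  then have "inflation S (h \<cdot> (a \<boxplus> b \<cdot> f))"
    by (rule inflation_comp[OF _ h]) (use d t B assms in simp)
  also have "h \<cdot> (a \<boxplus> b \<cdot> f) = g \<cdot> i \<boxplus> ?v \<cdot> f"
    using d(1-9) t B assms Q(1-4,9) by simp
  finally show ?thesis using bi Q(8) Q(1-4) t d(1-9) B
    by (intro exI[of _ g] exI[of _ ?v] exI[of _ p] exI[of _ q]) simp
qed

text \<open>There is only one class of extensions, so \<open>(i, p)\<close> is equivalent to the
  split one, and the inclusion of the split one is carried back along the equivalence.\<close>

lemma rigid_section:
  assumes "rigid C S M" "(i, p) \<in> S" "Dom C i \<in> M" "Cod C p \<in> M"
  shows "\<exists>s. in_hom s (Cod C p) (Dom C p) \<and> p \<cdot> s = Id C (Cod C p)"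
proof -
  let ?X = "Cod C p" and ?Y = "Dom C i"
  note L = S_D(3-6)[OF assms(2)]
  obtain a b r s where B: "biprod a b r s" "Dom C a = ?Y" "Dom C b = ?X"
    using biprod_exists[of ?Y ?X] L by auto
  note d = biprodD[OF B(1)]
  have E: "(a, s) \<in> extensions C S ?X ?Y" "(i, p) \<in> extensions C S ?X ?Y"
    using biprod_S[OF B(1)] assms(2) B d by (auto simp: extensions_def)
  have "is_singleton (Ext1 C S ?X ?Y)" using assms(1,3,4) by (simp add: rigid_def)
  then obtain x where x: "Ext1 C S ?X ?Y = {x}" by (rule is_singletonE)
  \<comment> \<open>Equality of the two classes together with reflexivity at \<open>(a, s)\<close>
    already yields an equivalence; symmetry and transitivity of \<open>ext_equiv\<close> need not be
    established.\<close>
  have "ext_equiv C S ?X ?Y `` {(i, p)} = ext_equiv C S ?X ?Y `` {(a, s)}"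
    using E[THEN quotientI, of "ext_equiv C S ?X ?Y"] x by (simp add: Ext1_def)
  moreover have "((a, s), (a, s)) \<in> ext_equiv C S ?X ?Y"
    unfolding ext_equiv_def using E d B by (auto intro!: exI[of _ "Id C (Dom C r)"])
  ultimately have "((i, p), (a, s)) \<in> ext_equiv C S ?X ?Y" by auto
  then obtain e where e: "is_iso C e" "Dom C e = Cod C i" "Cod C e = Cod C a" "s \<cdot> e = p"
    by (auto simp: ext_equiv_def)
  obtain e' where e': "e \<in> Arr C" "in_hom e' (Cod C e) (Dom C e)" "e \<cdot> e' = Id C (Cod C e)"
    using is_isoE[OF e(1)] by metis
  have "p \<cdot> (e' \<cdot> b) = s \<cdot> ((e \<cdot> e') \<cdot> b)" unfolding e(4)[symmetric] using e(1-3) e'(1,2) d L B by simp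
  also have "\<dots> = Id C ?X" unfolding e'(3) using e d B by simp
  finally show ?thesis using e e' d L B by (intro exI[of _ "e' \<cdot> b"]) simp
qed

text \<open>The pullback of the sequence along \<open>f\<close> is an extension of
  \<open>Dom C f\<close> by \<open>Dom C i\<close>, hence split; its section followed by the
  projection to \<open>Dom C p\<close> is the lift. Later arguments use rigidity in this
  form.\<close>

lemma rigid_lift:
  assumes "rigid C S M" "(i, p) \<in> S" "Dom C i \<in> M" "Dom C f \<in> M" "f \<in> Arr C" "Cod C f = Cod C p"
  shows "\<exists>g. in_hom g (Dom C f) (Dom C p) \<and> p \<cdot> g = f"
proof -
  have "deflation S p" using assms by (auto simp: deflation_def)
  then obtain h g where P: "is_pullback C f p h g" and h: "deflation S h"
    using deflation_pullback[of p f] assms by auto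
  note Q = is_pullbackD[OF P]
  obtain k where k: "is_kernel C k h" "Dom C k = Dom C i"
    using pullback_kernel[OF P S_D(1)[OF assms(2)]] by auto
  have "Cod C h \<in> M" using Q assms by simp
  then obtain s where s: "in_hom s (Cod C h) (Dom C h)" "h \<cdot> s = Id C (Cod C h)"
    using rigid_section[OF assms(1) S_kernelI[OF h k(1)]] k assms by auto
  have "p \<cdot> (g \<cdot> s) = f \<cdot> (h \<cdot> s)" using comp_eq_assoc[OF Q(9), of s] Q(1-8) s(1) by simp
  also have "\<dots> = f" unfolding s(2) using Q(1-8) by simp
  finally show ?thesis using Q(1-8) s by (intro exI[of _ "g \<cdot> s"]) simp
qed

end

section \<open>Stably zero morphisms and the functor G\<close>

text \<open>Isomorphisms of presheaves are detected on components: the inverse of a bijective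
  homomorphism is a homomorphism, and naturality of the inverses follows by cancelling
  \<open>\<eta>\<close>.\<close>

lemma Mod_isoI:
  assumes \<eta>: "Mod_mor C F F' \<eta>" and bij: "\<And>X. X \<in> Obj C \<Longrightarrow> bij_betw (\<eta> X) (carrier (Fob F X)) (carrier (Fob F' X))"
  shows "Mod_iso C F F' \<eta>"
proof -
  define \<theta> where "\<theta> X = inv_into (carrier (Fob F X)) (\<eta> X)" for X
  have F: "Mod_obj C F" "Mod_obj C F'" using \<eta> by (auto simp: Mod_mor_def)
  have l: "\<theta> X (\<eta> X x) = x" if "X \<in> Obj C" "x \<in> carrier (Fob F X)" for X x
    using bij[OF that(1)] that(2) unfolding \<theta>_def by (simp add: bij_betw_inv_into_left)
  have r: "\<eta> X (\<theta> X y) = y" if "X \<in> Obj C" "y \<in> carrier (Fob F' X)" for X y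
    using bij[OF that(1)] that(2) unfolding \<theta>_def by (simp add: bij_betw_inv_into_right)
  have "Mod_mor C F' F \<theta>"
    unfolding Mod_mor_def
  proof (intro conjI ballI)
    fix X assume X: "X \<in> Obj C"
    interpret group "Fob F X" using F(1) X by (simp add: Mod_obj_def comm_group_def)
    have "\<eta> X \<in> iso (Fob F X) (Fob F' X)"
      using \<eta> X bij[OF X] by (auto simp: iso_def Mod_mor_def)
    then show "\<theta> X \<in> hom (Fob F' X) (Fob F X)"
      unfolding \<theta>_def using iso_set_sym by (auto simp: iso_def)
  next
    fix f y assume f: "f \<in> Arr C" and y: "y \<in> carrier (Fob F' (Cod C f))"
    have O: "Dom C f \<in> Obj C" "Cod C f \<in> Obj C" using f by (auto simp: Arr_def)
    define x where "x = \<theta> (Cod C f) y"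
    have x: "x \<in> carrier (Fob F (Cod C f))"
      unfolding x_def \<theta>_def using bij_betw_inv_into[OF bij[OF O(2)]] y by (auto simp: bij_betw_def)
    have y': "y = \<eta> (Cod C f) x" using r[OF O(2) y] by (simp add: x_def)
    have "Fmap F f \<in> hom (Fob F (Cod C f)) (Fob F (Dom C f))" using F(1) f by (simp add: Mod_obj_def)
    then have fx: "Fmap F f x \<in> carrier (Fob F (Dom C f))" using x by (auto simp: hom_def)
    have "\<theta> (Dom C f) (Fmap F' f y) = \<theta> (Dom C f) (\<eta> (Dom C f) (Fmap F f x))"
      using \<eta> f x by (simp add: Mod_mor_def y')
    also have "\<dots> = Fmap F f x" by (rule l[OF O(1) fx])
    finally show "\<theta> (Dom C f) (Fmap F' f y) = Fmap F f (\<theta> (Cod C f) y)" by (simp add: x_def)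
  qed (use F in auto)
  then show ?thesis unfolding Mod_iso_def using \<eta> l r by blast
qed

lemma Mod_isoD:
  assumes "Mod_iso C F F' \<eta>" "X \<in> Obj C"
  shows "bij_betw (\<eta> X) (carrier (Fob F X)) (carrier (Fob F' X))"
proof -
  obtain \<theta> where \<theta>: "Mod_mor C F F' \<eta>" "Mod_mor C F' F \<theta>"
    "\<forall>X \<in> Obj C. (\<forall>x \<in> carrier (Fob F X). \<theta> X (\<eta> X x) = x) \<and> (\<forall>y \<in> carrier (Fob F' X). \<eta> X (\<theta> X y) = y)"
    using assms(1) unfolding Mod_iso_def by (elim conjE exE)
  have "\<eta> X \<in> hom (Fob F X) (Fob F' X)" "\<theta> X \<in> hom (Fob F' X) (Fob F X)"
    using \<theta>(1,2) assms(2) by (simp_all add: Mod_mor_def)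
  then show ?thesis
    by (intro bij_betwI[of _ _ _ "\<theta> X"]) (use \<theta>(3) assms(2) in \<open>simp_all add: hom_def\<close>)
qed

context exact_category
begin

section \<open>Injective objects\<close>

lemma injectivesD:
  assumes "I \<in> injectives C S"
  shows "I \<in> Obj C" "\<lbrakk>inflation S i; f \<in> Arr C; Dom C f = Dom C i; Cod C f = I\<rbrakk> \<Longrightarrow>
      \<exists>g. in_hom g (Cod C i) I \<and> g \<cdot> i = f"
proof -
  show I: "I \<in> Obj C" using assms by (simp add: injectives_def)
  assume i: "inflation S i" and f: "f \<in> Arr C" "Dom C f = Dom C i" "Cod C f = I"
  have "i \<in> Arr C" using i S_D by (auto simp: inflation_def)
  moreover have "f \<in> carrier (Hom C (Dom C i) I)" using f Arr_carrier[of f] by simp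
  then obtain g where "g \<in> carrier (Hom C (Cod C i) I)" "g \<cdot> i = f"
    using assms i unfolding injectives_def by blast
  ultimately show "\<exists>g. in_hom g (Cod C i) I \<and> g \<cdot> i = f" using I carrier_Hom_iff by auto
qed

lemma injectivesI:
  assumes "I \<in> Obj C"
    "\<And>i f. \<lbrakk>inflation S i; i \<in> Arr C; f \<in> Arr C; Dom C f = Dom C i; Cod C f = I\<rbrakk> \<Longrightarrow>
      \<exists>g. in_hom g (Cod C i) I \<and> g \<cdot> i = f"
  shows "I \<in> injectives C S"
  unfolding injectives_def
proof (intro CollectI conjI allI impI ballI)
  fix i f assume i: "inflation S i" and f: "f \<in> carrier (Hom C (Dom C i) I)"
  have "i \<in> Arr C" using i S_D by (auto simp: inflation_def)
  then show "\<exists>g\<in>carrier (Hom C (Cod C i) I). g \<cdot> i = f"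
    using assms(1) assms(2)[of i f] i f carrier_Hom_iff[of "Dom C i" I f] carrier_Hom_iff[of "Cod C i" I]
    by auto
qed fact

lemma zero_object_injective:
  assumes "Z \<in> Obj C" "Id C Z = zero Z Z"
  shows "Z \<in> injectives C S"
proof (rule injectivesI)
  fix i f assume i: "i \<in> Arr C" "f \<in> Arr C" "Dom C f = Dom C i" "Cod C f = Z"
  have "f = Id C Z \<cdot> f" using i by simp
  also have "\<dots> = zero (Cod C i) Z \<cdot> i" unfolding assms(2) using i assms(1) by simp
  finally show "\<exists>g. in_hom g (Cod C i) Z \<and> g \<cdot> i = f"
    using i assms(1) by (intro exI[of _ "zero (Cod C i) Z"]) simp
qed fact

lemma ex_zero_object: "\<exists>Z \<in> Obj C. Id C Z = zero Z Z"
proof -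
  obtain Z where "is_final C Z" using zero_object by blast
  then have Z: "Z \<in> Obj C" "\<exists>!f. f \<in> carrier (Hom C Z Z)" by (auto simp: is_final_def)
  then show ?thesis using carrier_Hom_iff[of Z Z "Id C Z"] carrier_Hom_iff[of Z Z "zero Z Z"] by auto
qed

lemma biprod_injective:
  assumes "biprod i j p q" "Dom C i \<in> injectives C S" "Dom C j \<in> injectives C S"
  shows "Dom C p \<in> injectives C S"
proof (rule injectivesI)
  note d = biprodD[OF assms(1)]
  fix k f assume k: "inflation S k" "k \<in> Arr C" "f \<in> Arr C" "Dom C f = Dom C k" "Cod C f = Dom C p"
  obtain a where a: "in_hom a (Cod C k) (Dom C i)" "a \<cdot> k = p \<cdot> f"
    using injectivesD(2)[OF assms(2) k(1), of "p \<cdot> f"] k d by auto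
  obtain b where b: "in_hom b (Cod C k) (Dom C j)" "b \<cdot> k = q \<cdot> f"
    using injectivesD(2)[OF assms(3) k(1), of "q \<cdot> f"] k d by auto
  have "(i \<cdot> a \<boxplus> j \<cdot> b) \<cdot> k = (i \<cdot> p \<boxplus> j \<cdot> q) \<cdot> f" using a b k d(1-9) by simp
  also have "\<dots> = f" unfolding d(14) using k by simp
  finally show "\<exists>g. in_hom g (Cod C k) (Dom C p) \<and> g \<cdot> k = f"
    using a b k d(1-9) by (intro exI[of _ "i \<cdot> a \<boxplus> j \<cdot> b"]) simp
qed (use biprodD[OF assms(1)] in auto)

text \<open>Membership in \<open>injective_ideal\<close> with both objects read off from the
  morphism ("stably zero"), so that closure properties need no indices.\<close>

definition stz :: "'m \<Rightarrow> bool" where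
  "stz f \<longleftrightarrow> (\<exists>I \<in> injectives C S. \<exists>g h. in_hom g (Dom C f) I \<and> in_hom h I (Cod C f) \<and> f = h \<cdot> g)"

lemma stzI:
  assumes "I \<in> injectives C S" "in_hom g X I" "in_hom h I Y"
  shows "stz (h \<cdot> g)"
  unfolding stz_def using assms by (intro bexI[of _ I] exI[of _ g] exI[of _ h]) auto

lemma stzE:
  assumes "stz f"
  obtains I g h where "I \<in> injectives C S" "in_hom g (Dom C f) I" "in_hom h I (Cod C f)" "f = h \<cdot> g" "f \<in> Arr C"
proof -
  obtain I g h where s: "I \<in> injectives C S" "in_hom g (Dom C f) I" "in_hom h I (Cod C f)" "f = h \<cdot> g"
    using assms by (auto simp: stz_def)
  then have "h \<cdot> g \<in> Arr C" by simp
  then show thesis using that[OF s] s(4) by simp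
qed

lemma stz_Arr: "stz f \<Longrightarrow> f \<in> Arr C"
  by (erule stzE)

lemma stz_comp_left: 
  assumes "stz f" "g \<in> Arr C" "Cod C f = Dom C g"
  shows "stz (g \<cdot> f)"
proof -
  obtain I a b where s: "I \<in> injectives C S" "in_hom a (Dom C f) I" "in_hom b I (Cod C f)" "f = b \<cdot> a"
    using assms(1) unfolding stz_def by blast
  have "stz ((g \<cdot> b) \<cdot> a)" by (rule stzI[OF s(1,2)]) (use s(1-3) assms in auto)
  also have "(g \<cdot> b) \<cdot> a = g \<cdot> f" unfolding s(4) using s(1-3) assms(2,3) by simp
  finally show ?thesis .
qed

lemma stz_comp_right:
  assumes "stz f" "g \<in> Arr C" "Cod C g = Dom C f"
  shows "stz (f \<cdot> g)"
proof -
  obtain I a b where s: "I \<in> injectives C S" "in_hom a (Dom C f) I" "in_hom b I (Cod C f)" "f = b \<cdot> a"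
    using assms(1) unfolding stz_def by blast
  have "stz (b \<cdot> (a \<cdot> g))" by (rule stzI[OF s(1), of _ "Dom C g" _ "Cod C f"]) (use s(1-3) assms in auto)
  also have "b \<cdot> (a \<cdot> g) = f \<cdot> g" unfolding s(4) using s(1-3) assms(2,3) by simp
  finally show ?thesis .
qed

lemma stz_zero: 
  assumes "X \<in> Obj C" "Y \<in> Obj C"
  shows "stz (zero X Y)"
proof -
  obtain Z where Z: "Z \<in> Obj C" "Id C Z = zero Z Z" using ex_zero_object by auto
  have "stz (zero Z Y \<cdot> zero X Z)"
    by (rule stzI[OF zero_object_injective[OF Z], of _ X _ Y]) (use Z assms in auto)
  then show ?thesis using Z(1) assms by simp
qed

lemma stz_neg:
  assumes "stz f"
  shows "stz (neg f)"
proof -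
  obtain I a b where s: "I \<in> injectives C S" "in_hom a (Dom C f) I" "in_hom b I (Cod C f)" "f = b \<cdot> a"
    using assms(1) unfolding stz_def by blast
  have "stz (neg b \<cdot> a)" by (rule stzI[OF s(1,2)]) (use s(1-3) in auto)
  also have "neg b \<cdot> a = neg f" unfolding s(4) using s(1-3) by simp
  finally show ?thesis .
qed

text \<open>If the summands factor through \<open>I\<close> and \<open>I'\<close>, their sum is a
  column followed by a row through the biproduct of \<open>I\<close> and \<open>I'\<close>, which is
  injective.\<close>

lemma stz_add:
  assumes "stz f" "stz f'" "Dom C f' = Dom C f" "Cod C f' = Cod C f"
  shows "stz (f \<boxplus> f')"
proof -
  obtain I a b where s: "I \<in> injectives C S" "in_hom a (Dom C f) I" "in_hom b I (Cod C f)" "f = b \<cdot> a"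
    using assms(1) unfolding stz_def by blast
  obtain I' a' b' where s': "I' \<in> injectives C S" "in_hom a' (Dom C f) I'" "in_hom b' I' (Cod C f)" "f' = b' \<cdot> a'"
    using assms(2) unfolding stz_def assms(3,4) by blast
  obtain i j p q where B: "biprod i j p q" "Dom C i = I" "Dom C j = I'"
    using biprod_exists[of I I'] injectivesD(1) s(1) s'(1) by blast
  note d = biprodD[OF B(1)]
  have "stz ((b \<cdot> p \<boxplus> b' \<cdot> q) \<cdot> (i \<cdot> a \<boxplus> j \<cdot> a'))"
    by (rule stzI[OF biprod_injective[OF B(1)], of _ "Dom C f" _ "Cod C f"])
      (use s(1-3) s'(1-3) B d(1-9) in auto)
  also have "(b \<cdot> p \<boxplus> b' \<cdot> q) \<cdot> (i \<cdot> a \<boxplus> j \<cdot> a') = f \<boxplus> f'"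
    unfolding s(4) s'(4) using s(2,3) s'(2,3) s(1)[THEN injectivesD(1)] s'(1)[THEN injectivesD(1)] B d(1-9)
      Dom_Obj[OF stz_Arr[OF assms(1)]]
    by (simp add: comp_eq_assoc[OF d(10)] comp_eq_assoc[OF d(11)] comp_eq_assoc[OF d(12)] comp_eq_assoc[OF d(13)])
  finally show ?thesis .
qed

section \<open>Equality modulo injectives\<close>

definition steq :: "'m \<Rightarrow> 'm \<Rightarrow> bool" where
  "steq f g \<longleftrightarrow> f \<in> Arr C \<and> g \<in> Arr C \<and> Dom C f = Dom C g \<and> Cod C f = Cod C g \<and> stz (f \<boxminus> g)"

lemma steqD:
  assumes "steq f g"
  shows "f \<in> Arr C" "g \<in> Arr C" "Dom C f = Dom C g" "Cod C f = Cod C g" "stz (f \<boxminus> g)"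
  using assms by (auto simp: steq_def)

lemma steq_refl: "f \<in> Arr C \<Longrightarrow> steq f f"
  by (simp add: steq_def stz_zero)

lemma steq_sym: 
  assumes "steq f g" shows "steq g f"
proof -
  note s = steqD[OF assms]
  have "neg (f \<boxminus> g) = g \<boxminus> f" using s(1-4) by (simp add: minus_def neg_add add_commute)
  then show ?thesis using stz_neg[OF s(5)] s(1-4) by (simp add: steq_def)
qed

lemma steq_trans [trans]:
  assumes "steq f g" "steq g h" shows "steq f h"
proof -
  note s = steqD[OF assms(1)] and t = steqD[OF assms(2)]
  have "(f \<boxminus> g) \<boxplus> (g \<boxminus> h) = f \<boxminus> h" using s(1-4) t(1-4) by (simp add: minus_def add_assoc)
  then show ?thesis using stz_add[OF s(5) t(5)] s(1-4) t(1-4) by (simp add: steq_def)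
qed

lemma steq_comp_left:
  assumes "steq f g" "h \<in> Arr C" "Dom C h = Cod C g"
  shows "steq (h \<cdot> f) (h \<cdot> g)"
  using steqD[OF assms(1)] assms(2,3) stz_comp_left[of "f \<boxminus> g" h] by (simp add: steq_def)

lemma steq_comp_right:
  assumes "steq f g" "h \<in> Arr C" "Cod C h = Dom C g"
  shows "steq (f \<cdot> h) (g \<cdot> h)"
  using steqD[OF assms(1)] assms(2,3) stz_comp_right[of "f \<boxminus> g" h] by (simp add: steq_def)

lemma steq_zero_iff: "f \<in> Arr C \<Longrightarrow> steq f (zero (Dom C f) (Cod C f)) \<longleftrightarrow> stz f"
  by (simp add: steq_def)

section \<open>The stable category in terms of representatives\<close>

lemma injective_ideal_eq:
  assumes "X \<in> Obj C" "Y \<in> Obj C"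
  shows "injective_ideal C S X Y = {f. in_hom f X Y \<and> stz f}"
proof (intro equalityI subsetI)
  fix f assume "f \<in> injective_ideal C S X Y"
  then obtain h g I where I: "I \<in> injectives C S" "g \<in> carrier (Hom C X I)" "h \<in> carrier (Hom C I Y)" "f = h \<cdot> g"
    by (auto simp: injective_ideal_def)
  have "in_hom g X I" "in_hom h I Y"
    using I(2,3) carrier_Hom_iff[of X I] carrier_Hom_iff[of I Y] injectivesD(1)[OF I(1)] assms by auto
  then show "f \<in> {f. in_hom f X Y \<and> stz f}" using stzI[OF I(1)] I(4) by auto
next
  fix f assume f: "f \<in> {f. in_hom f X Y \<and> stz f}"
  then have "stz f" by simp
  then obtain I g h where I: "I \<in> injectives C S" "in_hom g (Dom C f) I" "in_hom h I (Cod C f)" "f = h \<cdot> g"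
    unfolding stz_def by blast
  have "g \<in> carrier (Hom C X I)" "h \<in> carrier (Hom C I Y)"
    using f I(2,3) carrier_Hom_iff[OF assms(1) injectivesD(1)[OF I(1)]]
      carrier_Hom_iff[OF injectivesD(1)[OF I(1)] assms(2)] by auto
  then show "f \<in> injective_ideal C S X Y" unfolding injective_ideal_def using I(1,4) by blast
qed

lemma stz_subgroup:
  assumes "X \<in> Obj C" "Y \<in> Obj C"
  shows "subgroup (injective_ideal C S X Y) (Hom C X Y)"
proof -
  interpret comm_group "Hom C X Y" by (rule hom_group[OF assms])
  note c = carrier_Hom_iff[OF assms]
  show ?thesis
    unfolding injective_ideal_eq[OF assms]
  proof (rule subgroupI)
    show "{f. in_hom f X Y \<and> stz f} \<noteq> {}" using stz_zero[OF assms] zero_in_hom[OF assms] by auto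
    fix a assume "a \<in> {f. in_hom f X Y \<and> stz f}"
    then show "inv\<^bsub>Hom C X Y\<^esub> a \<in> {f. in_hom f X Y \<and> stz f}"
      using stz_neg[of a] neg_in_hom[of a] by (auto simp: neg_def)
    fix b assume "b \<in> {f. in_hom f X Y \<and> stz f}"
    with \<open>a \<in> _\<close> show "a \<otimes>\<^bsub>Hom C X Y\<^esub> b \<in> {f. in_hom f X Y \<and> stz f}"
      using stz_add[of a b] add_in_hom[of a b] by (auto simp: add_def)
  qed (use c in auto)
qed

text \<open>Adding a stably zero \<open>z\<close> to \<open>f\<close> and taking the difference with
  \<open>f\<close> are inverse to each other, so cosets can be handled through \<open>steq\<close>
  on representatives.\<close>

lemma stable_coset_eq:
  assumes "X \<in> Obj C" "Y \<in> Obj C" "in_hom f X Y"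
  shows "injective_ideal C S X Y #>\<^bsub>Hom C X Y\<^esub> f = {f'. steq f' f}"
proof -
  have "injective_ideal C S X Y #>\<^bsub>Hom C X Y\<^esub> f = {z \<boxplus> f |z. in_hom z X Y \<and> stz z}"
    unfolding injective_ideal_eq[OF assms(1,2)] r_coset_def by (auto simp: add_def)
  also have "\<dots> = {f'. steq f' f}"
  proof (intro equalityI subsetI)
    fix f' assume "f' \<in> {z \<boxplus> f |z. in_hom z X Y \<and> stz z}"
    then obtain z where z: "in_hom z X Y" "stz z" "f' = z \<boxplus> f" by auto
    then have "f' \<boxminus> f = z" using assms by (simp add: minus_def add_assoc)
    then show "f' \<in> {f'. steq f' f}" using z assms by (simp add: steq_def)
  next
    fix f' assume "f' \<in> {f'. steq f' f}"
    then have f: "steq f' f" by simp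
    note s = steqD[OF f]
    have "f' = (f' \<boxminus> f) \<boxplus> f" using s(1-4) by simp
    then show "f' \<in> {z \<boxplus> f |z. in_hom z X Y \<and> stz z}"
      using s assms(3) by (intro CollectI exI[of _ "f' \<boxminus> f"]) auto
  qed
  finally show ?thesis .
qed

lemma stable_class_eq:
  assumes "f \<in> Arr C"
  shows "stable_class C S f = {f'. steq f' f}"
  unfolding stable_class_def by (rule stable_coset_eq) (use assms in auto)

lemma stable_class_eq_iff:
  assumes "f \<in> Arr C" "g \<in> Arr C"
  shows "stable_class C S f = stable_class C S g \<longleftrightarrow> steq f g"
  unfolding stable_class_eq[OF assms(1)] stable_class_eq[OF assms(2)]
  using steq_refl[OF assms(1)] steq_sym steq_trans by blast

lemma Hom_stable:
  "Hom (stable_cat C S) X Y = Hom C X Y Mod injective_ideal C S X Y"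
  by (simp add: stable_cat_def quotient_cat_def)

lemma carrier_Hom_stable:
  assumes "X \<in> Obj C" "Y \<in> Obj C"
  shows "carrier (Hom (stable_cat C S) X Y) = stable_class C S ` {f. in_hom f X Y}"
  unfolding Hom_stable carrier_FactGroup
  using carrier_Hom_iff[OF assms] by (auto simp: stable_class_def image_iff)

lemma comm_group_Hom_stable:
  assumes "X \<in> Obj C" "Y \<in> Obj C"
  shows "comm_group (Hom (stable_cat C S) X Y)"
  unfolding Hom_stable by (rule comm_group.abelian_FactGroup[OF hom_group stz_subgroup]) fact+

lemma stable_class_mult:
  assumes "f \<in> Arr C" "g \<in> Arr C" "Dom C f = X" "Cod C f = Y" "Dom C g = X" "Cod C g = Y"
  shows "stable_class C S f \<otimes>\<^bsub>Hom (stable_cat C S) X Y\<^esub> stable_class C S g = stable_class C S (f \<boxplus> g)"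
proof -
  have O: "X \<in> Obj C" "Y \<in> Obj C" using assms by auto
  interpret comm_group "Hom C X Y" by (rule hom_group[OF O])
  interpret normal "injective_ideal C S X Y" "Hom C X Y"
    by (rule subgroup_imp_normal[OF stz_subgroup[OF O]])
  have c: "f \<in> carrier (Hom C X Y)" "g \<in> carrier (Hom C X Y)"
    using assms Arr_carrier[of f] Arr_carrier[of g] by auto
  show ?thesis
    using rcos_sum[OF c] add_in_hom[of f g] assms by (simp add: Hom_stable stable_class_def add_def)
qed

text \<open>The quotient takes \<open>Dom\<close> and \<open>Cod\<close> from a chosen
  representative of a coset; all representatives are parallel, so the choice does not
  matter.\<close>

lemma stable_class_Dom_Cod:
  assumes "f \<in> Arr C"
  shows "Dom (stable_cat C S) (stable_class C S f) = Dom C f" "Cod (stable_cat C S) (stable_class C S f) = Cod C f"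
proof -
  have "(SOME f'. f' \<in> stable_class C S f) \<in> stable_class C S f"
    by (rule someI[of _ f]) (simp add: stable_class_eq assms steq_refl)
  then have "steq (SOME f'. f' \<in> stable_class C S f) f" by (simp add: stable_class_eq assms)
  from steqD[OF this] show "Dom (stable_cat C S) (stable_class C S f) = Dom C f"
    "Cod (stable_cat C S) (stable_class C S f) = Cod C f"
    by (simp_all add: stable_cat_def quotient_cat_def)
qed

text \<open>Composition in \<open>quotient_cat\<close> is a union over all pairs of representatives.
  Stably zero maps form a two-sided ideal, so every pair contributes the same coset, and there is at
  least one pair.\<close>

lemma stable_class_comp:
  assumes "f \<in> Arr C" "g \<in> Arr C" "Cod C f = Dom C g"
  shows "stable_class C S g \<cdot>\<^bsub>stable_cat C S\<^esub> stable_class C S f = stable_class C S (g \<cdot> f)"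
proof -
  have *: "injective_ideal C S (Dom C f') (Cod C g') #>\<^bsub>Hom C (Dom C f') (Cod C g')\<^esub> (g' \<cdot> f') =
      stable_class C S (g \<cdot> f)" if "steq g' g" "steq f' f" for f' g'
  proof -
    note s = steqD[OF that(1)] and t = steqD[OF that(2)]
    have "injective_ideal C S (Dom C f') (Cod C g') #>\<^bsub>Hom C (Dom C f') (Cod C g')\<^esub> (g' \<cdot> f') =
      stable_class C S (g' \<cdot> f')"
      using s(1-4) t(1-4) assms by (simp add: stable_class_def)
    also have "\<dots> = stable_class C S (g \<cdot> f)"
    proof -
      have "steq (g' \<cdot> f') (g \<cdot> f')" by (rule steq_comp_right[OF that(1)]) (use s t assms in auto)
      also have "steq (g \<cdot> f') (g \<cdot> f)" by (rule steq_comp_left[OF that(2)]) (use assms in auto)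
      finally show ?thesis
        using steqD(1,2)[of "g' \<cdot> f'" "g \<cdot> f"] by (simp add: stable_class_eq_iff)
    qed
    finally show ?thesis .
  qed
  have "stable_class C S g \<cdot>\<^bsub>stable_cat C S\<^esub> stable_class C S f =
      (\<Union>g'\<in>{g'. steq g' g}. \<Union>f'\<in>{f'. steq f' f}.
        injective_ideal C S (Dom C f') (Cod C g') #>\<^bsub>Hom C (Dom C f') (Cod C g')\<^esub> (g' \<cdot> f'))"
    using assms by (simp add: stable_cat_def quotient_cat_def stable_class_eq)
  also have "\<dots> = (\<Union>g'\<in>{g'. steq g' g}. \<Union>f'\<in>{f'. steq f' f}. stable_class C S (g \<cdot> f))"
    using * by simp
  also have "\<dots> = stable_class C S (g \<cdot> f)"
    using steq_refl[OF assms(1)] steq_refl[OF assms(2)] by auto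
  finally show ?thesis .
qed

lemma stable_Id: "Id (stable_cat C S) X = stable_class C S (Id C X)" if "X \<in> Obj C"
  using that by (simp add: stable_cat_def quotient_cat_def stable_class_def)

lemma Arr_full_stable:
  assumes "M \<subseteq> Obj C"
  shows "Arr (full_subcat (stable_cat C S) M) = stable_class C S ` {f \<in> Arr C. Dom C f \<in> M \<and> Cod C f \<in> M}"
proof (intro equalityI subsetI)
  fix F assume "F \<in> Arr (full_subcat (stable_cat C S) M)"
  then obtain X Y where "X \<in> M" "Y \<in> M" "F \<in> carrier (Hom (stable_cat C S) X Y)"
    by (auto simp: Arr_def full_subcat_def)
  moreover from this have "X \<in> Obj C" "Y \<in> Obj C" using assms by auto
  ultimately show "F \<in> stable_class C S ` {f \<in> Arr C. Dom C f \<in> M \<and> Cod C f \<in> M}"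
    using carrier_Hom_stable[of X Y] by auto
next
  fix F assume "F \<in> stable_class C S ` {f \<in> Arr C. Dom C f \<in> M \<and> Cod C f \<in> M}"
  then obtain f where f: "f \<in> Arr C" "Dom C f \<in> M" "Cod C f \<in> M" "F = stable_class C S f" by auto
  have "F \<in> carrier (Hom (stable_cat C S) (Dom C f) (Cod C f))"
    unfolding f(4) using f(1) by (subst carrier_Hom_stable) auto
  then show "F \<in> Arr (full_subcat (stable_cat C S) M)"
    unfolding Arr_def full_subcat_def f(4) using f(2,3) by (simp add: stable_class_Dom_Cod[OF f(1)])
qed

lemma full_stable_simps:
  "Obj (full_subcat (stable_cat C S) M) = M"
  "Hom (full_subcat (stable_cat C S) M) = Hom (stable_cat C S)"
  "Dom (full_subcat (stable_cat C S) M) = Dom (stable_cat C S)"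
  "Cod (full_subcat (stable_cat C S) M) = Cod (stable_cat C S)"
  "Id (full_subcat (stable_cat C S) M) = Id (stable_cat C S)"
  "Comp (full_subcat (stable_cat C S) M) = Comp (stable_cat C S)"
  by (simp_all add: full_subcat_def)

section \<open>The functor G and its isomorphisms\<close>

lemma Mod_obj_G:
  assumes M: "M \<subseteq> Obj C" and X: "X \<in> Obj C"
  shows "Mod_obj (full_subcat (stable_cat C S) M) (G_obj C S X)"
proof -
  have c: "carrier (Hom (stable_cat C S) Y X) = stable_class C S ` {f. in_hom f Y X}" if "Y \<in> Obj C" for Y
    using carrier_Hom_stable[OF that X] .
  have c': "carrier (Hom (stable_cat C S) Y Z) = stable_class C S ` {f. in_hom f Y Z}" if "Y \<in> M" "Z \<in> M" for Y Z
    using carrier_Hom_stable[of Y Z] that M by blast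
  show ?thesis
    unfolding Mod_obj_def full_stable_simps Arr_full_stable[OF M]
  proof (intro conjI ballI impI)
    fix Y assume "Y \<in> M"
    then have Y: "Y \<in> Obj C" using M by auto
    show "comm_group (Fob (G_obj C S X) Y)"
      using comm_group_Hom_stable[OF Y X] by (simp add: G_obj_def)
    fix x assume "x \<in> carrier (Fob (G_obj C S X) Y)"
    then obtain a where "in_hom a Y X" "x = stable_class C S a" using c[OF Y] by (auto simp: G_obj_def)
    then show "Fmap (G_obj C S X) (Id (stable_cat C S) Y) x = x"
      using Y by (simp add: G_obj_def stable_Id stable_class_comp)
  next
    fix F assume "F \<in> stable_class C S ` {f \<in> Arr C. Dom C f \<in> M \<and> Cod C f \<in> M}"
    then obtain f where f: "f \<in> Arr C" "Dom C f \<in> M" "Cod C f \<in> M" "F = stable_class C S f" by auto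
    show "Fmap (G_obj C S X) F \<in> hom (Fob (G_obj C S X) (Cod (stable_cat C S) F)) (Fob (G_obj C S X) (Dom (stable_cat C S) F))"
      using f(1) unfolding f(4)
      by (auto simp: hom_def G_obj_def stable_class_Dom_Cod c stable_class_comp stable_class_mult)
    fix G assume "G \<in> stable_class C S ` {f \<in> Arr C. Dom C f \<in> M \<and> Cod C f \<in> M}"
      and FG: "Cod (stable_cat C S) F = Dom (stable_cat C S) G"
    then obtain g where g: "g \<in> Arr C" "Dom C g \<in> M" "Cod C g \<in> M" "G = stable_class C S g" by auto
    fix x assume "x \<in> carrier (Fob (G_obj C S X) (Cod (stable_cat C S) G))"
    then obtain a where a: "in_hom a (Cod C g) X" "x = stable_class C S a"
      using g by (auto simp: G_obj_def stable_class_Dom_Cod c)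
    have "Cod C f = Dom C g" using FG f(1) g(1) unfolding f(4) g(4) by (simp add: stable_class_Dom_Cod)
    then show "Fmap (G_obj C S X) (G \<cdot>\<^bsub>stable_cat C S\<^esub> F) x = Fmap (G_obj C S X) F (Fmap (G_obj C S X) G x)"
      using f(1) g(1) a unfolding f(4) g(4) a(2) by (simp add: G_obj_def stable_class_comp)
  next
    fix Y Z F G x
    assume Y: "Y \<in> M" and Z: "Z \<in> M"
      and F: "F \<in> carrier (Hom (stable_cat C S) Y Z)" "G \<in> carrier (Hom (stable_cat C S) Y Z)"
      and x: "x \<in> carrier (Fob (G_obj C S X) Z)"
    obtain f g where f: "in_hom f Y Z" "F = stable_class C S f" "in_hom g Y Z" "G = stable_class C S g"
      using F c'[OF Y Z] by auto
    obtain a where a: "in_hom a Z X" "x = stable_class C S a"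
      using x Z M c[of Z] by (auto simp: G_obj_def)
    have "Y \<in> Obj C" "Z \<in> Obj C" using Y Z M by auto
    then show "Fmap (G_obj C S X) (F \<otimes>\<^bsub>Hom (stable_cat C S) Y Z\<^esub> G) x =
        Fmap (G_obj C S X) F x \<otimes>\<^bsub>Fob (G_obj C S X) Y\<^esub> Fmap (G_obj C S X) G x"
      using f(1,3) a(1) unfolding f(2,4) a(2) by (simp add: G_obj_def stable_class_comp stable_class_mult)
  qed
qed

lemma Mod_mor_G:
  assumes M: "M \<subseteq> Obj C" and f: "f \<in> Arr C"
  shows "Mod_mor (full_subcat (stable_cat C S) M) (G_obj C S (Dom C f)) (G_obj C S (Cod C f)) (G_mor C S f)"
proof -
  have c: "carrier (Hom (stable_cat C S) Y (Dom C f)) = stable_class C S ` {a. in_hom a Y (Dom C f)}"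
    "carrier (Hom (stable_cat C S) Y (Cod C f)) = stable_class C S ` {a. in_hom a Y (Cod C f)}"
    if "Y \<in> Obj C" for Y
    using carrier_Hom_stable[OF that] f by auto
  show ?thesis
    unfolding Mod_mor_def full_stable_simps Arr_full_stable[OF M]
  proof (intro conjI ballI impI Mod_obj_G[OF M])
    fix Y assume "Y \<in> M"
    then have Y: "Y \<in> Obj C" using M by auto
    show "G_mor C S f Y \<in> hom (Fob (G_obj C S (Dom C f)) Y) (Fob (G_obj C S (Cod C f)) Y)"
      using Y f by (auto simp: hom_def G_obj_def G_mor_def c stable_class_comp stable_class_mult)
  next
    fix F x
    assume "F \<in> stable_class C S ` {f \<in> Arr C. Dom C f \<in> M \<and> Cod C f \<in> M}"
      and x: "x \<in> carrier (Fob (G_obj C S (Dom C f)) (Cod (stable_cat C S) F))"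
    then obtain g where g: "g \<in> Arr C" "Dom C g \<in> M" "Cod C g \<in> M" "F = stable_class C S g" by auto
    then obtain a where a: "in_hom a (Cod C g) (Dom C f)" "x = stable_class C S a"
      using x by (auto simp: G_obj_def stable_class_Dom_Cod c)
    show "G_mor C S f (Dom (stable_cat C S) F) (Fmap (G_obj C S (Dom C f)) F x) =
      Fmap (G_obj C S (Cod C f)) F (G_mor C S f (Cod (stable_cat C S) F) x)"
      using f g(1) a(1) unfolding g(4) a(2) by (simp add: G_obj_def G_mor_def stable_class_comp)
  qed (use f in auto)
qed

text \<open>Eliminates presheaves and cosets: naturality is automatic, so only bijectivity on each
  component remains, and it is expressed on representatives as stable injectivity and stable
  surjectivity.\<close>

lemma G_weak_equivalences_iff:
  assumes M: "M \<subseteq> Obj C"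
  shows "f \<in> G_weak_equivalences C S M \<longleftrightarrow> f \<in> Arr C \<and> (\<forall>N \<in> M.
    (\<forall>x x'. in_hom x N (Dom C f) \<longrightarrow> in_hom x' N (Dom C f) \<longrightarrow> steq (f \<cdot> x) (f \<cdot> x') \<longrightarrow> steq x x') \<and>
    (\<forall>y. in_hom y N (Cod C f) \<longrightarrow> (\<exists>x. in_hom x N (Dom C f) \<and> steq (f \<cdot> x) y)))"
    (is "_ \<longleftrightarrow> _ \<and> ?R")
proof -
  let ?G = "\<lambda>X. G_obj C S X" and ?\<eta> = "G_mor C S f"
  have bij: "(\<forall>N\<in>M. bij_betw (?\<eta> N) (carrier (Fob (?G (Dom C f)) N)) (carrier (Fob (?G (Cod C f)) N))) \<longleftrightarrow> ?R"
    if f: "f \<in> Arr C"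
  proof (rule ball_cong[OF refl])
    fix N assume "N \<in> M"
    then have N: "N \<in> Obj C" using M by auto
    have \<eta>: "?\<eta> N (stable_class C S x) = stable_class C S (f \<cdot> x)" if "in_hom x N (Dom C f)" for x
      using f that by (simp add: G_mor_def stable_class_comp)
    have c: "carrier (Fob (?G (Dom C f)) N) = stable_class C S ` {a. in_hom a N (Dom C f)}"
      "carrier (Fob (?G (Cod C f)) N) = stable_class C S ` {a. in_hom a N (Cod C f)}"
      using N f carrier_Hom_stable by (auto simp: G_obj_def)
    have "inj_on (?\<eta> N) (carrier (Fob (?G (Dom C f)) N)) \<longleftrightarrow>
      (\<forall>x x'. in_hom x N (Dom C f) \<longrightarrow> in_hom x' N (Dom C f) \<longrightarrow> steq (f \<cdot> x) (f \<cdot> x') \<longrightarrow> steq x x')"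
      unfolding c inj_on_def using f by (auto simp: \<eta> stable_class_eq_iff)
    moreover have img: "?\<eta> N ` carrier (Fob (?G (Dom C f)) N) = (\<lambda>x. stable_class C S (f \<cdot> x)) ` {a. in_hom a N (Dom C f)}"
      unfolding c image_image using \<eta> by (intro image_cong) auto
    moreover have "?\<eta> N ` carrier (Fob (?G (Dom C f)) N) \<subseteq> carrier (Fob (?G (Cod C f)) N)"
      unfolding img unfolding c using f by auto
    moreover have "carrier (Fob (?G (Cod C f)) N) \<subseteq> ?\<eta> N ` carrier (Fob (?G (Dom C f)) N) \<longleftrightarrow>
      (\<forall>y. in_hom y N (Cod C f) \<longrightarrow> (\<exists>x. in_hom x N (Dom C f) \<and> steq (f \<cdot> x) y))"
    proof -
      have "stable_class C S y = stable_class C S (f \<cdot> x) \<longleftrightarrow> steq (f \<cdot> x) y"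
        if "in_hom x N (Dom C f)" "in_hom y N (Cod C f)" for x y
        using that f stable_class_eq_iff[of "f \<cdot> x" y] by auto
      then show ?thesis unfolding img unfolding c by (auto simp: image_subset_iff image_iff)
    qed
    ultimately show "bij_betw (?\<eta> N) (carrier (Fob (?G (Dom C f)) N)) (carrier (Fob (?G (Cod C f)) N)) \<longleftrightarrow>
    (\<forall>x x'. in_hom x N (Dom C f) \<longrightarrow> in_hom x' N (Dom C f) \<longrightarrow> steq (f \<cdot> x) (f \<cdot> x') \<longrightarrow> steq x x') \<and>
    (\<forall>y. in_hom y N (Cod C f) \<longrightarrow> (\<exists>x. in_hom x N (Dom C f) \<and> steq (f \<cdot> x) y))"
      unfolding bij_betw_def by blast
  qed
  have "Mod_iso (full_subcat (stable_cat C S) M) (?G (Dom C f)) (?G (Cod C f)) ?\<eta> \<longleftrightarrow>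
     (\<forall>N\<in>M. bij_betw (?\<eta> N) (carrier (Fob (?G (Dom C f)) N)) (carrier (Fob (?G (Cod C f)) N)))"
    if f: "f \<in> Arr C"
  proof
    assume "Mod_iso (full_subcat (stable_cat C S) M) (?G (Dom C f)) (?G (Cod C f)) ?\<eta>"
    from Mod_isoD[OF this]
    show "\<forall>N\<in>M. bij_betw (?\<eta> N) (carrier (Fob (?G (Dom C f)) N)) (carrier (Fob (?G (Cod C f)) N))"
      by (simp add: full_stable_simps)
  next
    assume "\<forall>N\<in>M. bij_betw (?\<eta> N) (carrier (Fob (?G (Dom C f)) N)) (carrier (Fob (?G (Cod C f)) N))"
    then show "Mod_iso (full_subcat (stable_cat C S) M) (?G (Dom C f)) (?G (Cod C f)) ?\<eta>"
      by (intro Mod_isoI Mod_mor_G[OF M f]) (simp add: full_stable_simps)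
  qed
  then show ?thesis unfolding G_weak_equivalences_def mem_Collect_eq using bij by blast
qed

end

section \<open>Fibrations and weak equivalences\<close>

locale rigid_setting = exact_category +
  fixes M
  assumes wic: "weakly_idempotent_complete C"
    and enough_inj: "enough_injectives C S"
    and M_subset: "M \<subseteq> Obj C"
    and rigid_M: "rigid C S M"
    and M_finite: "contravariantly_finite C M"
    and injectives_M: "injectives C S \<subseteq> M"
    and M_sums: "closed_under_sums C M"
    and M_summands: "closed_under_summands C M"
    and mho_finite: "contravariantly_finite C (mho C S M)"
begin

section \<open>Membership in M, pr M and \<mho>M\<close>

lemma M_Obj: "N \<in> M \<Longrightarrow> N \<in> Obj C"
  using M_subset by auto

lemma mhoE:
  assumes "U \<in> mho C S M"
  obtains i p where "(i, p) \<in> S" "Dom C i \<in> M" "Dom C p \<in> injectives C S" "Cod C p = U"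
proof -
  obtain i p where i: "(i, p) \<in> S" "Dom C i \<in> M" "Cod C i \<in> injectives C S" "Cod C p = U"
    using assms by (auto simp: mho_def)
  then show thesis using that[of i p] S_D(5)[OF i(1)] by simp
qed

lemma mho_Obj: "U \<in> mho C S M \<Longrightarrow> U \<in> Obj C"
  using mhoE S_D(4) Cod_Obj by metis

lemma mhoI:
  assumes "(i, p) \<in> S" "Dom C i \<in> M" "Cod C i \<in> injectives C S"
  shows "Cod C p \<in> mho C S M"
  using assms by (auto simp: mho_def)

lemma prE:
  assumes "X \<in> pr C S M"
  obtains i p where "(i, p) \<in> S" "Dom C i \<in> M" "Dom C p \<in> M" "Cod C p = X"
proof -
  obtain i p where i: "(i, p) \<in> S" "Dom C i \<in> M" "Cod C i \<in> M" "Cod C p = X"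
    using assms by (auto simp: pr_def)
  then show thesis using that[of i p] S_D(5)[OF i(1)] by simp
qed

lemma prI:
  assumes "(i, p) \<in> S" "Dom C i \<in> M" "Dom C p \<in> M"
  shows "Cod C p \<in> pr C S M"
  using assms S_D(5)[OF assms(1)] by (auto simp: pr_def)

text \<open>The sequence \<open>0 \<rightarrow> I \<rightarrow> I\<close> presents \<open>I\<close>
  as an object of \<mho>M, its left end being injective and hence in \<open>M\<close>. That end is a
  kernel of the identity: \<open>k\<close> is zero and monic, which forces its domain to be a zero
  object.\<close>

lemma injectives_mho: "injectives C S \<subseteq> mho C S M"
proof
  fix I assume I: "I \<in> injectives C S"
  have O: "I \<in> Obj C" by (rule injectivesD(1)[OF I])
  obtain k where k: "(k, Id C I) \<in> S" using id_deflation[OF O] by (auto simp: deflation_def)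
  note K = S_D(3-6)[OF k]
  have *: "k \<cdot> Id C (Dom C k) = k \<cdot> zero (Dom C k) (Dom C k)"
  proof -
    have I: "Cod C k = I" using K(3) O by simp
    have "k \<cdot> Id C (Dom C k) = Id C I \<cdot> k" using K(1) I by simp
    also have "\<dots> = zero (Dom C k) I" using K(4) O by simp
    also have "\<dots> = k \<cdot> zero (Dom C k) (Dom C k)" using K(1) I by simp
    finally show ?thesis .
  qed
  have "Id C (Dom C k) = zero (Dom C k) (Dom C k)"
    by (rule is_kernelD(6)[OF S_D(1)[OF k] _ _ _ _ _ *]) (use K(1) in auto)
  then have "Dom C k \<in> M" using zero_object_injective[of "Dom C k"] K(1) injectives_M by auto
  then show "I \<in> mho C S M" using mhoI[OF k] K(1-3) I O by simp
qed

lemma right_approximation: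
  assumes "contravariantly_finite C A" "A \<subseteq> Obj C" "X \<in> Obj C"
  shows "\<exists>a \<in> Arr C. Dom C a \<in> A \<and> Cod C a = X \<and>
    (\<forall>f \<in> Arr C. Dom C f \<in> A \<longrightarrow> Cod C f = X \<longrightarrow> (\<exists>g. in_hom g (Dom C f) (Dom C a) \<and> a \<cdot> g = f))"
proof -
  obtain U a where U: "U \<in> A" "a \<in> carrier (Hom C U X)"
    and l: "\<forall>V \<in> A. \<forall>f \<in> carrier (Hom C V X). \<exists>g \<in> carrier (Hom C V U). a \<cdot> g = f"
    using assms(1,3) unfolding contravariantly_finite_def by blast
  have a: "in_hom a U X" using U assms carrier_Hom_iff[of U X] by auto
  have "\<exists>g. in_hom g (Dom C f) U \<and> a \<cdot> g = f" if f: "f \<in> Arr C" "Dom C f \<in> A" "Cod C f = X" for f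
  proof -
    obtain g where "g \<in> carrier (Hom C (Dom C f) U)" "a \<cdot> g = f"
      using l f Arr_carrier[OF f(1)] by blast
    then show ?thesis using carrier_Hom_iff[of "Dom C f" U g] f U(1) assms(2) by auto
  qed
  then show ?thesis using a U(1) by (intro bexI[of _ a]) auto
qed

lemma injective_hull:
  assumes "X \<in> Obj C"
  obtains j q where "(j, q) \<in> S" "Dom C j = X" "Cod C j \<in> injectives C S"
  using enough_inj assms unfolding enough_injectives_def inflation_def by blast

lemma M_biprod: "\<lbrakk>biprod i j p q; Dom C i \<in> M; Dom C j \<in> M\<rbrakk> \<Longrightarrow> Dom C p \<in> M"
  using M_sums unfolding closed_under_sums_def is_biproduct_iff by blast

text \<open>Weak idempotent completeness enters here: it supplies the kernel of \<open>r\<close>,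
  and that kernel is a complement of \<open>s\<close>.\<close>

lemma retraction_biprod:
  assumes "r \<in> Arr C" "in_hom s (Cod C r) (Dom C r)" "r \<cdot> s = Id C (Cod C r)"
  obtains k t where "biprod s k r t"
proof -
  have "s \<in> carrier (Hom C (Cod C r) (Dom C r))" using assms carrier_Hom_iff by auto
  then have "is_retraction C r" using assms by (auto simp: is_retraction_def)
  then obtain k where "is_kernel C k r" using wic by (auto simp: weakly_idempotent_complete_def)
  then show thesis using retraction_kernel_biprod[of k r s] assms that by blast
qed

lemma M_retract:
  assumes "in_hom r X Y" "in_hom s Y X" "r \<cdot> s = Id C Y" "X \<in> M"
  shows "Y \<in> M"
proof -
  obtain k t where B: "biprod s k r t" using retraction_biprod[of r s] assms(1-3) by auto
  have "is_biproduct C X Y (Dom C k)"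
    unfolding is_biproduct_iff using B assms(1,2) by blast
  then show ?thesis using M_summands assms(4) unfolding closed_under_summands_def by blast
qed

text \<open>The deflation from an injective onto \<open>U\<close> has its kernel in
  \<open>M\<close>, so rigidity lifts \<open>f\<close> along it and \<open>f\<close> factors through
  that injective. In other words, \<open>G U = 0\<close>.\<close>

lemma mho_stz:
  assumes "U \<in> mho C S M" "f \<in> Arr C" "Dom C f \<in> M" "Cod C f = U"
  shows "stz f"
proof -
  obtain i p where i: "(i, p) \<in> S" "Dom C i \<in> M" "Dom C p \<in> injectives C S" "Cod C p = U"
    using mhoE[OF assms(1)] by metis
  obtain g where "in_hom g (Dom C f) (Dom C p)" "p \<cdot> g = f"
    using rigid_lift[OF rigid_M i(1,2) assms(3,2)] i assms by auto
  then show ?thesis using stzI[OF i(3), of g "Dom C f" p U] S_D(4)[OF i(1)] i(4) by simp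
qed

section \<open>Fibrations and weak equivalences tested on morphisms\<close>

definition Fib where
  "Fib = {f \<in> Arr C. \<forall>U \<in> mho C S M. \<forall>v. in_hom v U (Cod C f) \<longrightarrow> (\<exists>l. in_hom l U (Dom C f) \<and> f \<cdot> l = v)}"

abbreviation W where "W \<equiv> G_weak_equivalences C S M"

lemma FibI:
  assumes "f \<in> Arr C" "\<And>v. \<lbrakk>v \<in> Arr C; Dom C v \<in> mho C S M; Cod C v = Cod C f\<rbrakk> \<Longrightarrow>
    \<exists>l. in_hom l (Dom C v) (Dom C f) \<and> f \<cdot> l = v"
  shows "f \<in> Fib"
  using assms by (auto simp: Fib_def)

lemma FibD:
  assumes "f \<in> Fib"
  shows "f \<in> Arr C" "\<lbrakk>v \<in> Arr C; Dom C v \<in> mho C S M; Cod C v = Cod C f\<rbrakk> \<Longrightarrow>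
    \<exists>l. in_hom l (Dom C v) (Dom C f) \<and> f \<cdot> l = v"
  using assms by (auto simp: Fib_def)

lemma WI:
  assumes "f \<in> Arr C"
    "\<And>N x x'. \<lbrakk>N \<in> M; in_hom x N (Dom C f); in_hom x' N (Dom C f); steq (f \<cdot> x) (f \<cdot> x')\<rbrakk> \<Longrightarrow> steq x x'"
    "\<And>N y. \<lbrakk>N \<in> M; in_hom y N (Cod C f)\<rbrakk> \<Longrightarrow> \<exists>x. in_hom x N (Dom C f) \<and> steq (f \<cdot> x) y"
  shows "f \<in> W"
  unfolding G_weak_equivalences_iff[OF M_subset] using assms by blast

lemma WD:
  assumes "f \<in> W"
  shows "f \<in> Arr C"
    "\<lbrakk>N \<in> M; in_hom x N (Dom C f); in_hom x' N (Dom C f); steq (f \<cdot> x) (f \<cdot> x')\<rbrakk> \<Longrightarrow> steq x x'"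
    "\<lbrakk>N \<in> M; in_hom y N (Cod C f)\<rbrakk> \<Longrightarrow> \<exists>x. in_hom x N (Dom C f) \<and> steq (f \<cdot> x) y"
  using assms unfolding G_weak_equivalences_iff[OF M_subset] by blast+

section \<open>Two-out-of-three, isomorphisms, composites and retracts\<close>

lemma W_comp:
  assumes "f \<in> W" "g \<in> W" "Cod C f = Dom C g"
  shows "g \<cdot> f \<in> W"
proof (rule WI)
  note F = WD[OF assms(1)] and G = WD[OF assms(2)]
  fix N x x' assume N: "N \<in> M" and x: "in_hom x N (Dom C (g \<cdot> f))" "in_hom x' N (Dom C (g \<cdot> f))"
    and e: "steq ((g \<cdot> f) \<cdot> x) ((g \<cdot> f) \<cdot> x')"
  have x': "in_hom x N (Dom C f)" "in_hom x' N (Dom C f)" using x F(1) G(1) assms(3) by simp_all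
  then have "steq (f \<cdot> x) (f \<cdot> x')" using G(2)[OF N, of "f \<cdot> x" "f \<cdot> x'"] e F(1) G(1) assms(3) by simp
  then show "steq x x'" by (rule F(2)[OF N x'])
next
  note F = WD[OF assms(1)] and G = WD[OF assms(2)]
  fix N z assume N: "N \<in> M" and z: "in_hom z N (Cod C (g \<cdot> f))"
  obtain y where y: "in_hom y N (Dom C g)" "steq (g \<cdot> y) z" using G(3)[OF N, of z] z F(1) G(1) assms(3) by auto
  obtain x where x: "in_hom x N (Dom C f)" "steq (f \<cdot> x) y" using F(3)[OF N, of y] y assms(3) by auto
  have "steq (g \<cdot> (f \<cdot> x)) (g \<cdot> y)" by (rule steq_comp_left[OF x(2)]) (use y G in auto)
  also note y(2)
  finally show "\<exists>x. in_hom x N (Dom C (g \<cdot> f)) \<and> steq ((g \<cdot> f) \<cdot> x) z"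
    using x(1) F(1) G(1) assms(3) by (intro exI[of _ x]) simp
qed (use WD(1)[OF assms(1)] WD(1)[OF assms(2)] assms(3) in simp)

lemma W_cancel_right:
  assumes "f \<in> W" "g \<cdot> f \<in> W" "g \<in> Arr C" "Cod C f = Dom C g"
  shows "g \<in> W"
proof (rule WI)
  note F = WD[OF assms(1)] and H = WD[OF assms(2)]
  fix N y y' assume N: "N \<in> M" and y: "in_hom y N (Dom C g)" "in_hom y' N (Dom C g)"
    and e: "steq (g \<cdot> y) (g \<cdot> y')"
  \<comment> \<open>Stable surjectivity of \<open>f\<close> replaces \<open>y\<close> and
    \<open>y'\<close> by \<open>f \<cdot> x\<close> and \<open>f \<cdot> x'\<close>, where stable
    injectivity of the composite applies.\<close>
  obtain x where x: "in_hom x N (Dom C f)" "steq (f \<cdot> x) y" using F(3)[OF N, of y] y assms(4) by auto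
  obtain x' where x': "in_hom x' N (Dom C f)" "steq (f \<cdot> x') y'" using F(3)[OF N, of y'] y assms(4) by auto
  have "steq (g \<cdot> (f \<cdot> x)) (g \<cdot> y)" by (rule steq_comp_left[OF x(2)]) (use y assms in auto)
  also note e
  also have "steq (g \<cdot> y') (g \<cdot> (f \<cdot> x'))" by (rule steq_sym, rule steq_comp_left[OF x'(2)]) (use y assms in auto)
  finally have "steq x x'" using H(2)[OF N, of x x'] x(1) x'(1) F(1) assms(3,4) by simp
  then have "steq (f \<cdot> x) (f \<cdot> x')" by (rule steq_comp_left) (use x' F in auto)
  then show "steq y y'" using steq_trans[OF steq_sym[OF x(2)]] steq_trans[OF _ x'(2)] by blast
next
  note F = WD[OF assms(1)] and H = WD[OF assms(2)]
  fix N z assume N: "N \<in> M" and z: "in_hom z N (Cod C g)"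
  obtain x where x: "in_hom x N (Dom C f)" "steq ((g \<cdot> f) \<cdot> x) z"
    using H(3)[OF N, of z] z F(1) assms(3,4) by auto
  then show "\<exists>y. in_hom y N (Dom C g) \<and> steq (g \<cdot> y) z"
    using F(1) assms(3,4) by (intro exI[of _ "f \<cdot> x"]) simp
qed fact

lemma W_cancel_left:
  assumes "g \<in> W" "g \<cdot> f \<in> W" "f \<in> Arr C" "Cod C f = Dom C g"
  shows "f \<in> W"
proof (rule WI)
  note G = WD[OF assms(1)] and H = WD[OF assms(2)]
  fix N x x' assume N: "N \<in> M" and x: "in_hom x N (Dom C f)" "in_hom x' N (Dom C f)"
    and e: "steq (f \<cdot> x) (f \<cdot> x')"
  have "steq (g \<cdot> (f \<cdot> x)) (g \<cdot> (f \<cdot> x'))" by (rule steq_comp_left[OF e]) (use x G assms in auto)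
  then show "steq x x'" using H(2)[OF N, of x x'] x G(1) assms(3,4) by simp
next
  note G = WD[OF assms(1)] and H = WD[OF assms(2)]
  fix N y assume N: "N \<in> M" and y: "in_hom y N (Cod C f)"
  obtain x where x: "in_hom x N (Dom C f)" "steq ((g \<cdot> f) \<cdot> x) (g \<cdot> y)"
    using H(3)[OF N, of "g \<cdot> y"] y G(1) assms(3,4) by auto
  then have "steq (f \<cdot> x) y" using G(2)[OF N, of "f \<cdot> x" y] y G(1) assms(3,4) by simp
  then show "\<exists>x. in_hom x N (Dom C f) \<and> steq (f \<cdot> x) y" using x by blast
qed fact

lemma iso_Fib_W:
  assumes "is_iso C f"
  shows "f \<in> Fib" "f \<in> W"
proof -
  obtain g where f: "f \<in> Arr C" and g: "in_hom g (Cod C f) (Dom C f)"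
    and gf: "g \<cdot> f = Id C (Dom C f)" and fg: "f \<cdot> g = Id C (Cod C f)"
    using is_isoE[OF assms] by metis
  show "f \<in> Fib"
  proof (rule FibI[OF f])
    fix v assume "v \<in> Arr C" "Cod C v = Cod C f"
    then show "\<exists>l. in_hom l (Dom C v) (Dom C f) \<and> f \<cdot> l = v"
      using f g by (intro exI[of _ "g \<cdot> v"]) (simp add: comp_eq_assoc[OF fg])
  qed
  show "f \<in> W"
  proof (rule WI[OF f])
    fix N x x' assume x: "in_hom x N (Dom C f)" "in_hom x' N (Dom C f)" "steq (f \<cdot> x) (f \<cdot> x')"
    have "steq (g \<cdot> (f \<cdot> x)) (g \<cdot> (f \<cdot> x'))" by (rule steq_comp_left[OF x(3)]) (use x f g in auto)
    then show "steq x x'" using x f g by (simp add: comp_eq_assoc[OF gf])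
  next
    fix N y assume "in_hom y N (Cod C f)"
    then show "\<exists>x. in_hom x N (Dom C f) \<and> steq (f \<cdot> x) y"
      using f g by (intro exI[of _ "g \<cdot> y"]) (simp add: comp_eq_assoc[OF fg] steq_refl)
  qed
qed

lemma Fib_comp:
  assumes "f \<in> Fib" "g \<in> Fib" "Cod C f = Dom C g"
  shows "g \<cdot> f \<in> Fib"
proof (rule FibI)
  note F = FibD[OF assms(1)] and G = FibD[OF assms(2)]
  show "g \<cdot> f \<in> Arr C" using F(1) G(1) assms(3) by simp
  fix v assume v: "v \<in> Arr C" "Dom C v \<in> mho C S M" "Cod C v = Cod C (g \<cdot> f)"
  obtain l where l: "in_hom l (Dom C v) (Dom C g)" "g \<cdot> l = v" using G(2)[of v] v F(1) G(1) assms(3) by auto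
  obtain k where k: "in_hom k (Dom C v) (Dom C f)" "f \<cdot> k = l" using F(2)[of l] v l assms(3) by auto
  show "\<exists>l. in_hom l (Dom C v) (Dom C (g \<cdot> f)) \<and> (g \<cdot> f) \<cdot> l = v"
    using k l F(1) G(1) assms(3) by (intro exI[of _ k]) simp
qed

lemma is_retractE:
  assumes "is_retract C f g"
  obtains i r j s where "f \<in> Arr C" "g \<in> Arr C" "in_hom i (Dom C f) (Dom C g)" "in_hom r (Dom C g) (Dom C f)"
    "in_hom j (Cod C f) (Cod C g)" "in_hom s (Cod C g) (Cod C f)"
    "r \<cdot> i = Id C (Dom C f)" "s \<cdot> j = Id C (Cod C f)" "g \<cdot> i = j \<cdot> f" "f \<cdot> r = s \<cdot> g"
proof -
  have fg: "f \<in> Arr C" "g \<in> Arr C" using assms by (auto simp: is_retract_def)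
  obtain i r j s where c: "i \<in> carrier (Hom C (Dom C f) (Dom C g))" "r \<in> carrier (Hom C (Dom C g) (Dom C f))"
    "j \<in> carrier (Hom C (Cod C f) (Cod C g))" "s \<in> carrier (Hom C (Cod C g) (Cod C f))"
    and e: "r \<cdot> i = Id C (Dom C f)" "s \<cdot> j = Id C (Cod C f)" "g \<cdot> i = j \<cdot> f" "f \<cdot> r = s \<cdot> g"
    using assms unfolding is_retract_def by blast
  show thesis by (rule that[OF fg _ _ _ _ e]) (use c fg carrier_Hom_iff in auto)
qed

lemma Fib_retract:
  assumes "is_retract C f g" "g \<in> Fib"
  shows "f \<in> Fib"
proof -
  obtain i r j s where a: "f \<in> Arr C" "g \<in> Arr C" "in_hom i (Dom C f) (Dom C g)" "in_hom r (Dom C g) (Dom C f)"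
    "in_hom j (Cod C f) (Cod C g)" "in_hom s (Cod C g) (Cod C f)"
    and e: "r \<cdot> i = Id C (Dom C f)" "s \<cdot> j = Id C (Cod C f)" "g \<cdot> i = j \<cdot> f" "f \<cdot> r = s \<cdot> g"
    using is_retractE[OF assms(1)] by blast
  show ?thesis
  proof (rule FibI[OF a(1)])
    fix v assume v: "v \<in> Arr C" "Dom C v \<in> mho C S M" "Cod C v = Cod C f"
    obtain l where l: "in_hom l (Dom C v) (Dom C g)" "g \<cdot> l = j \<cdot> v"
      using FibD(2)[OF assms(2), of "j \<cdot> v"] v a by auto
    have "f \<cdot> (r \<cdot> l) = s \<cdot> (g \<cdot> l)" using comp_eq_assoc[OF e(4), of l] l(1) a by simp
    also have "\<dots> = v" unfolding l(2) using v a by (simp add: comp_eq_assoc[OF e(2)])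
    finally show "\<exists>l. in_hom l (Dom C v) (Dom C f) \<and> f \<cdot> l = v"
      using l(1) a by (intro exI[of _ "r \<cdot> l"]) simp
  qed
qed

lemma W_retract:
  assumes "is_retract C f g" "g \<in> W"
  shows "f \<in> W"
proof -
  obtain i r j s where a: "f \<in> Arr C" "g \<in> Arr C" "in_hom i (Dom C f) (Dom C g)" "in_hom r (Dom C g) (Dom C f)"
    "in_hom j (Cod C f) (Cod C g)" "in_hom s (Cod C g) (Cod C f)"
    and e: "r \<cdot> i = Id C (Dom C f)" "s \<cdot> j = Id C (Cod C f)" "g \<cdot> i = j \<cdot> f" "f \<cdot> r = s \<cdot> g"
    using is_retractE[OF assms(1)] by blast
  note G = WD[OF assms(2)]
  show ?thesis
  proof (rule WI[OF a(1)])
    fix N x x' assume N: "N \<in> M" and x: "in_hom x N (Dom C f)" "in_hom x' N (Dom C f)" "steq (f \<cdot> x) (f \<cdot> x')"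
    have "steq (j \<cdot> (f \<cdot> x)) (j \<cdot> (f \<cdot> x'))" by (rule steq_comp_left[OF x(3)]) (use x a in auto)
    also have "j \<cdot> (f \<cdot> x) = g \<cdot> (i \<cdot> x)" using comp_eq_assoc[OF e(3), of x] x a by simp
    also have "j \<cdot> (f \<cdot> x') = g \<cdot> (i \<cdot> x')" using comp_eq_assoc[OF e(3), of x'] x a by simp
    finally have "steq (i \<cdot> x) (i \<cdot> x')" by (rule G(2)[OF N, rotated 2]) (use x a in auto)
    then have "steq (r \<cdot> (i \<cdot> x)) (r \<cdot> (i \<cdot> x'))" by (rule steq_comp_left) (use x a in auto)
    then show "steq x x'" using x a by (simp add: comp_eq_assoc[OF e(1)])
  next
    fix N y assume N: "N \<in> M" and y: "in_hom y N (Cod C f)"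
    obtain x where x: "in_hom x N (Dom C g)" "steq (g \<cdot> x) (j \<cdot> y)" using G(3)[OF N, of "j \<cdot> y"] y a by auto
    have "f \<cdot> (r \<cdot> x) = s \<cdot> (g \<cdot> x)" using comp_eq_assoc[OF e(4), of x] x(1) a by simp
    also have "steq (s \<cdot> (g \<cdot> x)) (s \<cdot> (j \<cdot> y))" by (rule steq_comp_left[OF x(2)]) (use y a in auto)
    also have "s \<cdot> (j \<cdot> y) = y" using y a by (simp add: comp_eq_assoc[OF e(2)])
    finally show "\<exists>x. in_hom x N (Dom C f) \<and> steq (f \<cdot> x) y" using x(1) a by (intro exI[of _ "r \<cdot> x"]) simp
  qed
qed

section \<open>The strict description of acyclic fibrations\<close>

lemma acyclic_lift:
  assumes "f \<in> Fib" "f \<in> W" "y \<in> Arr C" "Dom C y \<in> M" "Cod C y = Cod C f"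
  shows "\<exists>x. in_hom x (Dom C y) (Dom C f) \<and> f \<cdot> x = y"
proof -
  note F = FibD[OF assms(1)] and G = WD[OF assms(2)]
  obtain x0 where x0: "in_hom x0 (Dom C y) (Dom C f)" "steq (f \<cdot> x0) y"
    using G(3)[OF assms(4), of y] assms by auto
  \<comment> \<open>The lift \<open>x0\<close> has an error \<open>?d\<close> that passes through an
    injective \<open>I\<close>. The second half \<open>h\<close> of the error lifts along
    \<open>f\<close>, and subtracting \<open>h' \<cdot> k\<close> makes the lift exact.\<close>
  let ?d = "f \<cdot> x0 \<boxminus> y"
  have d: "in_hom ?d (Dom C y) (Cod C f)" "stz ?d" using x0 F(1) assms(3,5) steqD(5)[OF x0(2)] by auto
  obtain I k h where I: "I \<in> injectives C S" "in_hom k (Dom C y) I" "in_hom h I (Cod C f)" "?d = h \<cdot> k"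
    using d(2) unfolding stz_def d(1)[THEN conjunct2, THEN conjunct1] d(1)[THEN conjunct2, THEN conjunct2] by blast
  obtain h' where h': "in_hom h' I (Dom C f)" "f \<cdot> h' = h" using F(2)[of h] I injectives_mho by auto
  have "f \<cdot> (x0 \<boxminus> h' \<cdot> k) = f \<cdot> x0 \<boxminus> ?d"
    unfolding I(4) using x0(1) h' I(2,3) F(1) by (simp add: comp_eq_assoc[OF h'(2)])
  also have "\<dots> = y" using x0(1) F(1) assms(3,5) by (simp add: minus_def neg_add)
  finally show ?thesis using x0(1) h'(1) I(2) by (intro exI[of _ "x0 \<boxminus> h' \<cdot> k"]) simp
qed

text \<open>
  Extend a factorization of \<open>g\<close> along an injective hull \<open>J\<close> of its domain; the obstruction to \<open>f u = 0\<close>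
  factors through the cosyzygy of that domain and is removed by the lifting property of \<open>f\<close>.
\<close>

lemma acyclic_kernel:
  assumes "f \<in> Fib" "f \<in> W" "g \<in> Arr C" "Dom C g \<in> M" "Cod C g = Dom C f"
    "f \<cdot> g = zero (Dom C g) (Cod C f)"
  shows "\<exists>J \<in> injectives C S. \<exists>j u. in_hom j (Dom C g) J \<and> in_hom u J (Dom C f) \<and> u \<cdot> j = g \<and>
    f \<cdot> u = zero J (Cod C f)"
proof -
  note F = FibD[OF assms(1)] and G = WD[OF assms(2)]
  let ?N = "Dom C g"
  have "steq (f \<cdot> g) (f \<cdot> zero ?N (Dom C f))" using assms F(1) by (simp add: steq_refl)
  then have "steq g (zero ?N (Dom C f))" by (rule G(2)[OF assms(4), rotated 2]) (use assms(3,5) F(1) in auto)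
  then have "stz g" using steq_zero_iff[OF assms(3)] assms(5) by simp
  then obtain I a b where I: "I \<in> injectives C S" "in_hom a ?N I" "in_hom b I (Dom C f)" "g = b \<cdot> a"
    unfolding stz_def assms(5) by blast
  \<comment> \<open>The object \<open>I\<close> itself does not serve: \<open>a\<close> need not be
    an inflation, whereas the argument needs the cokernel of an inflation from
    \<open>Dom C g\<close> into an injective.\<close>
  obtain j q where j: "(j, q) \<in> S" "Dom C j = ?N" "Cod C j \<in> injectives C S"
    using injective_hull assms(3) Dom_Obj by metis
  note J = S_D(3-6)[OF j(1)]
  obtain a' where a': "in_hom a' (Cod C j) I" "a' \<cdot> j = a"
    using injectivesD(2)[OF I(1), of j a] j I(2,3) by (auto simp: inflation_def)
  let ?w = "b \<cdot> a'"
  have w: "in_hom ?w (Dom C q) (Dom C f)" "?w \<cdot> j = g"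
    unfolding I(4) using a' I(2,3) J by simp_all
  have "(f \<cdot> ?w) \<cdot> j = zero (Dom C j) (Cod C f)" using w J F(1) assms(6) j(2) by simp
  then obtain v where v: "in_hom v (Cod C q) (Cod C f)" "v \<cdot> q = f \<cdot> ?w"
    using is_cokernelD(5)[OF S_D(2)[OF j(1)], of "f \<cdot> ?w"] w(1) F(1) by auto
  have "Cod C q \<in> mho C S M" using mhoI[OF j(1)] j assms(4) by simp
  then obtain v' where v': "in_hom v' (Cod C q) (Dom C f)" "f \<cdot> v' = v" using F(2)[of v] v by auto
  let ?u = "?w \<boxminus> v' \<cdot> q"
  have "?u \<cdot> j = g" using w v' J F(1) assms(3,5) j(2) by simp
  moreover have "f \<cdot> ?u = zero (Dom C q) (Cod C f)"
  proof -
    have "f \<cdot> ?u = f \<cdot> ?w \<boxminus> v \<cdot> q"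
      using w(1) v' v(1) J F(1) by (simp del: comp_assoc' add: comp_eq_assoc[OF v'(2)])
    then show ?thesis unfolding v(2) using w(1) F(1) by (simp del: comp_assoc')
  qed
  moreover have "in_hom ?u (Dom C q) (Dom C f)" using w(1) v' J by simp
  ultimately show ?thesis using j J by (intro bexI[of _ "Dom C q"] exI[of _ j] exI[of _ ?u]) auto
qed

text \<open>Converse of the two preceding strict statements, with the kernel clause relaxed to
  \<open>stz g\<close>: this weaker form has to be verified in applications, while
  \<open>acyclic_kernel\<close> gives the strong form for use.\<close>

lemma acyclicI:
  assumes f: "f \<in> Fib"
    and lift: "\<And>y. \<lbrakk>y \<in> Arr C; Dom C y \<in> M; Cod C y = Cod C f\<rbrakk> \<Longrightarrow> \<exists>x. in_hom x (Dom C y) (Dom C f) \<and> f \<cdot> x = y"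
    and ker: "\<And>g. \<lbrakk>g \<in> Arr C; Dom C g \<in> M; Cod C g = Dom C f; f \<cdot> g = zero (Dom C g) (Cod C f)\<rbrakk> \<Longrightarrow> stz g"
  shows "f \<in> W"
proof (rule WI)
  note F = FibD[OF f]
  show "f \<in> Arr C" by (rule F)
  fix N x x' assume N: "N \<in> M" and x: "in_hom x N (Dom C f)" "in_hom x' N (Dom C f)"
    and e: "steq (f \<cdot> x) (f \<cdot> x')"
  let ?d = "f \<cdot> x \<boxminus> f \<cdot> x'"
  have d: "in_hom ?d N (Cod C f)" "stz ?d" using x F(1) steqD(5)[OF e] by auto
  obtain I k h where I: "I \<in> injectives C S" "in_hom k N I" "in_hom h I (Cod C f)" "?d = h \<cdot> k"
    using d(2) unfolding stz_def d(1)[THEN conjunct2, THEN conjunct1] d(1)[THEN conjunct2, THEN conjunct2] by blast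
  obtain h' where h': "in_hom h' I (Dom C f)" "f \<cdot> h' = h" using F(2)[of h] I injectives_mho by auto
  \<comment> \<open>The map \<open>h' \<cdot> k\<close> lifts \<open>?d\<close> along
    \<open>f\<close>, so \<open>f\<close> kills \<open>?g\<close> exactly, while \<open>?g\<close>
    differs from \<open>x \<boxminus> x'\<close> by a stably zero map.\<close>
  let ?g = "(x \<boxminus> x') \<boxminus> h' \<cdot> k"
  have g: "in_hom ?g N (Dom C f)" using x h' I(2,3) by simp
  have "f \<cdot> ?g = ?d \<boxminus> ?d"
    by (subst (2) I(4)) (use x h' I(2,3) F(1) in \<open>simp add: comp_eq_assoc[OF h'(2)]\<close>)
  then have "stz ?g" using ker[of ?g] g d N x h' I(2,3) F(1) by simp
  moreover have "stz (h' \<cdot> k)" by (rule stzI[OF I(1,2) h'(1)])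
  ultimately have "stz (?g \<boxplus> h' \<cdot> k)" by (rule stz_add) (use g h' I in auto)
  moreover have "?g \<boxplus> h' \<cdot> k = x \<boxminus> x'" using x h' I(2,3) by simp
  ultimately show "steq x x'" using x by (simp add: steq_def)
next
  fix N y assume "N \<in> M" "in_hom y N (Cod C f)"
  then obtain x where "in_hom x N (Dom C f)" "f \<cdot> x = y" using lift[of y] by auto
  then show "\<exists>x. in_hom x N (Dom C f) \<and> steq (f \<cdot> x) y"
    using \<open>in_hom y N (Cod C f)\<close> by (intro exI[of _ x]) (simp add: steq_refl)
qed

section \<open>Base change\<close>

lemma Fib_base_change:
  assumes "is_pullback C b f h g" "f \<in> Fib"
  shows "h \<in> Fib"
proof (rule FibI)
  note P = is_pullbackD[OF assms(1)] and F = FibD[OF assms(2)]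
  show "h \<in> Arr C" by (rule P)
  fix v assume v: "v \<in> Arr C" "Dom C v \<in> mho C S M" "Cod C v = Cod C h"
  obtain l where l: "in_hom l (Dom C v) (Dom C f)" "f \<cdot> l = b \<cdot> v" using F(2)[of "b \<cdot> v"] v P(1-8) by auto
  show "\<exists>l. in_hom l (Dom C v) (Dom C h) \<and> h \<cdot> l = v"
    using P(10)[of v l] P(6,7) v l by auto
qed

text \<open>The clauses of \<open>acyclicI\<close> for \<open>h\<close> come from exact equations
  for \<open>f\<close>, and these pass through the universal property of the square.\<close>

lemma acyclic_base_change:
  assumes "is_pullback C b f h g" "f \<in> Fib" "f \<in> W"
  shows "h \<in> W"
proof (rule acyclicI)
  note P = is_pullbackD[OF assms(1)] and F = FibD[OF assms(2)]
  show "h \<in> Fib" by (rule Fib_base_change[OF assms(1,2)])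
  fix y assume y: "y \<in> Arr C" "Dom C y \<in> M" "Cod C y = Cod C h"
  obtain l where l: "in_hom l (Dom C y) (Dom C f)" "f \<cdot> l = b \<cdot> y"
    using acyclic_lift[OF assms(2,3), of "b \<cdot> y"] y P(1-8) by auto
  show "\<exists>l. in_hom l (Dom C y) (Dom C h) \<and> h \<cdot> l = y"
    using P(10)[of y l] P(6,7) y l by auto
next
  note P = is_pullbackD[OF assms(1)]
  fix x assume x: "x \<in> Arr C" "Dom C x \<in> M" "Cod C x = Dom C h" "h \<cdot> x = zero (Dom C x) (Cod C h)"
  have "f \<cdot> (g \<cdot> x) = b \<cdot> (h \<cdot> x)" using comp_eq_assoc[OF P(9), of x] P(1-8) x(1-3) by simp
  also have "\<dots> = zero (Dom C x) (Cod C f)" using P(1-8) x by simp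
  finally obtain J j u where J: "J \<in> injectives C S" "in_hom j (Dom C x) J" "in_hom u J (Dom C f)"
    "u \<cdot> j = g \<cdot> x" "f \<cdot> u = zero J (Cod C f)"
    using acyclic_kernel[OF assms(2,3), of "g \<cdot> x"] P(1-8) x(1-3) by auto
  have "J \<in> Obj C" by (rule injectivesD(1)[OF J(1)])
  \<comment> \<open>The pair \<open>(0, u)\<close> is compatible because \<open>f \<cdot> u\<close>
    is exactly zero. The induced \<open>u'\<close> satisfies \<open>u' \<cdot> j = x\<close> since
    both sides have the same projections.\<close>
  then obtain u' where u': "in_hom u' J (Dom C g)" "h \<cdot> u' = zero J (Dom C b)" "g \<cdot> u' = u"
    using P(10)[of "zero J (Dom C b)" u] P(1-8) J by auto
  have "u' \<cdot> j = x"
    by (rule P(11))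
      (use P(1-8) x u' J(2-4) in \<open>simp_all add: comp_eq_assoc[OF u'(2)] comp_eq_assoc[OF u'(3)]\<close>)
  then show "stz x" using stzI[OF J(1,2) u'(1)] by simp
qed

section \<open>Objects of pr M are cofibrant\<close>

lemma pr_cofibrant:
  assumes "X \<in> pr C S M"
  shows "cofibrant C Fib W X"
proof -
  obtain i p where i: "(i, p) \<in> S" "Dom C i \<in> M" "Dom C p \<in> M" "Cod C p = X"
    using prE[OF assms] by metis
  note L = S_D(3-6)[OF i(1)] and K = is_cokernelD(5,6)[OF S_D(2)[OF i(1)]]
  have X: "X \<in> Obj C" using L i by auto
  have "\<exists>l. in_hom l X (Dom C f) \<and> f \<cdot> l = c"
    if f: "f \<in> Fib" "f \<in> W" and c: "in_hom c X (Cod C f)" for f c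
  proof -
    note F = FibD(1)[OF f(1)]
    obtain g where g: "in_hom g (Dom C p) (Dom C f)" "f \<cdot> g = c \<cdot> p"
      using acyclic_lift[OF f, of "c \<cdot> p"] c L i by auto
    have "f \<cdot> (g \<cdot> i) = zero (Dom C i) (Cod C f)" using g L F c i(4) by (simp add: comp_eq_assoc[OF g(2)])
    then obtain J j u where J: "J \<in> injectives C S" "in_hom j (Dom C i) J" "in_hom u J (Dom C f)"
      "u \<cdot> j = g \<cdot> i" "f \<cdot> u = zero J (Cod C f)"
      using acyclic_kernel[OF f, of "g \<cdot> i"] g(1) L i by auto
    \<comment> \<open>Injectivity of \<open>J\<close> extends \<open>j\<close> over the inflation
      \<open>i\<close>. Then \<open>u \<cdot> t\<close> agrees with \<open>g\<close> after
      \<open>i\<close> and is killed by \<open>f\<close>, so \<open>?g\<close> still lifts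
      \<open>c \<cdot> p\<close> and descends to the cokernel \<open>X\<close>.\<close>
    obtain t where t: "in_hom t (Cod C i) J" "t \<cdot> i = j"
      using injectivesD(2)[OF J(1), of i j] J i(1) by (auto simp: inflation_def)
    let ?g = "g \<boxminus> u \<cdot> t"
    have g': "in_hom ?g (Dom C p) (Dom C f)" using g t J(2,3) L by simp
    have "?g \<cdot> i = zero (Dom C i) (Dom C f)" using g(1) t J(2-4) L F by simp
    then obtain l where l: "in_hom l X (Dom C f)" "l \<cdot> p = ?g" using K(1)[of ?g] g' i by auto
    have "(f \<cdot> l) \<cdot> p = c \<cdot> p"
      using l g t J(2,3) L F i c by (simp add: comp_eq_assoc[OF J(5)])
    then have "f \<cdot> l = c" by (rule K(2)[rotated -1]) (use l(1) L F i c in auto)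
    then show ?thesis using l by auto
  qed
  then show ?thesis
    unfolding cofibrant_def using X carrier_Hom_iff FibD(1) by (auto simp: Bex_def)
qed

section \<open>Projections, approximations and factorizations\<close>

lemma biprod_eq_component:
  assumes "biprod i j p q" "x \<in> Arr C" "Cod C x = Dom C p" "q \<cdot> x = zero (Dom C x) (Cod C q)"
  shows "x = i \<cdot> (p \<cdot> x)"
proof -
  note d = biprodD[OF assms(1)]
  have "x = (i \<cdot> p \<boxplus> j \<cdot> q) \<cdot> x" unfolding d(14) using assms by simp
  also have "\<dots> = i \<cdot> (p \<cdot> x)" using assms(2-4) d(1-9) by simp
  finally show ?thesis .
qed

text \<open>The inclusion \<open>i\<close> gives lifts along \<open>p\<close> from every object, and
  a map killed by \<open>p\<close> passes through the summand \<open>Dom C j\<close>, on which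
  \<open>G\<close> vanishes. Then \<open>p \<cdot> i = Id\<close> and two-out-of-three handle
  \<open>i\<close>.\<close>

lemma biprod_projection:
  assumes "biprod i j p q" "\<And>f. \<lbrakk>f \<in> Arr C; Dom C f \<in> M; Cod C f = Dom C j\<rbrakk> \<Longrightarrow> stz f"
  shows "p \<in> Fib" "p \<in> W" "i \<in> W"
proof -
  note d = biprodD[OF assms(1)]
  show p: "p \<in> Fib"
  proof (rule FibI)
    fix v assume "v \<in> Arr C" "Cod C v = Cod C p"
    then show "\<exists>l. in_hom l (Dom C v) (Dom C p) \<and> p \<cdot> l = v"
      using d(1-9) by (intro exI[of _ "i \<cdot> v"]) (simp add: comp_eq_assoc[OF d(10)])
  qed (rule d)
  show "p \<in> W"
  proof (rule acyclicI[OF p])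
    fix v assume "v \<in> Arr C" "Cod C v = Cod C p"
    then show "\<exists>l. in_hom l (Dom C v) (Dom C p) \<and> p \<cdot> l = v"
      using d(1-9) by (intro exI[of _ "i \<cdot> v"]) (simp add: comp_eq_assoc[OF d(10)])
  next
    fix g assume g: "g \<in> Arr C" "Dom C g \<in> M" "Cod C g = Dom C p" "p \<cdot> g = zero (Dom C g) (Cod C p)"
    have "g = j \<cdot> (q \<cdot> g)"
      by (rule biprod_eq_component[OF biprod_commute[OF assms(1)]]) (use g d(7) in auto)
    moreover have "stz (j \<cdot> (q \<cdot> g))"
      by (rule stz_comp_left[OF assms(2)]) (use g d(1-9) in auto)
    ultimately show "stz g" by simp
  qed
  then show "i \<in> W"
    using d iso_Fib_W(2)[OF is_iso_Id[of "Dom C i"]] by (simp add: W_cancel_left[of p i])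
qed

text \<open>A right \<mho>M-approximation is a fibration by the very definition of
  \<open>Fib\<close>; contravariant finiteness of \<mho>M thus yields a fibration onto every
  object.\<close>

lemma mho_approximation:
  assumes "X \<in> Obj C"
  obtains e where "e \<in> Fib" "Dom C e \<in> mho C S M" "Cod C e = X"
proof -
  have "mho C S M \<subseteq> Obj C" using mho_Obj by auto
  from right_approximation[OF mho_finite this assms]
  obtain e where e: "e \<in> Arr C" "Dom C e \<in> mho C S M" "Cod C e = X"
    "\<forall>f \<in> Arr C. Dom C f \<in> mho C S M \<longrightarrow> Cod C f = X \<longrightarrow> (\<exists>g. in_hom g (Dom C f) (Dom C e) \<and> e \<cdot> g = f)"
    by blast
  then have "e \<in> Fib" by (intro FibI) auto
  then show thesis using that e by blast
qed

lemma factorization: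
  assumes "f \<in> Arr C"
  shows "\<exists>w \<in> W. \<exists>p \<in> Fib. Cod C w = Dom C p \<and> p \<cdot> w = f"
proof -
  obtain e where e: "e \<in> Fib" "Dom C e \<in> mho C S M" "Cod C e = Cod C f"
    using mho_approximation[OF Cod_Obj[OF assms]] by metis
  note E = FibD[OF e(1)]
  obtain i j p q where B: "biprod i j p q" "Dom C i = Dom C f" "Dom C j = Dom C e"
    using biprod_exists[of "Dom C f" "Dom C e"] assms E(1) by auto
  note d = biprodD[OF B(1)]
  have "i \<in> W" by (rule biprod_projection(3)[OF B(1)]) (use mho_stz e B in auto)
  moreover have "f \<cdot> p \<boxplus> e \<cdot> q \<in> Fib"
  proof (rule FibI)
    show "f \<cdot> p \<boxplus> e \<cdot> q \<in> Arr C" using assms E(1) B d(1-9) e by simp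
    fix v assume v: "v \<in> Arr C" "Dom C v \<in> mho C S M" "Cod C v = Cod C (f \<cdot> p \<boxplus> e \<cdot> q)"
    \<comment> \<open>The lift uses the second summand alone: \<open>e\<close> already lifts
      \<open>v\<close>, whatever \<open>f\<close> is.\<close>
    obtain l where l: "in_hom l (Dom C v) (Dom C e)" "e \<cdot> l = v" using E(2)[of v] v assms E(1) B d(1-9) e by auto
    show "\<exists>l. in_hom l (Dom C v) (Dom C (f \<cdot> p \<boxplus> e \<cdot> q)) \<and> (f \<cdot> p \<boxplus> e \<cdot> q) \<cdot> l = v"
      using l v assms E(1) B d(1-9) e
      by (intro exI[of _ "j \<cdot> l"]) (simp add: comp_eq_assoc[OF d(11)] comp_eq_assoc[OF d(13)])
  qed
  moreover have "(f \<cdot> p \<boxplus> e \<cdot> q) \<cdot> i = f" using assms E(1) B d(1-13) e by simp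
  ultimately show ?thesis using assms E(1) B d(1-9) e
    by (intro bexI[of _ i] bexI[of _ "f \<cdot> p \<boxplus> e \<cdot> q"]) auto
qed

text \<open>Pull the extension back along an injective presentation \<open>e\<close> of its quotient
  in \<mho>M. The pullback is the biproduct of \<open>Dom C e\<close> and \<open>Dom C k\<close>, so
  it lies in \<open>M\<close>, and its projection \<open>h\<close> to \<open>Dom C d\<close> is a
  deflation with kernel \<open>Dom C i\<close> in \<open>M\<close>.\<close>

lemma extension_in_pr:
  assumes "(k, d) \<in> S" "Dom C k \<in> M" "Cod C d \<in> mho C S M"
  shows "Dom C d \<in> pr C S M"
proof -
  note D = S_D(3-6)[OF assms(1)]
  obtain i e where i: "(i, e) \<in> S" "Dom C i \<in> M" "Dom C e \<in> injectives C S" "Cod C e = Cod C d"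
    using mhoE[OF assms(3)] by metis
  note I = S_D(3-6)[OF i(1)]
  have "deflation S e" using i(1) by (auto simp: deflation_def)
  then obtain h g where P: "is_pullback C d e h g" and h: "deflation S h"
    using deflation_pullback[of e d] D i(4) by auto
  note Q = is_pullbackD[OF P]
  have eM: "Dom C e \<in> M" using i(3) injectives_M by auto
  \<comment> \<open>Rigidity lifts \<open>e\<close> along \<open>d\<close>, since
    \<open>Dom C e\<close> is injective and therefore in \<open>M\<close>. The pair
    \<open>(l, Id)\<close> is then compatible and splits the projection \<open>g\<close>.\<close>
  obtain l where l: "in_hom l (Dom C e) (Dom C d)" "d \<cdot> l = e"
    using rigid_lift[OF rigid_M assms(1,2) eM] I i(4) by auto
  obtain s where s: "in_hom s (Dom C e) (Dom C g)" "g \<cdot> s = Id C (Dom C e)"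
    using Q(10)[of l "Id C (Dom C e)"] l I by auto
  obtain k' where k': "is_kernel C k' g" "Dom C k' = Dom C k"
    using pullback_kernel[OF is_pullback_sym[OF P] S_D(1)[OF assms(1)]] by auto
  obtain t where "biprod s k' g t"
    using retraction_kernel_biprod[OF k'(1), of s] s Q(8) by auto
  then have "Dom C g \<in> M" using M_biprod s k' assms(2) eM by metis
  moreover obtain k'' where "is_kernel C k'' h" "Dom C k'' = Dom C i"
    using pullback_kernel[OF P S_D(1)[OF i(1)]] by auto
  ultimately show ?thesis using prI[OF S_kernelI[OF h]] i(2) Q(6,7) by metis
qed

text \<open>
  With a right approximation \<open>a: M\<^sub>0 \<rightarrow> X\<close> and an injective hull \<open>j: M\<^sub>0 \<rightarrow> J\<close>, the cokernel \<open>V\<close> of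
  \<open>(j, a): M\<^sub>0 \<rightarrow> J \<oplus> X\<close> satisfies \<open>G V = 0\<close>. Hence an \<open>\<mho>M\<close>-approximation \<open>U \<rightarrow> V\<close> is an acyclic
  fibration, and so is its base change \<open>X' \<rightarrow> J \<oplus> X\<close>, where \<open>X'\<close> is an extension of \<open>U\<close> by \<open>M\<^sub>0\<close>.
\<close>

lemma pr_resolution:
  assumes "X \<in> Obj C"
  shows "\<exists>w. w \<in> Fib \<and> w \<in> W \<and> Cod C w = X \<and> Dom C w \<in> pr C S M"
proof -
  obtain a where a: "a \<in> Arr C" "Dom C a \<in> M" "Cod C a = X"
    and approx: "\<forall>f \<in> Arr C. Dom C f \<in> M \<longrightarrow> Cod C f = X \<longrightarrow> (\<exists>g. in_hom g (Dom C f) (Dom C a) \<and> a \<cdot> g = f)"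
    using right_approximation[OF M_finite M_subset assms] by blast
  obtain j j' where j: "(j, j') \<in> S" "Dom C j = Dom C a" "Cod C j \<in> injectives C S"
    using injective_hull[OF Dom_Obj[OF a(1)]] by metis
  note J = S_D(3-6)[OF j(1)]
  have "inflation S j" using j(1) by (auto simp: inflation_def)
  \<comment> \<open>The approximation \<open>a\<close> need not be an inflation; pairing it with the
    hull \<open>j\<close> makes it one, which provides the cokernel \<open>c\<close>.\<close>
  from inflation_col[OF this a(1)] obtain u v p q where B: "biprod u v p q" "Dom C u = Cod C j" "Dom C v = X"
    and inf: "inflation S (u \<cdot> j \<boxplus> v \<cdot> a)"
    using a j by auto
  note d = biprodD[OF B(1)]
  let ?m = "u \<cdot> j \<boxplus> v \<cdot> a"
  obtain c where c: "(?m, c) \<in> S" using inf by (auto simp: inflation_def)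
  have m: "in_hom ?m (Dom C a) (Dom C p)" using B(2,3) d(1-9) J(1) j(2) a by simp
  have c': "c \<in> Arr C" "Dom C c = Dom C p" "c \<cdot> ?m = zero (Dom C a) (Cod C c)"
    using S_D(4-6)[OF c] m by auto
  \<comment> \<open>The kernel of \<open>c\<close> is in \<open>M\<close>, so rigidity lifts
    \<open>y\<close> to \<open>J \<oplus> X\<close>. The component in \<open>X\<close> factors
    through the approximation \<open>a\<close>; subtracting \<open>?m \<cdot> z\<close> cancels it
    without changing the image under \<open>c\<close>. What remains passes through the injective
    \<open>J\<close>.\<close>
  have V: "stz y" if y: "y \<in> Arr C" "Dom C y \<in> M" "Cod C y = Cod C c" for y
  proof -
    obtain y' where y': "in_hom y' (Dom C y) (Dom C p)" "c \<cdot> y' = y"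
      using rigid_lift[OF rigid_M c _ y(2,1,3)] m a c' by auto
    obtain z where z: "in_hom z (Dom C y) (Dom C a)" "a \<cdot> z = q \<cdot> y'"
      using approx[rule_format, of "q \<cdot> y'"] y y' B d(1-9) by auto
    let ?y = "y' \<boxminus> ?m \<cdot> z"
    have y'': "in_hom ?y (Dom C y) (Dom C p)" using y'(1) z(1) m by simp
    have "q \<cdot> ?m = a" using m d(1-13) J j(2) a B(2,3) assms
      by (simp add: comp_eq_assoc[OF d(11)] comp_eq_assoc[OF d(12)])
    then have "q \<cdot> ?y = zero (Dom C y) X"
      using y'(1) z m d(4,7,9) a B comp_eq_assoc[of q ?m a z] by (simp del: comp_add add_comp)
    then have "?y = u \<cdot> (p \<cdot> ?y)"
      using y'' d B(3) by (intro biprod_eq_component[OF B(1)]) auto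
    moreover have "c \<cdot> ?y = y"
      using y' z(1) m c' y comp_eq_assoc[OF c'(3), of z] by (simp del: comp_add add_comp)
    ultimately have "y = (c \<cdot> u) \<cdot> (p \<cdot> ?y)" using c' d(1-9) y'' by simp
    moreover have "stz ((c \<cdot> u) \<cdot> (p \<cdot> ?y))"
      by (rule stzI[OF j(3), of _ "Dom C y" _ "Cod C c"]) (use c' d(1-9) y'' B in auto)
    ultimately show ?thesis by simp
  qed
  obtain e where e: "e \<in> Fib" "Dom C e \<in> mho C S M" "Cod C e = Cod C c"
    using mho_approximation[OF Cod_Obj[OF c'(1)]] by metis
  note E = FibD(1)[OF e(1)]
  \<comment> \<open>\<open>G\<close> vanishes at both ends of \<open>e\<close>: at the domain by
    \<open>mho_stz\<close>, at the codomain by \<open>V\<close>. Hence zero is a stable preimage of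
    every \<open>y\<close>.\<close>
  have eW: "e \<in> W"
  proof (rule WI[OF E])
    fix N x x' assume "N \<in> M" "in_hom x N (Dom C e)" "in_hom x' N (Dom C e)"
    then show "steq x x'" using mho_stz[OF e(2), of "x \<boxminus> x'"] by (simp add: steq_def)
  next
    fix N y assume N: "N \<in> M" and y: "in_hom y N (Cod C e)"
    have "stz (e \<cdot> zero N (Dom C e) \<boxminus> y)" by (rule V) (use N y E e M_Obj[OF N] Cod_Obj[OF c'(1)] in auto)
    then show "\<exists>x. in_hom x N (Dom C e) \<and> steq (e \<cdot> x) y"
      using N y E M_Obj[OF N] by (intro exI[of _ "zero N (Dom C e)"]) (simp add: steq_def)
  qed
  have "deflation S c" using c by (auto simp: deflation_def)
  then obtain h g where P: "is_pullback C e c h g" and h: "deflation S h"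
    using deflation_pullback[of c e] E e(3) by auto
  note Q = is_pullbackD[OF P] and P' = is_pullback_sym[OF P]
  obtain k where k: "is_kernel C k h" "Dom C k = Dom C ?m"
    using pullback_kernel[OF P S_D(1)[OF c]] by auto
  have "Dom C h \<in> pr C S M"
    by (rule extension_in_pr[OF S_kernelI[OF h k(1)]]) (use k(2) m a e Q(7) in auto)
  moreover have "g \<in> Fib" "g \<in> W"
    using Fib_base_change[OF P' e(1)] acyclic_base_change[OF P' e(1) eW] by auto
  \<comment> \<open>The complement of \<open>X\<close> is the injective \<open>J\<close>, on which
    \<open>G\<close> vanishes, so the projection to \<open>X\<close> is an acyclic fibration and can
    be composed with \<open>g\<close>.\<close>
  moreover have "q \<in> Fib" "q \<in> W"
  proof -
    have "Dom C u \<in> mho C S M" using injectives_mho j(3) B(2) by auto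
    then have "stz f" if "f \<in> Arr C" "Dom C f \<in> M" "Cod C f = Dom C u" for f
      using mho_stz that by blast
    then show "q \<in> Fib" "q \<in> W" using biprod_projection(1,2)[OF biprod_commute[OF B(1)]] by auto
  qed
  ultimately show ?thesis
    using Fib_comp[of g q] W_comp[of g q] Q(1-8) c' d(1-9) B
    by (intro exI[of _ "q \<cdot> g"]) auto
qed

text \<open>The deflation \<open>r \<cdot> p\<close> presents \<open>Z\<close>, so the point is that
  its kernel \<open>Dom C n\<close> lies in \<open>M\<close>. To this end the identity of
  \<open>Dom C n\<close> is written as a sum of a map through \<open>Dom C m\<close> and a map
  through \<open>Dom C p\<close>.\<close>

lemma pr_retract:
  assumes "X \<in> pr C S M" "in_hom r X Z" "in_hom s Z X" "r \<cdot> s = Id C Z"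
  shows "Z \<in> pr C S M"
proof -
  obtain m p where m: "(m, p) \<in> S" "Dom C m \<in> M" "Dom C p \<in> M" "Cod C p = X"
    using prE[OF assms(1)] by metis
  note L = S_D(3-6)[OF m(1)] and K = is_kernelD(5)[OF S_D(1)[OF m(1)]]
  obtain k t where B: "biprod s k r t" using retraction_biprod[of r s] assms(2-4) by auto
  have "deflation S r" using biprod_S[OF biprod_commute[OF B]] by (auto simp: deflation_def)
  moreover have "deflation S p" using m(1) by (auto simp: deflation_def)
  ultimately have "deflation S (r \<cdot> p)" by (intro deflation_comp) (use m assms(2) in auto)
  then obtain n where n: "(n, r \<cdot> p) \<in> S" by (auto simp: deflation_def)
  have N: "n \<in> Arr C" "Cod C n = Dom C p" "r \<cdot> (p \<cdot> n) = zero (Dom C n) Z"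
    using S_D(3-6)[OF n] L m assms(2) by auto
  note KN = is_kernelD(5,6)[OF S_D(1)[OF n]]
  have rsr: "r \<cdot> (s \<cdot> (r \<cdot> p)) = r \<cdot> p"
    using assms(2,3) L m by (simp add: comp_eq_assoc[OF assms(4)])
  \<comment> \<open>This is \<open>p\<close> followed by the idempotent \<open>1 - s r\<close> of
    \<open>X\<close>. As \<open>p\<close> has kernel in \<open>M\<close>, rigidity lifts it to an
    endomorphism \<open>h\<close> of \<open>Dom C p\<close>; as \<open>r\<close> kills it,
    \<open>h\<close> factors through the kernel \<open>n\<close>.\<close>
  let ?f = "p \<boxminus> s \<cdot> (r \<cdot> p)"
  have f: "in_hom ?f (Dom C p) X" using L m assms(2,3) by simp
  obtain h where h: "in_hom h (Dom C p) (Dom C p)" "p \<cdot> h = ?f"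
    using rigid_lift[OF rigid_M m(1,2), of ?f] f m by auto
  have "(r \<cdot> p) \<cdot> h = zero (Dom C p) Z" using h L m assms(2,3) rsr by simp
  then obtain h' where h': "in_hom h' (Dom C p) (Dom C n)" "n \<cdot> h' = h"
    using KN(1)[of h] h L m assms(2) by auto
  have "(r \<cdot> p) \<cdot> m = zero (Dom C m) Z" using L m assms(2) by simp
  then obtain m' where m': "in_hom m' (Dom C m) (Dom C n)" "n \<cdot> m' = m"
    using KN(1)[of m] L m assms(2) by auto
  \<comment> \<open>On the kernel of \<open>r \<cdot> p\<close> the correction
    \<open>s \<cdot> (r \<cdot> p)\<close> vanishes, so \<open>h \<cdot> n\<close> and
    \<open>n\<close> agree after \<open>p\<close> and their difference factors through
    \<open>m\<close>.\<close>
  have "p \<cdot> (h \<cdot> n) = p \<cdot> n" using h N L m assms(2,3) by (simp add: comp_eq_assoc[OF h(2)])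
  then have "p \<cdot> (n \<boxminus> h \<cdot> n) = zero (Dom C n) X" using h(1) N L m by simp
  then obtain t where t: "in_hom t (Dom C n) (Dom C m)" "m \<cdot> t = n \<boxminus> h \<cdot> n"
    using K[of "n \<boxminus> h \<cdot> n"] h N L m by auto
  have split: "m' \<cdot> t \<boxplus> h' \<cdot> n = Id C (Dom C n)"
  proof (rule KN(2))
    show "n \<cdot> (m' \<cdot> t \<boxplus> h' \<cdot> n) = n \<cdot> Id C (Dom C n)"
      using m' t h' N h(1) L by (simp add: comp_eq_assoc[OF m'(2)] comp_eq_assoc[OF h'(2)])
  qed (use m' t h' N in auto)
  obtain a b x y where B': "biprod a b x y" "Dom C a = Dom C m" "Dom C b = Dom C p"
    using biprod_exists[of "Dom C m" "Dom C p"] L by auto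
  note d = biprodD[OF B'(1)]
  \<comment> \<open>By \<open>split\<close>, this exhibits \<open>Dom C n\<close> as a retract of
    the biproduct of \<open>Dom C m\<close> and \<open>Dom C p\<close>, both in
    \<open>M\<close>.\<close>
  have "(m' \<cdot> x \<boxplus> h' \<cdot> y) \<cdot> (a \<cdot> t \<boxplus> b \<cdot> n) = m' \<cdot> t \<boxplus> h' \<cdot> n"
    using m' t h' N d(1-9) B' L
    by (simp add: comp_eq_assoc[OF d(10)] comp_eq_assoc[OF d(11)] comp_eq_assoc[OF d(12)] comp_eq_assoc[OF d(13)])
  with split have "Dom C n \<in> M"
    by (intro M_retract[of "m' \<cdot> x \<boxplus> h' \<cdot> y" "Dom C x" "Dom C n" "a \<cdot> t \<boxplus> b \<cdot> n"])
      (use m' t h' N d(1-9) B' L M_biprod[OF B'(1)] m in auto)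
  then show ?thesis using prI[OF n] L m assms(2) by simp
qed

end

section \<open>The prefibration structure and its cofibrant objects\<close>

theorem theorem0p3:
  fixes E :: "('o, 'm) cat" and S :: "('m \<times> 'm) set" and M :: "'o set"
  assumes "exact_category E S"
    and "weakly_idempotent_complete E"
    and "enough_injectives E S"
    and "enough_projectives E S"
    and "M \<subseteq> Obj E"
    and "rigid E S M"
    and "contravariantly_finite E M"
    and "injectives E S \<subseteq> M"
    and "closed_under_sums E M"
    and "closed_under_summands E M"
    and "contravariantly_finite E (mho E S M)"
  shows "\<exists>Fib W. W = G_weak_equivalences E S M \<and>
    abc_prefibration_no_existence E Fib W \<and>
    (has_pullbacks E \<longrightarrow> abc_prefibration E Fib W) \<and>
    (\<forall>X \<in> Obj E. fibrant E Fib X) \<and>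
    (\<forall>X \<in> Obj E. cofibrant E Fib W X \<longleftrightarrow> X \<in> pr E S M) \<and>
    (projectives E S \<subseteq> M \<longrightarrow> (\<forall>X \<in> Obj E. \<exists>w. cofibrant_replacement E Fib W X w))"
proof -
  interpret rigid_setting E S M
    using assms unfolding rigid_setting_def rigid_setting_axioms_def by blast
  have final: "\<exists>T. is_final E T" using zero_object by blast
  have fib: "fibrant E Fib X" if X: "X \<in> Obj E" for X
    unfolding fibrant_def
  proof (intro conjI allI impI subsetI)
    fix T f assume T: "is_final E T" and "f \<in> carrier (Hom E X T)"
    then have f: "in_hom f X T" using X carrier_Hom_iff by (simp add: is_final_def)
    show "f \<in> Fib"
    proof (rule FibI)
      fix v assume v: "v \<in> Arr E" "Dom E v \<in> mho E S M" "Cod E v = Cod E f"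
      \<comment> \<open>Maps into a final object are unique, so the zero map into \<open>X\<close>
        already lifts \<open>v\<close>.\<close>
      have "\<exists>!g. g \<in> carrier (Hom E (Dom E v) T)" using T v by (simp add: is_final_def)
      moreover have "f \<cdot>\<^bsub>E\<^esub> zero (Dom E v) X \<in> carrier (Hom E (Dom E v) T)"
        "v \<in> carrier (Hom E (Dom E v) T)"
        using carrier_Hom_iff[of "Dom E v" T] f v X T by (auto simp: is_final_def)
      ultimately have "f \<cdot>\<^bsub>E\<^esub> zero (Dom E v) X = v" by blast
      then show "\<exists>l. in_hom l (Dom E v) (Dom E f) \<and> f \<cdot>\<^bsub>E\<^esub> l = v"
        using f v X by (intro exI[of _ "zero (Dom E v) X"]) simp
    qed (use f in simp)
  qed (rule X)
  have cofib: "X \<in> pr E S M" if "cofibrant E Fib W X" for X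
  proof -
    have X: "X \<in> Obj E" using that by (simp add: cofibrant_def)
    obtain w where w: "w \<in> Fib" "w \<in> W" "Cod E w = X" "Dom E w \<in> pr E S M"
      using pr_resolution[OF X] by blast
    have "\<exists>l \<in> carrier (Hom E X (Dom E w)). w \<cdot>\<^bsub>E\<^esub> l = Id E X"
      using that w Arr_carrier[of "Id E X"] X unfolding cofibrant_def by simp
    then obtain l where "in_hom l X (Dom E w)" "w \<cdot>\<^bsub>E\<^esub> l = Id E X"
      using carrier_Hom_iff[OF X, of "Dom E w"] FibD(1)[OF w(1)] by auto
    then show ?thesis using pr_retract[OF w(4), of w X l] w(3) FibD(1)[OF w(1)] by simp
  qed
  have F1: "abc_F1 E Fib W"
    unfolding abc_F1_def using final fib Fib_comp iso_Fib_W by (auto simp: is_final_def)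
  have F2: "abc_F2 E W"
    unfolding abc_F2_def using W_comp W_cancel_right W_cancel_left by blast
  have F3: "abc_F3 E Fib W"
    unfolding abc_F3_def using Fib_retract W_retract by blast
  have F4: "abc_F4_base_change E Fib W"
    unfolding abc_F4_base_change_def using Fib_base_change acyclic_base_change by blast
  have F5: "abc_F5 E Fib W"
    unfolding abc_F5_def using factorization by blast
  have Arr: "Fib \<subseteq> Arr E" "W \<subseteq> Arr E" using FibD(1) WD(1) by auto
  \<comment> \<open>An acyclic fibration from an object of \<open>pr M\<close> is a weak equivalence
    with cofibrant source.\<close>
  have repl: "\<exists>w. cofibrant_replacement E Fib W X w" if "X \<in> Obj E" for X
    unfolding cofibrant_replacement_def using pr_resolution[OF that] pr_cofibrant by blast
  show ?thesis
  proof (intro exI conjI)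
    show "W = G_weak_equivalences E S M" ..
    show "abc_prefibration_no_existence E Fib W"
      unfolding abc_prefibration_no_existence_def using Arr F1 F2 F3 F4 F5 by blast
    \<comment> \<open>Base change has been proved for every square that exists, so (F4) asks only
      for existence in addition.\<close>
    show "has_pullbacks E \<longrightarrow> abc_prefibration E Fib W"
      unfolding abc_prefibration_def abc_F4_def using Arr F1 F2 F3 F4 F5 by blast
  qed (use fib cofib pr_cofibrant repl in blast)+
qed

end
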